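(* Let $A$ be a unital commutative associative $\mathbb{F}$-algebra such that $A\otimes A$ is an integral domain, and let $V=\mathscr{W}_A(\Gamma)\otimes\mathscr{W}_A(\Gamma)$, regarded as a $\mathscr{W}_A(\Gamma)$-module under the adjoint diagonal action. Every derivation from $\mathscr{W}_A(\Gamma)$ to $V$ is inner, i.e., $H^1(\mathscr{W}_A(\Gamma),V)=0$.
   Context: $\mathbb{F}$ is a field of characteristic zero; all tensor products are over $\mathbb{F}$. $\Gamma$ is an additive subgroup of $\mathbb{F}$ with $1\in\Gamma$. The group algebra $\mathbb{F}[\Gamma]$ has basis $\{e^\alpha\mid\alpha\in\Gamma\}$, and $\partial$ is the operator $\partial(e^\alpha)=\alpha e^\alpha$; $\mathscr{W}(\Gamma)=\mathbb{F}[\Gamma]\partial$, with basis $L_\alpha=e^\alpha\partial$. The generalized map Virasoro algebra is $\mathscr{W}_A(\Gamma)=\mathscr{W}(\Gamma)\otimes A$; it is spanned by the elements $L_\alpha x=e^\alpha\partial\otimes x$ ($\alpha\in\Gamma$, $x\in A$), with bracket $[L_\alpha x,L_\beta y]=(\beta-\alpha)L_{\alpha+\beta}xy$. The adjoint diagonal action is $x\cdot(a\otimes b)=[x,a]\otimes b+a\otimes[x,b]$. A derivation from a Lie algebra $L$ to an $L$-module $V$ is a linear map $D:L\to V$ with $D([x,y])=x\cdot D(y)-y\cdot D(x)$; it is inner if there is $v\in V$ with $D(x)=x\cdot v$ for all $x\in L$. $H^1(L,V)\cong\mathrm{Der}(L,V)/\mathrm{Inn}(L,V)$, the quotient of the space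 of derivations by the space of inner derivations. *)

theory Defs
  imports
    "HOL-Library.Poly_Mapping"
    "HOL-Library.FuncSet"
    "HOL-Algebra.Module"
    "HOL-Algebra.QuotRing"
    "HOL-Algebra.Algebraic_Closure_Type"
begin

text \<open>
  The ground field is a type \<open>'f\<close> of class \<^class>\<open>field_char_0\<close>; vector spaces and algebras over it
  are \<^type>\<open>module\<close> records of HOL-Algebra with scalars \<^const>\<open>ring_of_type_algebra\<close>.
  The field \<^const>\<open>monoid.mult\<close> of such a record holds whatever bilinear product the space carries: the
  associative product of an algebra, or the bracket of a Lie algebra. A Lie algebra has no unit, so
  there the field \<^const>\<open>monoid.one\<close> is unused.
\<close>

abbreviation scale_pm :: "'f \<Rightarrow> ('x \<Rightarrow>\<^sub>0 'f) \<Rightarrow> ('x \<Rightarrow>\<^sub>0 'f::field)"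
  where "scale_pm c \<equiv> Poly_Mapping.map ((*) c)"

definition quotient_module :: "('f, 'b, 'm) module_scheme \<Rightarrow> 'b set \<Rightarrow> ('f, 'b set) module" where
  "quotient_module M N =
     \<lparr> carrier = a_rcosets\<^bsub>M\<^esub> N, monoid.mult = rcoset_mult M N, one = N +>\<^bsub>M\<^esub> \<one>\<^bsub>M\<^esub>,
       zero = N, add = set_add M,
       module.smult = (\<lambda>c S. \<Union>x\<in>S. N +>\<^bsub>M\<^esub> (c \<odot>\<^bsub>M\<^esub> x)) \<rparr>"


section \<open>Tensor products over the ground field\<close>

text \<open>
  The tensor product is the vector space with basis the pairs \<open>(u, v)\<close>, modulo the bilinearity
  relations. On basis elements the product is \<open>(u, v) (u', v') = (u u', v v')\<close>, so that on
  cosets it is the usual product of a tensor product of (not necessarily associative) algebras.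
\<close>

definition free_pairs ::
  "('f::field, 'u, 'm) module_scheme \<Rightarrow> ('f, 'v, 'n) module_scheme \<Rightarrow> ('f, 'u \<times> 'v \<Rightarrow>\<^sub>0 'f) module" where
  "free_pairs M N =
     \<lparr> carrier = {p. Poly_Mapping.keys p \<subseteq> carrier M \<times> carrier N},
       monoid.mult = (\<lambda>p q. \<Sum>(u, v)\<in>Poly_Mapping.keys p. \<Sum>(u', v')\<in>Poly_Mapping.keys q.
                 Poly_Mapping.single (u \<otimes>\<^bsub>M\<^esub> u', v \<otimes>\<^bsub>N\<^esub> v') (Poly_Mapping.lookup p (u, v) * Poly_Mapping.lookup q (u', v'))),
       one = Poly_Mapping.single (\<one>\<^bsub>M\<^esub>, \<one>\<^bsub>N\<^esub>) 1,
       zero = 0, add = (+), module.smult = scale_pm \<rparr>"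

abbreviation pair_pm :: "'u \<Rightarrow> 'v \<Rightarrow> ('u \<times> 'v \<Rightarrow>\<^sub>0 'f::field)"
  where "pair_pm u v \<equiv> Poly_Mapping.single (u, v) 1"

definition bilinear_relations ::
  "('f::field, 'u, 'm) module_scheme \<Rightarrow> ('f, 'v, 'n) module_scheme \<Rightarrow> ('u \<times> 'v \<Rightarrow>\<^sub>0 'f) set" where
  "bilinear_relations M N = module.span scale_pm
     ({pair_pm (u \<oplus>\<^bsub>M\<^esub> u') v - pair_pm u v - pair_pm u' v | u u' v.
         u \<in> carrier M \<and> u' \<in> carrier M \<and> v \<in> carrier N} \<union>
      {pair_pm u (v \<oplus>\<^bsub>N\<^esub> v') - pair_pm u v - pair_pm u v' | u v v'.
         u \<in> carrier M \<and> v \<in> carrier N \<and> v' \<in> carrier N} \<union>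
      {pair_pm (c \<odot>\<^bsub>M\<^esub> u) v - scale_pm c (pair_pm u v) | c u v.
         u \<in> carrier M \<and> v \<in> carrier N} \<union>
      {pair_pm u (c \<odot>\<^bsub>N\<^esub> v) - scale_pm c (pair_pm u v) | c u v.
         u \<in> carrier M \<and> v \<in> carrier N})"

definition tensor_product ::
  "('f::field, 'u, 'm) module_scheme \<Rightarrow> ('f, 'v, 'n) module_scheme \<Rightarrow> ('f, ('u \<times> 'v \<Rightarrow>\<^sub>0 'f) set) module" where
  "tensor_product M N = quotient_module (free_pairs M N) (bilinear_relations M N)"

text \<open>The endomorphism \<open>f \<otimes> g\<close> of the tensor product, for linear endomorphisms \<open>f\<close> and \<open>g\<close>.\<close>

definition tensor_map ::
  "('f::field, 'u, 'm) module_scheme \<Rightarrow> ('f, 'v, 'n) module_scheme \<Rightarrow> ('u \<Rightarrow> 'u) \<Rightarrow> ('v \<Rightarrow> 'v) \<Rightarrow>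
   ('u \<times> 'v \<Rightarrow>\<^sub>0 'f) set \<Rightarrow> ('u \<times> 'v \<Rightarrow>\<^sub>0 'f) set" where
  "tensor_map M N f g S =
     (\<Union>p\<in>S. bilinear_relations M N +>\<^bsub>free_pairs M N\<^esub>
        (\<Sum>(u, v)\<in>Poly_Mapping.keys p. Poly_Mapping.single (f u, g v) (Poly_Mapping.lookup p (u, v))))"


section \<open>Derivations of a Lie algebra into a module\<close>

definition linear_between ::
  "('f, 'u, 'm) module_scheme \<Rightarrow> ('f, 'v, 'n) module_scheme \<Rightarrow> ('u \<Rightarrow> 'v) \<Rightarrow> bool" where
  "linear_between M N h \<longleftrightarrow>
     h \<in> carrier M \<rightarrow> carrier N \<and>
     (\<forall>x\<in>carrier M. \<forall>y\<in>carrier M. h (x \<oplus>\<^bsub>M\<^esub> y) = h x \<oplus>\<^bsub>N\<^esub> h y) \<and>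
     (\<forall>c. \<forall>x\<in>carrier M. h (c \<odot>\<^bsub>M\<^esub> x) = c \<odot>\<^bsub>N\<^esub> h x)"

definition lie_derivation ::
  "('f, 'l, 'm) module_scheme \<Rightarrow> ('f, 'v, 'n) module_scheme \<Rightarrow> ('l \<Rightarrow> 'v \<Rightarrow> 'v) \<Rightarrow> ('l \<Rightarrow> 'v) \<Rightarrow> bool" where
  "lie_derivation L V act D \<longleftrightarrow>
     linear_between L V D \<and>
     (\<forall>x\<in>carrier L. \<forall>y\<in>carrier L. D (x \<otimes>\<^bsub>L\<^esub> y) = act x (D y) \<ominus>\<^bsub>V\<^esub> act y (D x))"

definition inner_derivation ::
  "('f, 'l, 'm) module_scheme \<Rightarrow> ('f, 'v, 'n) module_scheme \<Rightarrow> ('l \<Rightarrow> 'v \<Rightarrow> 'v) \<Rightarrow> ('l \<Rightarrow> 'v) \<Rightarrow> bool" where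
  "inner_derivation L V act D \<longleftrightarrow>
     lie_derivation L V act D \<and> (\<exists>v\<in>carrier V. \<forall>x\<in>carrier L. D x = act x v)"

text \<open>
  A function on the carrier of \<open>L\<close> is represented by its extension by \<^const>\<open>undefined\<close>, so that
  equal derivations are equal as HOL functions.
\<close>

definition Der_module ::
  "('f, 'l, 'm) module_scheme \<Rightarrow> ('f, 'v, 'n) module_scheme \<Rightarrow> ('l \<Rightarrow> 'v \<Rightarrow> 'v) \<Rightarrow> ('f, 'l \<Rightarrow> 'v) module" where
  "Der_module L V act =
     \<lparr> carrier = {D \<in> extensional (carrier L). lie_derivation L V act D},
       monoid.mult = undefined, one = undefined,
       zero = (\<lambda>x\<in>carrier L. \<zero>\<^bsub>V\<^esub>),
       add = (\<lambda>D E. \<lambda>x\<in>carrier L. D x \<oplus>\<^bsub>V\<^esub> E x),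
       module.smult = (\<lambda>c D. \<lambda>x\<in>carrier L. c \<odot>\<^bsub>V\<^esub> D x) \<rparr>"

definition Inn ::
  "('f, 'l, 'm) module_scheme \<Rightarrow> ('f, 'v, 'n) module_scheme \<Rightarrow> ('l \<Rightarrow> 'v \<Rightarrow> 'v) \<Rightarrow> ('l \<Rightarrow> 'v) set" where
  "Inn L V act = {D \<in> extensional (carrier L). inner_derivation L V act D}"

definition H1 ::
  "('f, 'l, 'm) module_scheme \<Rightarrow> ('f, 'v, 'n) module_scheme \<Rightarrow> ('l \<Rightarrow> 'v \<Rightarrow> 'v) \<Rightarrow> ('f, ('l \<Rightarrow> 'v) set) module" where
  "H1 L V act = quotient_module (Der_module L V act) (Inn L V act)"

definition adjoint_diagonal_action ::
  "('f::field, 'l, 'm) module_scheme \<Rightarrow> 'l \<Rightarrow> ('l \<times> 'l \<Rightarrow>\<^sub>0 'f) set \<Rightarrow> ('l \<times> 'l \<Rightarrow>\<^sub>0 'f) set" where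
  "adjoint_diagonal_action L x v =
     tensor_map L L (\<lambda>a. x \<otimes>\<^bsub>L\<^esub> a) (\<lambda>b. b) v
       \<oplus>\<^bsub>tensor_product L L\<^esub> tensor_map L L (\<lambda>a. a) (\<lambda>b. x \<otimes>\<^bsub>L\<^esub> b) v"


section \<open>The generalized map Virasoro algebra\<close>

text \<open>
  Elements of the group algebra of \<open>(\<Gamma>, +)\<close> are finitely supported functions, with the
  convolution product of \<^type>\<open>poly_mapping\<close>, and \<open>e\<^sup>\<alpha> = single \<alpha> 1\<close>.
  \<open>euler_op\<close> is the operator \<open>\<partial>\<close>, \<open>\<partial>(e\<^sup>\<alpha>) = \<alpha> e\<^sup>\<alpha>\<close>.
\<close>

definition euler_op :: "('f \<Rightarrow>\<^sub>0 'f) \<Rightarrow> ('f \<Rightarrow>\<^sub>0 'f::field)" where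
  "euler_op p = Poly_Mapping.mapp (\<lambda>\<alpha> c. \<alpha> * c) p"

text \<open>
  The operator \<open>p \<partial>\<close> is represented by its coefficient \<open>p\<close> in the group algebra; the product is
  the commutator \<open>[p \<partial>, q \<partial>] = (p \<partial>(q) - q \<partial>(p)) \<partial>\<close>.
\<close>

definition witt_algebra :: "'f set \<Rightarrow> ('f::field, 'f \<Rightarrow>\<^sub>0 'f) module" where
  "witt_algebra \<Gamma> =
     \<lparr> carrier = {p. Poly_Mapping.keys p \<subseteq> \<Gamma>},
       monoid.mult = (\<lambda>p q. p * euler_op q - q * euler_op p), one = undefined,
       zero = 0, add = (+), module.smult = scale_pm \<rparr>"

text \<open>
  The element \<open>L\<^sub>\<alpha> x\<close> is the class of the pair \<open>(e\<^sup>\<alpha>, x)\<close>. The bracket is the product of the tensor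
  product, \<open>[p \<partial> \<otimes> x, q \<partial> \<otimes> y] = [p \<partial>, q \<partial>] \<otimes> x y\<close>, which gives
  \<open>[L\<^sub>\<alpha> x, L\<^sub>\<beta> y] = (\<beta> - \<alpha>) L\<^bsub>\<alpha>+\<beta>\<^esub> x y\<close>.
\<close>

definition map_virasoro ::
  "'f set \<Rightarrow> ('f::field, 'a, 'm) module_scheme \<Rightarrow> ('f, (('f \<Rightarrow>\<^sub>0 'f) \<times> 'a \<Rightarrow>\<^sub>0 'f) set) module" where
  "map_virasoro \<Gamma> A = tensor_product (witt_algebra \<Gamma>) A"

end

theory Submission
  imports Defs
begin

text \<open>
  Write \<open>L\<close> for the generalized map Virasoro algebra, \<open>V\<close> for \<open>L \<otimes> L\<close>, and \<open>L\<^sub>\<alpha> a\<close> for the class of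
  \<open>e\<^sup>\<alpha> \<partial> \<otimes> a\<close>. A bilinear form \<open>l\<close> on \<open>A\<close> turns an element \<open>w\<close> of \<open>V\<close> into a finitely supported
  function \<open>coord l w\<close> of two variables: its value at \<open>(\<alpha>, \<beta>)\<close> is \<open>l\<close> applied to the component of
  \<open>w\<close> along \<open>L\<^sub>\<alpha> \<otimes> L\<^sub>\<beta>\<close>. These functions, for all \<open>l\<close> together, determine \<open>w\<close>
  (\<open>coord_separates\<close>), and \<open>L\<^sub>n 1\<close> acts on all of them by one scalar formula, \<open>witt_act n\<close>. So a
  derivation \<open>D\<close>, restricted to the elements \<open>L\<^sub>n 1\<close> with \<open>n\<close> an integer, is a family of scalar
  cocycles \<open>d\<close> of the integral Witt algebra.

  Such a cocycle has an explicit primitive \<open>v\<close>. Where \<open>\<alpha> + \<beta> \<noteq> 0\<close>, the operator of \<open>L\<^sub>0\<close> is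
  multiplication by \<open>\<alpha> + \<beta>\<close>, so \<open>v = d 0 / (\<alpha> + \<beta>)\<close>. On the line \<open>\<alpha> + \<beta> = 0\<close> put \<open>v(\<alpha>)\<close> for
  \<open>v \<alpha> (-\<alpha>)\<close>. The values of \<open>d 1\<close> at two neighbouring points and of \<open>d 2\<close> at one point are three
  linear expressions in \<open>v(\<alpha>)\<close>, \<open>v(\<alpha> - 1)\<close>, \<open>v(\<alpha> - 2)\<close>; the determinant of this system is, up to
  sign, the constant 12. Hence \<open>v\<close> depends on \<open>d 1\<close> and \<open>d 2\<close> by a local formula with polynomial
  coefficients (\<open>cocycle_primitive\<close>). No division by a function of \<open>\<alpha>\<close> occurs on this line, the
  support stays finite, and one element of \<open>V\<close> realises the formula for all forms \<open>l\<close> at once.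

  After subtracting the coboundary of \<open>v\<close>, the local formula vanishes on the remaining cocycle, and
  then the cocycle vanishes too (\<open>cocycle_with_zero_primitive_vanishes\<close>). The cocycle identities
  split it along the cosets of the integers. On a coset other than the integers themselves, the
  lowest point of the support gives a contradiction. On the integers, where the leading
  coefficients of the recurrences have zeros, the cocycle is shown to be the coboundary of a
  function \<open>w\<close>, possibly of infinite support, and the local formula computes \<open>w = 0\<close>.

  Thus \<open>D - (\<lambda>x. x \<cdot> v)\<close> kills \<open>L\<^sub>n 1\<close> for integers \<open>n\<close>, and the value \<open>f\<close> of this difference at \<open>L\<^sub>\<gamma> a\<close> is an
  eigenvector of \<open>L\<^bsub>-n\<^esub> L\<^sub>n\<close>, with eigenvalue \<open>(\<gamma> - n) (\<gamma> + 2 n)\<close>, for every integer \<open>n\<close>. For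
  generic \<open>n\<close> that operator carries the support of \<open>f\<close> away from itself by \<open>(n, -n)\<close> with nonzero
  coefficients, so \<open>f = 0\<close> (\<open>witt_eigenfunction_vanishes\<close>). Since the elements \<open>L\<^sub>\<gamma> a\<close> span \<open>L\<close>,
  \<open>D\<close> is inner.
\<close>

section \<open>Cocycles on functions of two variables\<close>

text \<open>
  A finitely supported function vanishes at all sufficiently small integers, so induction upwards
  can start without a base case.
\<close>

lemma int_from_below:
  fixes f :: "int \<Rightarrow> 'b::zero"
  assumes fin: "finite {k. f k \<noteq> 0}"
    and step: "\<And>k. k < b \<Longrightarrow> (\<And>j. j < k \<Longrightarrow> f j = 0) \<Longrightarrow> f k = 0"
    and "k < b"
  shows "f k = 0"
proof (rule ccontr)
  assume "f k \<noteq> 0"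
  define S where "S = {j. f j \<noteq> 0 \<and> j < b}"
  have S: "finite S" "k \<in> S"
    using fin \<open>f k \<noteq> 0\<close> \<open>k < b\<close> by (auto simp: S_def)
  then have "Min S \<in> S"
    using Min_in by blast
  moreover have "f j = 0" if "j < Min S" for j
  proof (rule ccontr)
    assume "f j \<noteq> 0"
    then have "j \<in> S"
      using that \<open>Min S \<in> S\<close> by (simp add: S_def)
    then show False
      using that Min_le[OF S(1), of j] by linarith
  qed
  moreover have "f (Min S) \<noteq> 0" "Min S < b"
    using \<open>Min S \<in> S\<close> unfolding S_def by blast+
  ultimately show False
    using step[of "Min S"] by blast
qed

text \<open>
  Here \<open>e1\<close>, \<open>e2\<close>, \<open>f1\<close>, \<open>f2\<close> are the components of a degree-zero cocycle for the indices 1, 2,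
  -1, -2, along the coset of \<open>a\<close>: the integer \<open>k\<close> stands for the first exponent \<open>a + k\<close>. \<open>R1\<close>,
  \<open>R2\<close>, \<open>R3\<close> are the cocycle identities for the index pairs (1, -1), (-1, 2), (1, -2), and \<open>N\<close> says
  that the local formula for the primitive gives zero. At the lowest point \<open>b\<close> of the support of
  \<open>e1\<close>, \<open>R1\<close> determines \<open>f1 (b - 1)\<close> and \<open>R2\<close> determines \<open>e2 b\<close>, because no integer shift of \<open>a\<close> is
  zero; inserting both into \<open>N\<close> leaves \<open>12 * e1 b = 0\<close>.
\<close>

lemma normalised_cocycle_vanishes_off_Ints:
  fixes a :: "'f::field_char_0" and e1 e2 f1 f2 :: "int \<Rightarrow> 'f"
  assumes R1: "\<And>k. (a + of_int k - 2) * f1 (k - 1) - (a + of_int k + 2) * f1 k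
                 = (a + of_int k + 2) * e1 (k + 1) + (2 - a - of_int k) * e1 k"
    and R2: "\<And>k. 3 * e1 k = (a + of_int k + 2) * e2 (k + 1) + (3 - a - of_int k) * e2 k
                 - (a + of_int k - 4) * f1 (k - 2) + (a + of_int k + 3) * f1 k"
    and R3: "\<And>k. - 3 * f1 k = (a + of_int k - 2) * f2 (k - 1) - (a + of_int k + 3) * f2 k
                 - (a + of_int k + 4) * e1 (k + 2) - (3 - a - of_int k) * e1 k"
    and N: "\<And>k. (a + of_int k - 2) * (a + of_int k - 3) * e2 k
              = (a + of_int k - 2) * (a + of_int k - 4) * e1 (k - 1)
                + (a + of_int k) * (a + of_int k - 4) * e1 k"
    and fin: "finite {k. e1 k \<noteq> 0}" "finite {k. e2 k \<noteq> 0}" "finite {k. f1 k \<noteq> 0}" "finite {k. f2 k \<noteq> 0}"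
    and a: "a \<notin> \<int>"
  shows "e1 k = 0 \<and> e2 k = 0 \<and> f1 k = 0 \<and> f2 k = 0"
proof -
  have nz: "a + of_int k \<noteq> 0" for k
    using a by (metis Ints_minus Ints_of_int add_eq_0_iff2)
  have nz2: "a + of_int k + 2 \<noteq> 0" "a + of_int k + 3 \<noteq> 0" "a + of_int k + 1 \<noteq> 0" for k
    using nz[of "k + 2"] nz[of "k + 3"] nz[of "k + 1"] by (simp_all add: add.assoc)
  have f1_below: "f1 j = 0" if "\<And>i. i \<le> c \<Longrightarrow> e1 i = 0" "j < c" for j c
  proof (rule int_from_below[where f = f1 and b = c])
    fix k assume k: "k < c" and below: "\<And>j. j < k \<Longrightarrow> f1 j = 0"
    have "f1 (k - 1) = 0" "e1 k = 0" "e1 (k + 1) = 0"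
      using below[of "k - 1"] that(1)[of k] that(1)[of "k + 1"] k by auto
    then have "(a + of_int k + 2) * f1 k = 0"
      using R1[of k] by simp
    then show "f1 k = 0"
      using nz2(1)[of k] by simp
  qed (use fin that in simp_all)
  have e2_below: "e2 j = 0" if "\<And>i. i < c \<Longrightarrow> e1 i = 0" "j < c" for j c
  proof (rule int_from_below[where f = e2 and b = c])
    fix k assume k: "k < c" and below: "\<And>j. j < k \<Longrightarrow> e2 j = 0"
    have "f1 j = 0" if "j < c - 1" for j
      by (rule f1_below[where c = "c - 1"]) (use \<open>\<And>i. i < c \<Longrightarrow> e1 i = 0\<close> that in auto)
    then have "e2 (k - 1) = 0" "e1 (k - 1) = 0" "f1 (k - 1) = 0" "f1 (k - 3) = 0"
      using below[of "k - 1"] that(1)[of "k - 1"] k by auto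
    then have "(a + of_int (k - 1) + 2) * e2 k = 0"
      using R2[of "k - 1"] by simp
    then show "e2 k = 0"
      using nz2(1)[of "k - 1"] by simp
  qed (use fin that in simp_all)
  have e1: "e1 k = 0" for k
  proof (rule int_from_below[where b = "k + 1"])
    fix b assume below: "\<And>j. j < b \<Longrightarrow> e1 j = 0"
    have f: "f1 (b - 2) = 0" "f1 (b - 3) = 0"
      by (rule f1_below[where c = "b - 1"]; use below in simp)+
    have g: "e2 (b - 1) = 0"
      by (rule e2_below[where c = b]) (use below in simp_all)
    define x where "x = a + of_int b"
    have x: "x + 1 \<noteq> 0"
      using nz2(3)[of b] by (simp add: x_def)
    have "- (x + 1) * f1 (b - 1) = (x + 1) * e1 b"
      using R1[of "b - 1"] f below[of "b - 1"] by (simp add: x_def algebra_simps)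
    moreover have "(x + 1) * (f1 (b - 1) + e1 b) = (x + 1) * e1 b - (- (x + 1) * f1 (b - 1))"
      by (simp add: algebra_simps)
    ultimately have r1: "f1 (b - 1) = - e1 b"
      using x by (simp add: add_eq_0_iff2)
    have "0 = (x + 1) * e2 b + (x + 2) * f1 (b - 1)"
      using R2[of "b - 1"] f g below[of "b - 1"] by (simp add: x_def algebra_simps)
    then have r2: "(x + 1) * e2 b = (x + 2) * e1 b"
      unfolding r1 by simp
    have n: "(x - 2) * (x - 3) * e2 b = x * (x - 4) * e1 b"
      using N[of b] below[of "b - 1"] by (simp add: x_def)
    have "12 * e1 b = (x + 1) * ((x - 2) * (x - 3) * e2 b - x * (x - 4) * e1 b)
            - (x - 2) * (x - 3) * ((x + 1) * e2 b - (x + 2) * e1 b)"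
      by (simp add: algebra_simps)
    also have "\<dots> = 0"
      unfolding n r2 by simp
    finally have "12 * e1 b = 0" .
    then show "e1 b = 0" by simp
  qed (use fin in simp_all)
  have f1: "f1 k = 0" for k
    by (rule f1_below[where c = "k+1"]) (use e1 in auto)
  have e2: "e2 k = 0" for k
    by (rule e2_below[where c = "k+1"]) (use e1 in auto)
  have "f2 k = 0"
  proof (rule int_from_below[where f = f2 and b = "k + 1"])
    fix k assume "\<And>j. j < k \<Longrightarrow> f2 j = 0"
    then have "f2 (k - 1) = 0"
      by simp
    then have "(a + of_int k + 3) * f2 k = 0"
      using R3[of k] by (simp add: e1 f1)
    then show "f2 k = 0"
      using nz2(2)[of k] by simp
  qed (use fin in simp_all)
  with e1 f1 e2 show ?thesis by simp
qed

text \<open>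
  The recurrence \<open>(k - 2) * w (k - 1) - (k + 1) * w k = e k\<close> breaks at \<open>k = 2\<close> and \<open>k = -1\<close>, where it
  prescribes \<open>w 2\<close> and \<open>w (-2)\<close>. From there it can be solved upwards and downwards, and between
  them one parameter, the value \<open>w (-1)\<close>, remains free. It is used to prescribe the combination
  \<open>5 * w (-3) + w (-1)\<close>, which is the value at -3 of the action of index -2 on \<open>w\<close>.
\<close>

lemma L1_surjective_on_int_functions:
  fixes e :: "int \<Rightarrow> 'f::field_char_0"
  shows "\<exists>w. 5 * w (-3) + w (-1) = c \<and> (\<forall>k. (of_int k - 2) * w (k - 1) - (of_int k + 1) * w k = e k)"
proof -
  define up where "up = rec_nat (- e 2 / 3)
     (\<lambda>n x. ((of_nat n + 1) * x - e (int n + 3)) / (of_nat n + 4))"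
  define dn where "dn = rec_nat (- e (-1) / 3)
     (\<lambda>n x. ((of_nat n + 1) * x - e (- 2 - int n)) / (of_nat n + 4))"
  define c' where "c' = c - 5 * dn 1"
  define w where "w k = (if k \<ge> 2 then up (nat (k - 2)) else if k \<le> -2 then dn (nat (- 2 - k))
      else if k = -1 then c' else if k = 0 then - 2 * c' - e 0 else (2 * c' + e 0 - e 1) / 2)" for k :: int
  have nz: "of_nat n + 4 \<noteq> (0::'f)" for n
    by (metis of_nat_add of_nat_eq_0_iff of_nat_numeral add_is_0 zero_neq_numeral)
  have up0: "up 0 = - e 2 / 3" and dn0: "dn 0 = - e (-1) / 3"
    by (simp_all add: up_def dn_def)
  have upS: "(of_nat n + 4) * up (Suc n) = (of_nat n + 1) * up n - e (int n + 3)" for n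
    using nz[of n] by (simp add: up_def)
  have dnS: "(of_nat n + 4) * dn (Suc n) = (of_nat n + 1) * dn n - e (- 2 - int n)" for n
    using nz[of n] by (simp add: dn_def)
  have "(of_int k - 2) * w (k - 1) - (of_int k + 1) * w k = e k" for k
  proof -
    consider n where "k = int n + 3" | n where "k = - 2 - int n" | "k = -1" | "k = 0" | "k = 1" | "k = 2"
    proof -
      have "k \<ge> 3 \<or> k \<le> -2 \<or> k = -1 \<or> k = 0 \<or> k = 1 \<or> k = 2" by linarith
      moreover have "\<exists>n. k = int n + 3" if "k \<ge> 3"
        by (rule exI[of _ "nat (k - 3)"]) (use that in simp)
      moreover have "\<exists>n. k = - 2 - int n" if "k \<le> -2"
        by (rule exI[of _ "nat (- 2 - k)"]) (use that in simp)
      ultimately show ?thesis using that by blast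
    qed
    then show ?thesis
    proof cases
      case (1 n)
      have "w (k - 1) = up n" "w k = up (Suc n)"
        by (simp_all add: w_def 1 nat_add_distrib)
      then show ?thesis using upS[of n] by (simp add: 1 algebra_simps)
    next
      case (2 n)
      have "w k = dn n" "w (k - 1) = dn (Suc n)"
        by (simp_all add: w_def 2 nat_add_distrib)
      then show ?thesis using dnS[of n] by (simp add: 2 algebra_simps)
    qed (simp_all add: w_def up0 dn0 field_simps)
  qed
  then show ?thesis
    by (intro exI[of _ w]) (simp add: w_def c'_def)
qed

lemma int_vanish_up:
  fixes f :: "int \<Rightarrow> 'b::zero"
  assumes "f c = 0" "\<And>k. k > c \<Longrightarrow> f (k - 1) = 0 \<Longrightarrow> f k = 0" "k \<ge> c"
  shows "f k = 0"
  using assms(3)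
proof (induction rule: int_ge_induct)
  case (step i)
  then show ?case using assms(2)[of "i + 1"] by simp
qed (fact assms(1))

lemma int_vanish_down:
  fixes f :: "int \<Rightarrow> 'b::zero"
  assumes "f c = 0" "\<And>k. k < c \<Longrightarrow> f (k + 1) = 0 \<Longrightarrow> f k = 0" "k \<le> c"
  shows "f k = 0"
  using assms(3)
proof (induction rule: int_le_induct)
  case (step i)
  then show ?case using assms(2)[of "i - 1"] by simp
qed (fact assms(1))

text \<open>
  The situation on the integers after the component of index 1 has been made zero: \<open>g2\<close>, \<open>h1\<close>, \<open>h2\<close>
  are the components for 2, -1, -2, and \<open>R1\<close> to \<open>R4\<close> are the identities for the index pairs (1, -1),
  (-1, 2), (1, -2), (2, -2). By \<open>R1\<close>, the function \<open>h1\<close> lives on \<open>{-2..1}\<close> and is a multiple of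
  (1, -3, 3, -1). A nonzero multiple would make \<open>g2 (-4)\<close> nonzero by \<open>R2\<close>, whereas \<open>R4\<close> at -4,
  with \<open>h2 (-6) = 0\<close> from \<open>R3\<close>, says that it is zero. The functions may have infinite support, as
  subtracting the coboundary of \<open>w\<close> from \<open>L1_surjective_on_int_functions\<close> produces such functions.
  The condition on \<open>h2 (-3)\<close> removes the coboundaries of functions killed by index 1.
\<close>

lemma reduced_cocycle_vanishes_on_Ints:
  fixes g1 g2 h1 h2 :: "int \<Rightarrow> 'f::field_char_0"
  assumes R1: "\<And>k. (of_int k - 2) * h1 (k - 1) - (of_int k + 2) * h1 k = 0"
    and R2: "\<And>k. 0 = (of_int k + 2) * g2 (k + 1) + (3 - of_int k) * g2 k
                 - (of_int k - 4) * h1 (k - 2) + (of_int k + 3) * h1 k"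
    and R3: "\<And>k. - 3 * h1 k = (of_int k - 2) * h2 (k - 1) - (of_int k + 3) * h2 k"
    and R4: "\<And>k. 0 = (of_int k - 4) * h2 (k - 2) - (of_int k + 4) * h2 k
                 - (of_int k + 4) * g2 (k + 2) - (4 - of_int k) * g2 k"
    and u: "h2 (-3) = 0"
  shows "g2 k = 0 \<and> h1 k = 0 \<and> h2 k = 0"
proof -
  have nz: "of_int k + of_int c \<noteq> (0::'f)" if "k \<noteq> -c" for k c :: int
    using that by (metis add_eq_0_iff2 of_int_add of_int_eq_0_iff)
  have [simp]: "of_int k - numeral c = (0::'f) \<longleftrightarrow> k = numeral c"
    "of_int k + numeral c = (0::'f) \<longleftrightarrow> k = - numeral c"
    "numeral c - of_int k = (0::'f) \<longleftrightarrow> k = numeral c" for k c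
    using nz[of k "numeral c"] nz[of k "- numeral c"] by auto
  have h1_up: "h1 k = 0" if "k \<ge> 2" for k
  proof (rule int_vanish_up[OF _ _ that])
    show "h1 2 = 0" using R1[of 2] by simp
    show "h1 k = 0" if "k > 2" "h1 (k - 1) = 0" for k
      using R1[of k] that by simp
  qed
  have h1_down: "h1 k = 0" if "k \<le> -3" for k
  proof (rule int_vanish_down[OF _ _ that])
    show "h1 (-3) = 0" using R1[of "-2"] by simp
    show "h1 k = 0" if "k < -3" "h1 (k + 1) = 0" for k
      using R1[of "k+1"] that nz[of k "-1"] by simp
  qed
  have h2_4: "h2 (-4) = 0"
    using R3[of "-3"] h1_down[of "-3"] by simp
  have h2_down: "h2 k = 0" if "k \<le> -4" for k
  proof (rule int_vanish_down[where f = h2, OF _ _ that])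
    show "h2 (-4) = 0" by (fact h2_4)
    show "h2 k = 0" if "k < -4" "h2 (k + 1) = 0" for k
      using R3[of "k+1"] that nz[of k "-1"] h1_down[of "k+1"] by simp
  qed
  have "g2 (-4) = 0"
    using R4[of "-4"] h2_down[of "-6"] by simp
  then have "g2 (-3) = 0"
    using R2[of "-4"] h1_down[of "-6"] h1_down[of "-4"] by simp
  then have g2_m2: "g2 (-2) = 0"
    using R2[of "-3"] h1_down[of "-5"] by simp
  then have t: "h1 (-2) = 0"
    using R2[of "-2"] h1_down[of "-4"] by simp
  have h1: "h1 k = 0" for k
  proof (cases "k \<le> -2")
    case True
    then show ?thesis using t h1_down[of k] by (cases "k = -2") auto
  next
    case False
    show ?thesis
    proof (rule int_vanish_up[where c = "-2"])
      show "h1 k = 0" if "k > -2" "h1 (k - 1) = 0" for k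
        using R1[of k] that by simp
    qed (use t False in auto)
  qed
  have h2: "h2 k = 0" for k
  proof (cases "k \<le> -4")
    case False
    show ?thesis
    proof (rule int_vanish_up[where f = h2 and c = "-3"])
      show "h2 k = 0" if "k > -3" "h2 (k - 1) = 0" for k
        using R3[of k] that h1 by simp
    qed (use u False in auto)
  qed (rule h2_down)
  have g2_0: "g2 0 = 0"
    using R4[of "-2"] g2_m2 h2 by simp
  have g2: "g2 k = 0" for k
  proof -
    consider "k \<le> -2" | "k = -1" | "k \<ge> 0" by linarith
    then show ?thesis
    proof cases
      case 1
      show ?thesis
      proof (rule int_vanish_down[where c = "-2"])
        show "g2 k = 0" if "k < -2" "g2 (k + 1) = 0" for k
          using R2[of k] that h1 by simp
      qed (use 1 g2_m2 in auto)
    next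
      case 2
      then show ?thesis using R2[of "-1"] g2_0 h1 by simp
    next
      case 3
      show ?thesis
      proof (rule int_vanish_up[where c = 0])
        show "g2 k = 0" if "k > 0" "g2 (k - 1) = 0" for k
          using R2[of "k - 1"] that h1 nz[of k 1] by (simp add: add.commute)
      qed (use 3 g2_0 in auto)
    qed
  qed
  show ?thesis using g2 h1 h2 by simp
qed

text \<open>
  The counterpart of \<open>normalised_cocycle_vanishes_off_Ints\<close> for the coset of zero. Choose \<open>w\<close> with
  \<open>e1\<close> equal to the action of index 1 on \<open>w\<close>; the difference of the cocycle and the coboundary of \<open>w\<close>
  vanishes by \<open>reduced_cocycle_vanishes_on_Ints\<close>. So \<open>e1\<close> and \<open>e2\<close> come from \<open>w\<close>, and the expression in
  \<open>N\<close> evaluates to a multiple of \<open>w k\<close> by the constant 12.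
\<close>

lemma normalised_cocycle_vanishes_on_Ints:
  fixes e1 e2 f1 f2 :: "int \<Rightarrow> 'f::field_char_0"
  assumes R1: "\<And>k. (of_int k - 2) * f1 (k - 1) - (of_int k + 2) * f1 k
                 = (of_int k + 2) * e1 (k + 1) + (2 - of_int k) * e1 k"
    and R2: "\<And>k. 3 * e1 k = (of_int k + 2) * e2 (k + 1) + (3 - of_int k) * e2 k
                 - (of_int k - 4) * f1 (k - 2) + (of_int k + 3) * f1 k"
    and R3: "\<And>k. - 3 * f1 k = (of_int k - 2) * f2 (k - 1) - (of_int k + 3) * f2 k
                 - (of_int k + 4) * e1 (k + 2) - (3 - of_int k) * e1 k"
    and R4: "\<And>k. 0 = (of_int k - 4) * f2 (k - 2) - (of_int k + 4) * f2 k
                 - (of_int k + 4) * e2 (k + 2) - (4 - of_int k) * e2 k"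
    and N: "\<And>k. (of_int k - 2) * (of_int k - 3) * e2 k
              = (of_int k - 2) * (of_int k - 4) * e1 (k - 1) + of_int k * (of_int k - 4) * e1 k"
  shows "e1 k = 0 \<and> e2 k = 0 \<and> f1 k = 0 \<and> f2 k = 0"
proof -
  obtain w where w0: "5 * w (-3) + w (-1) = f2 (-3)"
    and w: "\<And>k. (of_int k - 2) * w (k - 1) - (of_int k + 1) * w k = e1 k"
    using L1_surjective_on_int_functions[of "f2 (-3)" e1] by blast
  define g2 where "g2 k = e2 k - ((of_int k - 4) * w (k - 2) - (of_int k + 2) * w k)" for k
  define h1 where "h1 k = f1 k - ((of_int k + 2) * w (k + 1) + (1 - of_int k) * w k)" for k
  define h2 where "h2 k = f2 k - ((of_int k + 4) * w (k + 2) + (2 - of_int k) * w k)" for k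
  have z: "g2 k = 0 \<and> h1 k = 0 \<and> h2 k = 0" for k
  proof (rule reduced_cocycle_vanishes_on_Ints)
    show "(of_int k - 2) * h1 (k - 1) - (of_int k + 2) * h1 k = 0" for k
      using R1[of k] unfolding w[symmetric] h1_def by (simp add: algebra_simps)
    show "0 = (of_int k + 2) * g2 (k + 1) + (3 - of_int k) * g2 k
                 - (of_int k - 4) * h1 (k - 2) + (of_int k + 3) * h1 k" for k
      using R2[of k] unfolding w[symmetric] h1_def g2_def by (simp add: algebra_simps)
    show "- 3 * h1 k = (of_int k - 2) * h2 (k - 1) - (of_int k + 3) * h2 k" for k
      using R3[of k] unfolding w[symmetric] h1_def h2_def by (simp add: algebra_simps)
    show "0 = (of_int k - 4) * h2 (k - 2) - (of_int k + 4) * h2 k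
                 - (of_int k + 4) * g2 (k + 2) - (4 - of_int k) * g2 k" for k
      using R4[of k] unfolding w[symmetric] h2_def g2_def by (simp add: algebra_simps)
    show "h2 (-3) = 0"
      using w0 by (simp add: h2_def algebra_simps)
  qed
  have e2: "e2 k = (of_int k - 4) * w (k - 2) - (of_int k + 2) * w k" for k
    using z[of k] by (simp add: g2_def)
  have "12 * w k = (of_int k - 2) * (of_int k - 4) * e1 (k - 1) + of_int k * (of_int k - 4) * e1 k
     - (of_int k - 2) * (of_int k - 3) * e2 k" for k
    unfolding w[symmetric] e2 by (simp add: algebra_simps)
  then have "12 * w k = 0" for k
    using N[of k] by simp
  then have "w k = 0" for k
    by simp
  then show ?thesis
    using w[of k] z[of k] by (simp add: g2_def h1_def h2_def)
qed

text \<open>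
  The action of \<open>L\<^sub>n 1\<close> on coordinate functions: it sends \<open>L\<^sub>\<alpha> \<otimes> L\<^sub>\<beta>\<close> to
  \<open>(\<alpha> - n) L\<^bsub>\<alpha>+n\<^esub> \<otimes> L\<^sub>\<beta> + (\<beta> - n) L\<^sub>\<alpha> \<otimes> L\<^bsub>\<beta>+n\<^esub>\<close>, and the coefficients are read off at the target.
\<close>

definition witt_act :: "'f::field \<Rightarrow> ('f \<Rightarrow> 'f \<Rightarrow> 'f) \<Rightarrow> 'f \<Rightarrow> 'f \<Rightarrow> 'f" where
  "witt_act n w \<alpha> \<beta> = (\<alpha> - 2 * n) * w (\<alpha> - n) \<beta> + (\<beta> - 2 * n) * w \<alpha> (\<beta> - n)"

text \<open>
  The first case solves the three equations for \<open>d 1 \<alpha>\<close>, \<open>d 1 (\<alpha> - 1)\<close> and \<open>d 2 \<alpha>\<close> (second argument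
  given by the degree) for \<open>v \<alpha> (-\<alpha>)\<close>; the second case inverts the action of \<open>L\<^sub>0\<close>.
\<close>

definition cocycle_primitive :: "('f::field \<Rightarrow> 'f \<Rightarrow> 'f \<Rightarrow> 'f) \<Rightarrow> 'f \<Rightarrow> 'f \<Rightarrow> 'f" where
  "cocycle_primitive d \<alpha> \<beta> =
     (if \<alpha> + \<beta> = 0
      then ((\<alpha> - 2) * (\<alpha> - 4) * d 1 (\<alpha> - 1) (\<beta> + 2) + \<alpha> * (\<alpha> - 4) * d 1 \<alpha> (\<beta> + 1)
            - (\<alpha> - 2) * (\<alpha> - 3) * d 2 \<alpha> (\<beta> + 2)) / 12
      else d 0 \<alpha> \<beta> / (\<alpha> + \<beta>))"

definition finite_support :: "('f::zero \<Rightarrow> 'f \<Rightarrow> 'f) \<Rightarrow> bool" where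
  "finite_support w \<longleftrightarrow> finite {(\<alpha>, \<beta>). w \<alpha> \<beta> \<noteq> 0}"

definition cocycle :: "('f::field \<Rightarrow> 'f \<Rightarrow> 'f \<Rightarrow> 'f) \<Rightarrow> bool" where
  "cocycle d \<longleftrightarrow> (\<forall>n\<in>\<int>. \<forall>m\<in>\<int>. \<forall>\<alpha> \<beta>.
     (m - n) * d (n + m) \<alpha> \<beta> = witt_act n (d m) \<alpha> \<beta> - witt_act m (d n) \<alpha> \<beta>)"

text \<open>
  Determinant 12 of the system: the formula recovers \<open>w\<close> from its coboundary at each point. In
  particular an invariant function is zero.
\<close>

lemma cocycle_primitive_witt_act:
  "cocycle_primitive (\<lambda>n. witt_act n w) \<alpha> \<beta> = (w \<alpha> \<beta> :: 'f::field_char_0)"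
proof (cases "\<alpha> + \<beta> = 0")
  case True
  then have \<beta>: "\<beta> = - \<alpha>"
    by (simp add: add_eq_0_iff)
  have "(\<alpha> - 2) * (\<alpha> - 4) * witt_act 1 w (\<alpha> - 1) (\<beta> + 2) + \<alpha> * (\<alpha> - 4) * witt_act 1 w \<alpha> (\<beta> + 1)
            - (\<alpha> - 2) * (\<alpha> - 3) * witt_act 2 w \<alpha> (\<beta> + 2) = 12 * w \<alpha> \<beta>"
    unfolding witt_act_def \<beta> by (simp add: algebra_simps)
  then show ?thesis
    using True by (simp add: cocycle_primitive_def)
next
  case False
  have "witt_act 0 w \<alpha> \<beta> = (\<alpha> + \<beta>) * w \<alpha> \<beta>"
    by (simp add: witt_act_def algebra_simps)
  then show ?thesis
    using False by (simp add: cocycle_primitive_def)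
qed

lemma witt_act_commutator:
  "(m - n) * witt_act (n + m) w \<alpha> \<beta> = witt_act n (witt_act m w) \<alpha> \<beta> - witt_act m (witt_act n w) \<alpha> \<beta>"
proof -
  have *: "x - n - m = x - (n + m)" "x - m - n = x - (n + m)" for x
    by (simp_all add: algebra_simps)
  show ?thesis
    unfolding witt_act_def * by (simp add: algebra_simps)
qed

text \<open>
  The identity for the indices 0 and \<open>n\<close> shows that \<open>e n\<close> lives on the line \<open>\<alpha> + \<beta> = n\<close> and that
  \<open>e 0\<close> is invariant, hence zero. What remains is a function \<open>E n\<close> of one variable, treated coset by
  coset. The indices 1, -1, 2, -2 suffice since they generate the integral Witt algebra.
\<close>

lemma cocycle_with_zero_primitive_vanishes:
  fixes e :: "'f::field_char_0 \<Rightarrow> 'f \<Rightarrow> 'f \<Rightarrow> 'f"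
  assumes coc: "cocycle e" and fin: "\<And>n. n \<in> \<int> \<Longrightarrow> finite_support (e n)"
    and prim: "\<And>\<alpha> \<beta>. cocycle_primitive e \<alpha> \<beta> = 0" and n: "n \<in> \<int>"
  shows "e n \<alpha> \<beta> = 0"
proof -
  have C: "(m - n) * e (n + m) \<alpha> \<beta> = witt_act n (e m) \<alpha> \<beta> - witt_act m (e n) \<alpha> \<beta>"
    if "n \<in> \<int>" "m \<in> \<int>" for n m \<alpha> \<beta>
    using coc that by (simp add: cocycle_def)
  have e0: "e 0 \<alpha> \<beta> = 0" if "\<alpha> + \<beta> \<noteq> 0" for \<alpha> \<beta>
    using prim[of \<alpha> \<beta>] that by (simp add: cocycle_primitive_def)
  have deg: "(\<alpha> + \<beta> - n) * e n \<alpha> \<beta> = witt_act n (e 0) \<alpha> \<beta>" if "n \<in> \<int>" for n \<alpha> \<beta>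
    using C[of 0 n \<alpha> \<beta>] that by (simp add: witt_act_def algebra_simps)
  \<comment> \<open>Off the line of degree \<open>n\<close> both values of \<open>e 0\<close> on the right of \<open>deg\<close> have nonzero degree.\<close>
  have off: "e n \<alpha> \<beta> = 0" if "n \<in> \<int>" "\<alpha> + \<beta> \<noteq> n" for n \<alpha> \<beta>
  proof -
    have "witt_act n (e 0) \<alpha> \<beta> = 0"
      using e0[of "\<alpha> - n" \<beta>] e0[of \<alpha> "\<beta> - n"] that by (simp add: witt_act_def algebra_simps)
    then show ?thesis using deg[OF that(1), of \<alpha> \<beta>] that(2) by simp
  qed
  have invariant: "witt_act n (e 0) \<alpha> \<beta> = 0" if "n \<in> \<int>" for n \<alpha> \<beta>
    using deg[OF that, of \<alpha> \<beta>] off[OF that, of \<alpha> \<beta>] by (cases "\<alpha> + \<beta> = n") auto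
  have e0: "e 0 \<alpha> \<beta> = 0" for \<alpha> \<beta>
    
  proof -
    have "cocycle_primitive (\<lambda>n. witt_act n (e 0)) \<alpha> \<beta> = 0"
      by (simp add: cocycle_primitive_def invariant)
    then show ?thesis
      by (simp add: cocycle_primitive_witt_act)
  qed
  \<comment> \<open>The second exponent is determined by the first: \<open>e n\<close> is a function on the line of degree \<open>n\<close>.\<close>
  define E where "E n \<alpha> = e n \<alpha> (n - \<alpha>)" for n \<alpha>
  have E: "(m - n) * E (n + m) \<alpha> = (\<alpha> - 2 * n) * E m (\<alpha> - n) + (m - n - \<alpha>) * E m \<alpha>
             - (\<alpha> - 2 * m) * E n (\<alpha> - m) - (n - m - \<alpha>) * E n \<alpha>"
    if "n \<in> \<int>" "m \<in> \<int>" for n m \<alpha>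
    using C[OF that, of \<alpha> "n + m - \<alpha>"] by (simp add: witt_act_def E_def algebra_simps)
  have E0: "E 0 \<alpha> = 0" for \<alpha>
    by (simp add: E_def e0)
  have R1: "(\<alpha> - 2) * E (-1) (\<alpha> - 1) - (\<alpha> + 2) * E (-1) \<alpha> = (\<alpha> + 2) * E 1 (\<alpha> + 1) + (2 - \<alpha>) * E 1 \<alpha>" for \<alpha>
    using E[of 1 "-1" \<alpha>] by (simp add: E0 algebra_simps)
  have R2: "3 * E 1 \<alpha> = (\<alpha> + 2) * E 2 (\<alpha> + 1) + (3 - \<alpha>) * E 2 \<alpha>
                 - (\<alpha> - 4) * E (-1) (\<alpha> - 2) + (\<alpha> + 3) * E (-1) \<alpha>" for \<alpha>
    using E[of "-1" 2 \<alpha>] by (simp add: algebra_simps)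
  have R3: "- 3 * E (-1) \<alpha> = (\<alpha> - 2) * E (-2) (\<alpha> - 1) - (\<alpha> + 3) * E (-2) \<alpha>
                 - (\<alpha> + 4) * E 1 (\<alpha> + 2) - (3 - \<alpha>) * E 1 \<alpha>" for \<alpha>
    using E[of 1 "-2" \<alpha>] by (simp add: algebra_simps)
  have R4: "0 = (\<alpha> - 4) * E (-2) (\<alpha> - 2) - (\<alpha> + 4) * E (-2) \<alpha>
                 - (\<alpha> + 4) * E 2 (\<alpha> + 2) - (4 - \<alpha>) * E 2 \<alpha>" for \<alpha>
    using E[of 2 "-2" \<alpha>] by (simp add: E0 algebra_simps)
  have N: "(\<alpha> - 2) * (\<alpha> - 3) * E 2 \<alpha> = (\<alpha> - 2) * (\<alpha> - 4) * E 1 (\<alpha> - 1) + \<alpha> * (\<alpha> - 4) * E 1 \<alpha>" for \<alpha>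
    using prim[of \<alpha> "-\<alpha>"] by (simp add: cocycle_primitive_def E_def)
  have E12: "E 1 \<alpha> = 0 \<and> E 2 \<alpha> = 0 \<and> E (-1) \<alpha> = 0 \<and> E (-2) \<alpha> = 0" for \<alpha>
  proof (cases "\<alpha> \<in> \<int>")
    case True
    then obtain k where k: "\<alpha> = of_int k"
      by (rule Ints_cases)
    have "E 1 (of_int k) = 0 \<and> E 2 (of_int k) = 0 \<and> E (-1) (of_int k) = 0 \<and> E (-2) (of_int k) = 0"
      by (rule normalised_cocycle_vanishes_on_Ints[of "\<lambda>k. E (-1) (of_int k)" "\<lambda>k. E 1 (of_int k)"
            "\<lambda>k. E 2 (of_int k)" "\<lambda>k. E (-2) (of_int k)" k])
        (use R1 R2 R3 R4 N in simp_all)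
    then show ?thesis by (simp add: k)
  next
    case False
    have "finite {k. E n (\<alpha> + of_int k) \<noteq> 0}" if "n \<in> \<int>" for n
    proof -
      let ?h = "\<lambda>k. (\<alpha> + of_int k, n - (\<alpha> + of_int k))"
      have "finite (?h -` {(\<alpha>, \<beta>). e n \<alpha> \<beta> \<noteq> 0})"
        by (rule finite_vimageI) (use fin[OF that] in \<open>auto simp: finite_support_def inj_def\<close>)
      also have "?h -` {(\<alpha>, \<beta>). e n \<alpha> \<beta> \<noteq> 0} = {k. E n (\<alpha> + of_int k) \<noteq> 0}"
        by (auto simp: E_def)
      finally show ?thesis .
    qed
    note finite_E = this
    have "E 1 (\<alpha> + of_int 0) = 0 \<and> E 2 (\<alpha> + of_int 0) = 0
               \<and> E (-1) (\<alpha> + of_int 0) = 0 \<and> E (-2) (\<alpha> + of_int 0) = 0"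
    proof (rule normalised_cocycle_vanishes_off_Ints[of \<alpha> "\<lambda>k. E (-1) (\<alpha> + of_int k)" "\<lambda>k. E 1 (\<alpha> + of_int k)"
            "\<lambda>k. E 2 (\<alpha> + of_int k)" "\<lambda>k. E (-2) (\<alpha> + of_int k)"])
      fix k :: int
      have *: "\<alpha> + of_int (k + c) = \<alpha> + of_int k + of_int c"
        "\<alpha> + of_int (k - c) = \<alpha> + of_int k - of_int c"
        "c' - \<alpha> - of_int k = c' - (\<alpha> + of_int k)" for c c'
        by simp_all
      show "(\<alpha> + of_int k - 2) * E (-1) (\<alpha> + of_int (k - 1)) - (\<alpha> + of_int k + 2) * E (-1) (\<alpha> + of_int k)
          = (\<alpha> + of_int k + 2) * E 1 (\<alpha> + of_int (k + 1)) + (2 - \<alpha> - of_int k) * E 1 (\<alpha> + of_int k)"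
        unfolding * of_int_1 by (rule R1)
      show "3 * E 1 (\<alpha> + of_int k) = (\<alpha> + of_int k + 2) * E 2 (\<alpha> + of_int (k + 1))
          + (3 - \<alpha> - of_int k) * E 2 (\<alpha> + of_int k)
          - (\<alpha> + of_int k - 4) * E (-1) (\<alpha> + of_int (k - 2)) + (\<alpha> + of_int k + 3) * E (-1) (\<alpha> + of_int k)"
        unfolding * of_int_1 of_int_numeral by (rule R2)
      show "- 3 * E (-1) (\<alpha> + of_int k) = (\<alpha> + of_int k - 2) * E (-2) (\<alpha> + of_int (k - 1))
          - (\<alpha> + of_int k + 3) * E (-2) (\<alpha> + of_int k)
          - (\<alpha> + of_int k + 4) * E 1 (\<alpha> + of_int (k + 2)) - (3 - \<alpha> - of_int k) * E 1 (\<alpha> + of_int k)"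
        unfolding * of_int_1 of_int_numeral by (rule R3)
      show "(\<alpha> + of_int k - 2) * (\<alpha> + of_int k - 3) * E 2 (\<alpha> + of_int k)
          = (\<alpha> + of_int k - 2) * (\<alpha> + of_int k - 4) * E 1 (\<alpha> + of_int (k - 1))
            + (\<alpha> + of_int k) * (\<alpha> + of_int k - 4) * E 1 (\<alpha> + of_int k)"
        unfolding * of_int_1 by (rule N)
    qed (use False finite_E in simp_all)
    then show ?thesis by simp
  qed
  have e12: "e n \<alpha> \<beta> = 0" if "n \<in> {0, 1, -1, 2, -2}" for n \<alpha> \<beta>
  proof (cases "\<alpha> + \<beta> = n")
    case True
    then have "e n \<alpha> \<beta> = E n \<alpha>"
      by (auto simp: E_def)
    then show ?thesis
      using that E12[of \<alpha>] E0[of \<alpha>] by auto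
  next
    case False
    moreover have "n \<in> \<int>" using that by auto
    ultimately show ?thesis by (simp add: off)
  qed
  \<comment> \<open>\<open>[L\<^sub>1, L\<^sub>k] = (k - 1) L\<^bsub>k+1\<^esub>\<close> raises the index, except at \<open>k = 1\<close>, where index 2 is needed
    separately; negative indices are symmetric.\<close>
  have pos: "e (of_nat k) \<alpha> \<beta> = 0" for k \<alpha> \<beta>
  proof (induction k arbitrary: \<alpha> \<beta>)
    case (Suc k)
    show ?case
    proof (cases "k = 1")
      case False
      have "(of_nat k - 1) * e (1 + of_nat k) \<alpha> \<beta> = 0"
        using C[of 1 "of_nat k" \<alpha> \<beta>] Suc e12 by (simp add: witt_act_def)
      moreover have "of_nat k - 1 \<noteq> (0 :: 'f)"
        using False by (metis eq_iff_diff_eq_0 of_nat_1 of_nat_eq_iff)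
      ultimately show ?thesis by simp
    qed (simp add: e12)
  qed (simp add: e12)
  have neg: "e (- of_nat k) \<alpha> \<beta> = 0" for k \<alpha> \<beta>
  proof (induction k arbitrary: \<alpha> \<beta>)
    case (Suc k)
    show ?case
    proof (cases "k = 1")
      case False
      have "(- of_nat k + 1) * e (- 1 - of_nat k) \<alpha> \<beta> = 0"
        using C[of "-1" "- of_nat k" \<alpha> \<beta>] Suc e12 by (simp add: witt_act_def)
      moreover have "- of_nat k + 1 \<noteq> (0 :: 'f)"
        using False by (metis add_eq_0_iff add.inverse_inverse of_nat_1 of_nat_eq_iff)
      ultimately show ?thesis by simp
    qed (simp add: e12)
  qed (simp add: e12)
  obtain z where "n = of_int z"
    using n by (rule Ints_cases)
  then show ?thesis
    using pos[of "nat z"] neg[of "nat (- z)"] by (cases "z \<ge> 0") auto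
qed

lemma finite_support_shift:
  assumes "finite_support w"
  shows "finite_support (\<lambda>\<alpha> \<beta>. c \<alpha> \<beta> * w (\<alpha> - s) (\<beta> - t) :: 'f::field)"
proof -
  have "{(\<alpha>, \<beta>). c \<alpha> \<beta> * w (\<alpha> - s) (\<beta> - t) \<noteq> 0}
      \<subseteq> (\<lambda>(\<alpha>, \<beta>). (\<alpha> + s, \<beta> + t)) ` {(\<alpha>, \<beta>). w \<alpha> \<beta> \<noteq> 0}"
    by (auto simp: image_iff) (metis diff_add_cancel)
  then show ?thesis
    using assms by (auto simp: finite_support_def intro: finite_subset)
qed

lemma finite_support_add: "finite_support v \<Longrightarrow> finite_support w \<Longrightarrow> finite_support (\<lambda>\<alpha> \<beta>. v \<alpha> \<beta> + w \<alpha> \<beta> :: 'f::field)"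
  unfolding finite_support_def
  by (rule finite_subset[where B = "{(\<alpha>, \<beta>). v \<alpha> \<beta> \<noteq> 0} \<union> {(\<alpha>, \<beta>). w \<alpha> \<beta> \<noteq> 0}"]) auto

lemma finite_support_diff: "finite_support v \<Longrightarrow> finite_support w \<Longrightarrow> finite_support (\<lambda>\<alpha> \<beta>. v \<alpha> \<beta> - w \<alpha> \<beta> :: 'f::field)"
  unfolding finite_support_def
  by (rule finite_subset[where B = "{(\<alpha>, \<beta>). v \<alpha> \<beta> \<noteq> 0} \<union> {(\<alpha>, \<beta>). w \<alpha> \<beta> \<noteq> 0}"]) auto

lemma finite_support_witt_act: "finite_support w \<Longrightarrow> finite_support (witt_act n w)"
  using finite_support_add[OF finite_support_shift[of w "\<lambda>\<alpha> \<beta>. \<alpha> - 2 * n" n 0]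
      finite_support_shift[of w "\<lambda>\<alpha> \<beta>. \<beta> - 2 * n" 0 n]]
  by (simp add: witt_act_def[abs_def])

text \<open>
  By \<open>cocycle_primitive_witt_act\<close> and linearity, subtracting the coboundary of the primitive leaves a
  cocycle whose primitive is zero.
\<close>

theorem cocycle_eq_witt_act_cocycle_primitive:
  fixes d :: "'f::field_char_0 \<Rightarrow> 'f \<Rightarrow> 'f \<Rightarrow> 'f"
  assumes coc: "cocycle d" and fin: "\<And>n. n \<in> \<int> \<Longrightarrow> finite_support (d n)"
    and v: "finite_support (cocycle_primitive d)" and n: "n \<in> \<int>"
  shows "d n \<alpha> \<beta> = witt_act n (cocycle_primitive d) \<alpha> \<beta>"
proof -
  define v where "v = cocycle_primitive d"
  define e where "e n \<alpha> \<beta> = d n \<alpha> \<beta> - witt_act n v \<alpha> \<beta>" for n \<alpha> \<beta>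
  have "e n \<alpha> \<beta> = 0"
  proof (rule cocycle_with_zero_primitive_vanishes[of e])
    have C: "(m - n) * d (n + m) \<alpha> \<beta> = witt_act n (d m) \<alpha> \<beta> - witt_act m (d n) \<alpha> \<beta>"
      if "n \<in> \<int>" "m \<in> \<int>" for n m \<alpha> \<beta>
      using coc that by (simp add: cocycle_def)
    have L: "witt_act n (e m) \<alpha> \<beta> = witt_act n (d m) \<alpha> \<beta> - witt_act n (witt_act m v) \<alpha> \<beta>" for n m \<alpha> \<beta>
      unfolding witt_act_def[of n] e_def by (simp add: algebra_simps)
    show "cocycle e"
      unfolding cocycle_def
    proof (intro ballI allI)
      fix n m \<alpha> \<beta> :: 'f assume "n \<in> \<int>" "m \<in> \<int>"
      then show "(m - n) * e (n + m) \<alpha> \<beta> = witt_act n (e m) \<alpha> \<beta> - witt_act m (e n) \<alpha> \<beta>"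
        unfolding L unfolding e_def right_diff_distrib[of "m - n"] witt_act_commutator by (simp add: C)
    qed
    show "finite_support (e n)" if "n \<in> \<int>" for n
      unfolding e_def[abs_def] using fin[OF that] v
      by (intro finite_support_diff finite_support_witt_act) (simp_all add: v_def)
    have "cocycle_primitive e \<alpha> \<beta> = cocycle_primitive d \<alpha> \<beta> - cocycle_primitive (\<lambda>n. witt_act n v) \<alpha> \<beta>" for \<alpha> \<beta>
      unfolding cocycle_primitive_def e_def by (simp add: right_diff_distrib add_divide_distrib diff_divide_distrib)
    then show "cocycle_primitive e \<alpha> \<beta> = 0" for \<alpha> \<beta>
      unfolding cocycle_primitive_witt_act by (simp add: v_def)
  qed (fact n)
  then show ?thesis
    by (simp add: e_def v_def)
qed

text \<open>
  The action of \<open>L\<^sub>\<gamma> a\<close>: multiplication by \<open>a\<close> on the first or the second factor changes the form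
  through which the coordinates are taken, so the two terms involve two different functions.
\<close>

definition witt_act_pair :: "'f::field \<Rightarrow> ('f \<Rightarrow> 'f \<Rightarrow> 'f) \<Rightarrow> ('f \<Rightarrow> 'f \<Rightarrow> 'f) \<Rightarrow> 'f \<Rightarrow> 'f \<Rightarrow> 'f" where
  "witt_act_pair \<gamma> F G \<alpha> \<beta> = (\<alpha> - 2 * \<gamma>) * F (\<alpha> - \<gamma>) \<beta> + (\<beta> - 2 * \<gamma>) * G \<alpha> (\<beta> - \<gamma>)"

lemma witt_act_pair_commutator:
  "(\<gamma> - n) * witt_act_pair (n + \<gamma>) F G \<alpha> \<beta>
   = witt_act n (witt_act_pair \<gamma> F G) \<alpha> \<beta> - witt_act_pair \<gamma> (witt_act n F) (witt_act n G) \<alpha> \<beta>"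
proof -
  have *: "x - n - \<gamma> = x - (n + \<gamma>)" "x - \<gamma> - n = x - (n + \<gamma>)" for x
    by (simp_all add: algebra_simps)
  show ?thesis
    unfolding witt_act_def witt_act_pair_def * by (simp add: algebra_simps)
qed

text \<open>
  The function \<open>witt_act (-n) (witt_act n f)\<close> involves values of \<open>f\<close> shifted by \<open>(n, -n)\<close>, by zero and by
  \<open>(-n, n)\<close>. If \<open>n\<close> avoids the finitely many differences of points of the support, then at the point
  \<open>(\<alpha> + n, \<beta> - n)\<close> only the shift of \<open>f \<alpha> \<beta>\<close> survives, with the factor \<open>(\<beta> + n) * (\<alpha> - n)\<close>, while \<open>f\<close>
  itself vanishes there. The image of \<open>L\<^sub>\<gamma> a\<close> under a homomorphism of modules satisfies \<open>eq\<close>.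
\<close>

lemma witt_eigenfunction_vanishes:
  fixes f :: "'f::field_char_0 \<Rightarrow> 'f \<Rightarrow> 'f"
  assumes fin: "finite_support f"
    and eq: "\<And>n \<alpha> \<beta>. n \<in> \<int> \<Longrightarrow> witt_act (-n) (witt_act n f) \<alpha> \<beta> = c n * f \<alpha> \<beta>"
  shows "f \<alpha> \<beta> = 0"
proof (rule ccontr)
  assume f: "f \<alpha> \<beta> \<noteq> 0"
  define S where "S = {(\<alpha>, \<beta>). f \<alpha> \<beta> \<noteq> 0}"
  have S: "finite S"
    using fin by (simp add: finite_support_def S_def)
  define Bad where "Bad = (\<lambda>p. fst p - \<alpha>) ` S \<union> (\<lambda>p. (fst p - \<alpha>) / 2) ` S \<union> {\<alpha>, - \<beta>}"
  have "finite Bad"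
    using S by (simp add: Bad_def)
  moreover have "infinite (\<int> :: 'f set)"
  proof -
    have "inj (of_int :: int \<Rightarrow> 'f)"
      by (simp add: inj_def)
    then show ?thesis
      unfolding Ints_def using finite_imageD infinite_UNIV_int by blast
  qed
  ultimately obtain n where n: "n \<in> \<int>" "n \<notin> Bad"
    by (meson finite_subset subsetI)
  have 1: "f (\<alpha> + n) y = 0" "f (\<alpha> + 2 * n) y = 0" for y
  proof -
    have "(\<alpha> + n, y) \<notin> S"
    proof
      assume "(\<alpha> + n, y) \<in> S"
      then have "fst (\<alpha> + n, y) - \<alpha> \<in> Bad"
        unfolding Bad_def by blast
      with n(2) show False by simp
    qed
    moreover have "(\<alpha> + 2 * n, y) \<notin> S"
    proof
      assume "(\<alpha> + 2 * n, y) \<in> S"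
      then have "(fst (\<alpha> + 2 * n, y) - \<alpha>) / 2 \<in> Bad"
        unfolding Bad_def by blast
      with n(2) show False by simp
    qed
    ultimately show "f (\<alpha> + n) y = 0" "f (\<alpha> + 2 * n) y = 0" by (auto simp: S_def)
  qed
  have "witt_act (-n) (witt_act n f) (\<alpha> + n) (\<beta> - n) = (\<beta> + n) * (\<alpha> - n) * f \<alpha> \<beta>"
    using 1 by (simp add: witt_act_def algebra_simps)
  also have "\<dots> \<noteq> 0"
    using f n(2) by (auto simp: Bad_def add_eq_0_iff)
  finally show False
    using eq[OF n(1), of "\<alpha> + n" "\<beta> - n"] 1 by simp
qed

section \<open>Tensor products and bilinear forms\<close>

lemma lookup_scale_pm [simp]: "Poly_Mapping.lookup (scale_pm c p) k = c * Poly_Mapping.lookup p k"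
  by (auto simp: map.rep_eq when_def)

interpretation pm: vector_space "scale_pm :: 'f::field \<Rightarrow> ('k \<Rightarrow>\<^sub>0 'f) \<Rightarrow> ('k \<Rightarrow>\<^sub>0 'f)"
  by unfold_locales (auto intro!: poly_mapping_eqI simp: lookup_add algebra_simps)

definition linext :: "('k \<Rightarrow> 'f::field) \<Rightarrow> ('k \<Rightarrow>\<^sub>0 'f) \<Rightarrow> 'f" where
  "linext b p = (\<Sum>k\<in>Poly_Mapping.keys p. Poly_Mapping.lookup p k * b k)"

lemma linext_superset:
  "finite S \<Longrightarrow> Poly_Mapping.keys p \<subseteq> S \<Longrightarrow> linext b p = (\<Sum>k\<in>S. Poly_Mapping.lookup p k * b k)"
  unfolding linext_def by (rule sum.mono_neutral_left) (auto simp: in_keys_iff)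

lemma linext_add: "linext b (p + q) = linext b p + linext b q"
proof -
  let ?S = "Poly_Mapping.keys p \<union> Poly_Mapping.keys q \<union> Poly_Mapping.keys (p + q)"
  have S: "finite ?S" by simp
  show ?thesis
    by (simp add: linext_superset[OF S] lookup_add distrib_right sum.distrib le_supI1)
qed

lemma keys_scale_pm: "Poly_Mapping.keys (scale_pm c p) \<subseteq> Poly_Mapping.keys p"
  by (metis in_keys_iff lookup_scale_pm mult_zero_right subsetI)

lemma linext_scale: "linext b (scale_pm c p) = c * linext b p"
proof -
  have "linext b (scale_pm c p) = (\<Sum>k\<in>Poly_Mapping.keys p. Poly_Mapping.lookup (scale_pm c p) k * b k)"
    by (rule linext_superset[OF finite_keys keys_scale_pm])
  also have "\<dots> = (\<Sum>k\<in>Poly_Mapping.keys p. c * (Poly_Mapping.lookup p k * b k))"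
    by (rule sum.cong) (simp_all only: lookup_scale_pm mult.assoc)
  also have "\<dots> = c * linext b p"
    unfolding linext_def by (rule sum_distrib_left[symmetric])
  finally show ?thesis .
qed

lemma linext_0 [simp]: "linext b 0 = 0"
  by (simp add: linext_def)

lemma linext_single [simp]: "linext b (Poly_Mapping.single k c) = c * b k"
  by (simp add: linext_def)

lemma linext_minus: "linext b (p - q) = linext b p - linext b q"
  using linext_add[of b "p - q" q] by simp

lemma linext_sum: "linext b (sum P I) = (\<Sum>i\<in>I. linext b (P i))"
  by (induction I rule: infinite_finite_induct) (auto simp: linext_add)

lemma poly_mapping_sum_single:
  "(\<Sum>k\<in>Poly_Mapping.keys p. Poly_Mapping.single k (Poly_Mapping.lookup p k)) = p"
proof (rule poly_mapping_eqI)
  fix k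
  have "(\<Sum>l\<in>Poly_Mapping.keys p. if l = k then Poly_Mapping.lookup p l else 0) = Poly_Mapping.lookup p k"
    by (simp add: in_keys_iff)
  then show "Poly_Mapping.lookup (\<Sum>k\<in>Poly_Mapping.keys p. Poly_Mapping.single k (Poly_Mapping.lookup p k)) k
      = Poly_Mapping.lookup p k"
    by (simp only: lookup_sum lookup_single when_def)
qed

lemma linear_eq_linext:
  assumes "Vector_Spaces.linear scale_pm (*) \<phi>"
  shows "\<phi> p = linext (\<lambda>k. \<phi> (Poly_Mapping.single k 1)) p"
proof -
  interpret \<phi>: Vector_Spaces.linear scale_pm "(*)" \<phi> by fact
  have single: "\<phi> (Poly_Mapping.single k c) = c * \<phi> (Poly_Mapping.single k 1)" for k c
    using \<phi>.scale[of c "Poly_Mapping.single k 1"] by simp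
  have "\<phi> p = \<phi> (\<Sum>k\<in>Poly_Mapping.keys p. Poly_Mapping.single k (Poly_Mapping.lookup p k))"
    by (simp only: poly_mapping_sum_single)
  also have "\<dots> = (\<Sum>k\<in>Poly_Mapping.keys p. \<phi> (Poly_Mapping.single k (Poly_Mapping.lookup p k)))"
    by (rule \<phi>.sum)
  also have "\<dots> = linext (\<lambda>k. \<phi> (Poly_Mapping.single k 1)) p"
    unfolding linext_def by (intro sum.cong refl single)
  finally show ?thesis .
qed

definition bilinear_form ::
  "('f::field, 'u, 'm) module_scheme \<Rightarrow> ('f, 'v, 'n) module_scheme \<Rightarrow> ('u \<times> 'v \<Rightarrow> 'f) \<Rightarrow> bool" where
  "bilinear_form M N b \<longleftrightarrow>
     (\<forall>u\<in>carrier M. \<forall>u'\<in>carrier M. \<forall>v\<in>carrier N. b (u \<oplus>\<^bsub>M\<^esub> u', v) = b (u, v) + b (u', v)) \<and>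
     (\<forall>u\<in>carrier M. \<forall>v\<in>carrier N. \<forall>v'\<in>carrier N. b (u, v \<oplus>\<^bsub>N\<^esub> v') = b (u, v) + b (u, v')) \<and>
     (\<forall>c. \<forall>u\<in>carrier M. \<forall>v\<in>carrier N. b (c \<odot>\<^bsub>M\<^esub> u, v) = c * b (u, v)) \<and>
     (\<forall>c. \<forall>u\<in>carrier M. \<forall>v\<in>carrier N. b (u, c \<odot>\<^bsub>N\<^esub> v) = c * b (u, v))"

lemma linext_bilinear_relations:
  assumes "bilinear_form M N b" "r \<in> bilinear_relations M N"
  shows "linext b r = 0"
  using assms(2) unfolding bilinear_relations_def
proof (induction rule: pm.span_induct_alt)
  case (step c x y)
  from step(1) have "linext b x = 0"
    using assms(1) by (elim UnE CollectE exE conjE)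
      (simp_all only: bilinear_form_def linext_minus linext_scale linext_single, simp_all)
  with step(2) show ?case
    by (simp add: linext_add linext_scale)
qed simp

text \<open>
  The converse of \<open>linext_bilinear_relations\<close>: a vector outside the subspace of relations is detected
  by a linear functional that kills the subspace, and such a functional is the extension of a bilinear
  form. All later identities in tensor products are proved by evaluating bilinear forms.
\<close>

lemma in_bilinear_relations:
  fixes M :: "('f::field, 'u, 'm) module_scheme" and N :: "('f, 'v, 'n) module_scheme"
  assumes "\<And>b. bilinear_form M N b \<Longrightarrow> linext b p = 0"
  shows "p \<in> bilinear_relations M N"
proof (rule ccontr)
  let ?R = "bilinear_relations M N"
  interpret pmf: vector_space_pair "scale_pm :: 'f::field \<Rightarrow> ('u \<times> 'v \<Rightarrow>\<^sub>0 'f) \<Rightarrow> _" "(*) :: 'f \<Rightarrow> 'f \<Rightarrow> 'f"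
    by unfold_locales (auto simp: algebra_simps)
  assume p: "p \<notin> ?R"
  have R: "pm.subspace ?R"
    unfolding bilinear_relations_def by (rule pm.subspace_span)
  obtain B where B: "B \<subseteq> ?R" "pm.independent B" "?R \<subseteq> pm.span B"
    using pm.maximal_independent_subset by blast
  have "pm.span B \<subseteq> ?R"
    using B(1) R by (rule pm.span_minimal)
  then have "pm.independent (insert p B)"
    using p B(2) by (intro pm.independent_insertI) auto
  then obtain \<phi> where \<phi>: "Vector_Spaces.linear scale_pm (*) \<phi>"
    "\<And>x. x \<in> insert p B \<Longrightarrow> \<phi> x = (if x = p then 1 else 0)"
    using pmf.linear_independent_extend[of "insert p B" "\<lambda>x. if x = p then 1 else 0"] by blast
  interpret \<phi>: Vector_Spaces.linear scale_pm "(*)" \<phi> by fact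
  have "\<phi> x = 0" if "x \<in> pm.span B" for x
    using that
  proof (induction rule: pm.span_induct_alt)
    case (step c x y)
    then show ?case using \<phi>(2)[of x] p B(1) by (auto simp: \<phi>.add \<phi>.scale)
  qed (rule \<phi>.zero)
  then have R0: "\<phi> x = 0" if "x \<in> ?R" for x
    using that B(3) by blast
  define b where "b k = \<phi> (Poly_Mapping.single k 1)" for k
  note rel = R0[unfolded bilinear_relations_def, OF pm.span_base]
  have "bilinear_form M N b"
    unfolding bilinear_form_def
  proof (intro conjI ballI allI)
    fix u u' v assume "u \<in> carrier M" "u' \<in> carrier M" "v \<in> carrier N"
    then have "\<phi> (pair_pm (u \<oplus>\<^bsub>M\<^esub> u') v - pair_pm u v - pair_pm u' v) = 0"
      by (intro rel) blast
    then show "b (u \<oplus>\<^bsub>M\<^esub> u', v) = b (u, v) + b (u', v)"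
      by (simp add: b_def \<phi>.diff diff_eq_eq add.commute)
  next
    fix u v v' assume "u \<in> carrier M" "v \<in> carrier N" "v' \<in> carrier N"
    then have "\<phi> (pair_pm u (v \<oplus>\<^bsub>N\<^esub> v') - pair_pm u v - pair_pm u v') = 0"
      by (intro rel) blast
    then show "b (u, v \<oplus>\<^bsub>N\<^esub> v') = b (u, v) + b (u, v')"
      by (simp add: b_def \<phi>.diff diff_eq_eq add.commute)
  next
    fix c u v assume "u \<in> carrier M" "v \<in> carrier N"
    then have "\<phi> (pair_pm (c \<odot>\<^bsub>M\<^esub> u) v - scale_pm c (pair_pm u v)) = 0"
      by (intro rel) blast
    then show "b (c \<odot>\<^bsub>M\<^esub> u, v) = c * b (u, v)"
      by (simp only: b_def \<phi>.diff \<phi>.scale eq_iff_diff_eq_0[symmetric])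
  next
    fix c u v assume "u \<in> carrier M" "v \<in> carrier N"
    then have "\<phi> (pair_pm u (c \<odot>\<^bsub>N\<^esub> v) - scale_pm c (pair_pm u v)) = 0"
      by (intro rel) blast
    then show "b (u, c \<odot>\<^bsub>N\<^esub> v) = c * b (u, v)"
      by (simp only: b_def \<phi>.diff \<phi>.scale eq_iff_diff_eq_0[symmetric])
  qed
  then have "linext b p = 0"
    by (rule assms)
  moreover have "\<phi> p = linext b p"
    unfolding b_def using \<phi>(1) by (rule linear_eq_linext)
  ultimately show False
    using \<phi>(2)[of p] by simp
qed

lemma linext_cong: "(\<And>k. k \<in> Poly_Mapping.keys p \<Longrightarrow> b k = b' k) \<Longrightarrow> linext b p = linext b' p"
  by (simp add: linext_def)

definition tensor_class ::
  "('f::field, 'u, 'm) module_scheme \<Rightarrow> ('f, 'v, 'n) module_scheme \<Rightarrow> ('u \<times> 'v \<Rightarrow>\<^sub>0 'f) \<Rightarrow> ('u \<times> 'v \<Rightarrow>\<^sub>0 'f) set" where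
  "tensor_class M N p = bilinear_relations M N +>\<^bsub>free_pairs M N\<^esub> p"

text \<open>
  The choice of the representative \<open>p\<close> is immaterial on classes when \<open>b\<close> is bilinear
  (\<open>tensor_eval_class\<close>). For arbitrary \<open>b\<close> the value is still additive in \<open>b\<close>, which allows the form to
  be rewritten under \<open>tensor_eval\<close>.
\<close>

definition tensor_eval :: "('k \<Rightarrow> 'f::field) \<Rightarrow> ('k \<Rightarrow>\<^sub>0 'f) set \<Rightarrow> 'f" where
  "tensor_eval b S = linext b (SOME p. p \<in> S)"

lemma subspace_bilinear_relations: "pm.subspace (bilinear_relations M N)"
  unfolding bilinear_relations_def by (rule pm.subspace_span)

lemma mem_tensor_class_iff: "q \<in> tensor_class M N p \<longleftrightarrow> q - p \<in> bilinear_relations M N"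
  by (auto simp: tensor_class_def a_r_coset_def' free_pairs_def intro!: bexI[of _ "q - p"])

lemma self_mem_tensor_class: "p \<in> tensor_class M N p"
  using pm.subspace_0[OF subspace_bilinear_relations] by (simp add: mem_tensor_class_iff)

lemma linext_mem_class: "bilinear_form M N b \<Longrightarrow> q \<in> tensor_class M N p \<Longrightarrow> linext b q = linext b p"
  using linext_bilinear_relations[of M N b "q - p"] by (simp add: mem_tensor_class_iff linext_minus)

lemma tensor_eval_class: "bilinear_form M N b \<Longrightarrow> tensor_eval b (tensor_class M N p) = linext b p"
  unfolding tensor_eval_def by (rule linext_mem_class) (auto intro: someI[of _ p] self_mem_tensor_class)

lemma tensor_class_eqI:
  assumes "\<And>b. bilinear_form M N b \<Longrightarrow> linext b p = linext b q"
  shows "tensor_class M N p = tensor_class M N q"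
proof -
  have pq: "p - q \<in> bilinear_relations M N"
    by (rule in_bilinear_relations) (simp add: linext_minus assms)
  have "x - p \<in> bilinear_relations M N \<longleftrightarrow> x - q \<in> bilinear_relations M N" for x
    using pm.subspace_add[OF subspace_bilinear_relations _ pq, of "x - p"]
      pm.subspace_diff[OF subspace_bilinear_relations _ pq, of "x - q"] by auto
  then show ?thesis by (auto simp: mem_tensor_class_iff)
qed

text \<open>
  The operations on classes are unions over representatives; such a union is a single class when
  bilinear forms cannot distinguish the members.
\<close>

lemma Union_tensor_class_eq:
  assumes "\<And>b q. bilinear_form M N b \<Longrightarrow> q \<in> S \<Longrightarrow> linext b (h q) = linext b r" and "S \<noteq> {}"
  shows "(\<Union>q\<in>S. tensor_class M N (h q)) = tensor_class M N r"
proof -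
  have "tensor_class M N (h q) = tensor_class M N r" if "q \<in> S" for q
    using assms(1) that by (intro tensor_class_eqI) blast
  with assms(2) show ?thesis by auto
qed

lemma add_tensor_class: "tensor_class M N p \<oplus>\<^bsub>tensor_product M N\<^esub> tensor_class M N q = tensor_class M N (p + q)"
proof -
  have "tensor_class M N p \<oplus>\<^bsub>tensor_product M N\<^esub> tensor_class M N q
      = {x + y | x y. x \<in> tensor_class M N p \<and> y \<in> tensor_class M N q}"
    by (auto simp: tensor_product_def quotient_module_def set_add_def' free_pairs_def)
  also have "\<dots> = tensor_class M N (p + q)"
  proof (intro equalityI subsetI)
    fix z assume "z \<in> {x + y | x y. x \<in> tensor_class M N p \<and> y \<in> tensor_class M N q}"
    then obtain x y where "z = x + y" "x - p \<in> bilinear_relations M N" "y - q \<in> bilinear_relations M N"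
      by (auto simp: mem_tensor_class_iff)
    moreover from this have "(x - p) + (y - q) \<in> bilinear_relations M N"
      by (intro pm.subspace_add[OF subspace_bilinear_relations])
    ultimately show "z \<in> tensor_class M N (p + q)"
      by (simp add: mem_tensor_class_iff algebra_simps)
  next
    fix z assume "z \<in> tensor_class M N (p + q)"
    then have "z - q \<in> tensor_class M N p"
      by (simp add: mem_tensor_class_iff algebra_simps)
    then show "z \<in> {x + y | x y. x \<in> tensor_class M N p \<and> y \<in> tensor_class M N q}"
      using self_mem_tensor_class[of q M N] by (intro CollectI exI[of _ "z - q"] exI[of _ q]) auto
  qed
  finally show ?thesis .
qed

lemma smult_tensor_class: "c \<odot>\<^bsub>tensor_product M N\<^esub> tensor_class M N p = tensor_class M N (scale_pm c p)"
proof -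
  have "c \<odot>\<^bsub>tensor_product M N\<^esub> tensor_class M N p = (\<Union>q\<in>tensor_class M N p. tensor_class M N (scale_pm c q))"
    by (simp add: tensor_product_def quotient_module_def tensor_class_def[of M N] free_pairs_def)
  also have "\<dots> = tensor_class M N (scale_pm c p)"
  proof (rule Union_tensor_class_eq)
    show "linext b (scale_pm c q) = linext b (scale_pm c p)"
      if "bilinear_form M N b" "q \<in> tensor_class M N p" for b q
      unfolding linext_scale linext_mem_class[OF that] ..
  qed (use self_mem_tensor_class in blast)
  finally show ?thesis .
qed

lemma zero_tensor: "\<zero>\<^bsub>tensor_product M N\<^esub> = tensor_class M N 0"
proof -
  have "\<zero>\<^bsub>tensor_product M N\<^esub> = bilinear_relations M N"
    by (simp add: tensor_product_def quotient_module_def)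
  also have "\<dots> = tensor_class M N 0"
    by (auto simp: mem_tensor_class_iff)
  finally show ?thesis .
qed

lemma carrier_tensor:
  "carrier (tensor_product M N) = tensor_class M N ` {p. Poly_Mapping.keys p \<subseteq> carrier M \<times> carrier N}"
  by (auto simp: tensor_product_def quotient_module_def A_RCOSETS_def' tensor_class_def[of M N])
    (auto simp: free_pairs_def)

text \<open>
  What the tensor product needs of its factors: the bilinearity relations are imposed only on
  carriers, and closure keeps them inside.
\<close>

definition closed_space :: "('f, 'u, 'm) module_scheme \<Rightarrow> bool" where
  "closed_space M \<longleftrightarrow> (\<forall>x\<in>carrier M. \<forall>y\<in>carrier M. x \<oplus>\<^bsub>M\<^esub> y \<in> carrier M) \<and>
     (\<forall>c. \<forall>x\<in>carrier M. c \<odot>\<^bsub>M\<^esub> x \<in> carrier M)"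

lemma tensor_cases:
  assumes "S \<in> carrier (tensor_product M N)"
  obtains p where "S = tensor_class M N p" "Poly_Mapping.keys p \<subseteq> carrier M \<times> carrier N"
  using assms by (auto simp: carrier_tensor)

lemma tensor_class_closed: "Poly_Mapping.keys p \<subseteq> carrier M \<times> carrier N \<Longrightarrow> tensor_class M N p \<in> carrier (tensor_product M N)"
  by (auto simp: carrier_tensor)

lemma tensor_add_closed:
  "S \<in> carrier (tensor_product M N) \<Longrightarrow> T \<in> carrier (tensor_product M N) \<Longrightarrow>
   S \<oplus>\<^bsub>tensor_product M N\<^esub> T \<in> carrier (tensor_product M N)"
  by (elim tensor_cases) (auto simp: add_tensor_class intro!: tensor_class_closed dest!: subsetD[OF Poly_Mapping.keys_add])

lemma tensor_smult_closed:
  "S \<in> carrier (tensor_product M N) \<Longrightarrow> c \<odot>\<^bsub>tensor_product M N\<^esub> S \<in> carrier (tensor_product M N)"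
  by (elim tensor_cases) (auto simp: smult_tensor_class intro!: tensor_class_closed dest!: subsetD[OF keys_scale_pm])

lemma closed_space_tensor: "closed_space (tensor_product M N)"
  by (simp add: closed_space_def tensor_add_closed tensor_smult_closed)

lemma tensor_zero_closed: "\<zero>\<^bsub>tensor_product M N\<^esub> \<in> carrier (tensor_product M N)"
  unfolding zero_tensor by (rule tensor_class_closed) simp

lemma tensor_ext:
  assumes "S \<in> carrier (tensor_product M N)" "T \<in> carrier (tensor_product M N)"
    and "\<And>b. bilinear_form M N b \<Longrightarrow> tensor_eval b S = tensor_eval b T"
  shows "S = T"
  using assms by (elim tensor_cases) (auto simp: tensor_eval_class intro!: tensor_class_eqI)

lemma tensor_eval_add:
  "bilinear_form M N b \<Longrightarrow> S \<in> carrier (tensor_product M N) \<Longrightarrow> T \<in> carrier (tensor_product M N) \<Longrightarrow>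
   tensor_eval b (S \<oplus>\<^bsub>tensor_product M N\<^esub> T) = tensor_eval b S + tensor_eval b T"
  by (elim tensor_cases) (simp add: add_tensor_class tensor_eval_class linext_add)

lemma tensor_eval_smult:
  "bilinear_form M N b \<Longrightarrow> S \<in> carrier (tensor_product M N) \<Longrightarrow>
   tensor_eval b (c \<odot>\<^bsub>tensor_product M N\<^esub> S) = c * tensor_eval b S"
  by (elim tensor_cases) (simp add: smult_tensor_class tensor_eval_class linext_scale)

lemma tensor_eval_zero: "bilinear_form M N b \<Longrightarrow> tensor_eval b \<zero>\<^bsub>tensor_product M N\<^esub> = 0"
  by (simp add: zero_tensor tensor_eval_class)

lemma abelian_group_tensor: "abelian_group (tensor_product M N)"
proof (rule abelian_groupI)
  let ?T = "tensor_product M N"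
  fix S assume S: "S \<in> carrier ?T"
  show "\<exists>y\<in>carrier ?T. y \<oplus>\<^bsub>?T\<^esub> S = \<zero>\<^bsub>?T\<^esub>"
  proof
    show "(- 1) \<odot>\<^bsub>?T\<^esub> S \<oplus>\<^bsub>?T\<^esub> S = \<zero>\<^bsub>?T\<^esub>"
      by (rule tensor_ext[of _ M N])
        (simp_all add: S tensor_eval_add tensor_eval_smult tensor_eval_zero tensor_add_closed tensor_smult_closed tensor_zero_closed)
  qed (simp add: S tensor_smult_closed)
qed (rule tensor_ext[of _ M N] | simp add: tensor_eval_add tensor_eval_zero tensor_add_closed tensor_zero_closed algebra_simps)+

lemma tensor_minus:
  assumes "S \<in> carrier (tensor_product M N)" "T \<in> carrier (tensor_product M N)"
  shows "S \<ominus>\<^bsub>tensor_product M N\<^esub> T = S \<oplus>\<^bsub>tensor_product M N\<^esub> ((- 1) \<odot>\<^bsub>tensor_product M N\<^esub> T)"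
proof -
  let ?T = "tensor_product M N"
  interpret abelian_group ?T by (rule abelian_group_tensor)
  have "\<ominus>\<^bsub>?T\<^esub> T = (- 1) \<odot>\<^bsub>?T\<^esub> T"
    by (rule minus_equality)
      (rule tensor_ext[of _ M N] | simp add: assms tensor_eval_add tensor_eval_zero tensor_eval_smult tensor_add_closed tensor_zero_closed tensor_smult_closed)+
  then show ?thesis by (simp add: a_minus_def)
qed

lemma tensor_minus_closed:
  assumes "S \<in> carrier (tensor_product M N)" "T \<in> carrier (tensor_product M N)"
  shows "S \<ominus>\<^bsub>tensor_product M N\<^esub> T \<in> carrier (tensor_product M N)"
  using assms by (simp add: tensor_minus tensor_add_closed tensor_smult_closed)

lemma tensor_eval_minus:
  "bilinear_form M N b \<Longrightarrow> S \<in> carrier (tensor_product M N) \<Longrightarrow> T \<in> carrier (tensor_product M N) \<Longrightarrow>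
   tensor_eval b (S \<ominus>\<^bsub>tensor_product M N\<^esub> T) = tensor_eval b S - tensor_eval b T"
  by (simp add: tensor_minus tensor_eval_add tensor_eval_smult tensor_smult_closed)

lemma bilinear_form_cong:
  assumes "closed_space M" "closed_space N"
    and "\<And>u v. u \<in> carrier M \<Longrightarrow> v \<in> carrier N \<Longrightarrow> b (u, v) = b' (u, v)"
  shows "bilinear_form M N b \<longleftrightarrow> bilinear_form M N b'"
  using assms unfolding bilinear_form_def closed_space_def by simp

lemma tensor_eval_cong:
  assumes "closed_space M" "closed_space N" "bilinear_form M N b" "S \<in> carrier (tensor_product M N)"
    and "\<And>u v. u \<in> carrier M \<Longrightarrow> v \<in> carrier N \<Longrightarrow> b (u, v) = b' (u, v)"
  shows "tensor_eval b S = tensor_eval b' S"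
proof -
  have "bilinear_form M N b'"
    using assms bilinear_form_cong[of M N b b'] by simp
  then show ?thesis
    using assms(3,4,5) by (elim tensor_cases) (auto simp: tensor_eval_class intro!: linext_cong)
qed

lemma bilinear_form_comp:
  "bilinear_form M N b \<Longrightarrow> linear_between M M f \<Longrightarrow> linear_between N N g \<Longrightarrow>
   bilinear_form M N (\<lambda>(u, v). b (f u, g v))"
  unfolding bilinear_form_def linear_between_def Pi_iff by simp

lemma linext_push:
  "linext b (\<Sum>(u, v)\<in>Poly_Mapping.keys p. Poly_Mapping.single (f u, g v) (Poly_Mapping.lookup p (u, v)))
   = linext (\<lambda>(u, v). b (f u, g v)) p"
  by (simp add: linext_sum linext_def[of _ p] case_prod_beta)

lemma keys_push:
  "Poly_Mapping.keys (\<Sum>(u, v)\<in>Poly_Mapping.keys p. Poly_Mapping.single (f u, g v) (Poly_Mapping.lookup p (u, v)))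
   \<subseteq> (\<lambda>(u, v). (f u, g v)) ` Poly_Mapping.keys p"
  by (rule order_trans[OF keys_sum]) (auto split: if_splits)

lemma tensor_map_tensor_class:
  assumes "linear_between M M f" "linear_between N N g"
  shows "tensor_map M N f g (tensor_class M N p) = tensor_class M N
    (\<Sum>(u, v)\<in>Poly_Mapping.keys p. Poly_Mapping.single (f u, g v) (Poly_Mapping.lookup p (u, v)))"
  unfolding tensor_map_def tensor_class_def[of M N, symmetric]
proof (rule Union_tensor_class_eq)
  fix b q assume "bilinear_form M N b" "q \<in> tensor_class M N p"
  then have "linext (\<lambda>(u, v). b (f u, g v)) q = linext (\<lambda>(u, v). b (f u, g v)) p"
    using assms by (intro linext_mem_class[where M = M and N = N] bilinear_form_comp)
  then show "linext b (\<Sum>(u, v)\<in>Poly_Mapping.keys q. Poly_Mapping.single (f u, g v) (Poly_Mapping.lookup q (u, v)))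
      = linext b (\<Sum>(u, v)\<in>Poly_Mapping.keys p. Poly_Mapping.single (f u, g v) (Poly_Mapping.lookup p (u, v)))"
    by (simp only: linext_push)
qed (use self_mem_tensor_class in blast)

lemma tensor_map_closed:
  assumes "linear_between M M f" "linear_between N N g" "S \<in> carrier (tensor_product M N)"
  shows "tensor_map M N f g S \<in> carrier (tensor_product M N)"
  using assms(3)
proof (rule tensor_cases)
  fix p assume p: "S = tensor_class M N p" "Poly_Mapping.keys p \<subseteq> carrier M \<times> carrier N"
  have "f \<in> carrier M \<rightarrow> carrier M" "g \<in> carrier N \<rightarrow> carrier N"
    using assms by (auto simp: linear_between_def)
  with p(2) keys_push[of f g p] show ?thesis
    unfolding p(1) tensor_map_tensor_class[OF assms(1,2)] by (intro tensor_class_closed) fastforce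
qed

lemma tensor_eval_tensor_map:
  assumes "bilinear_form M N b" "linear_between M M f" "linear_between N N g"
    "S \<in> carrier (tensor_product M N)"
  shows "tensor_eval b (tensor_map M N f g S) = tensor_eval (\<lambda>(u, v). b (f u, g v)) S"
  using assms(4)
proof (rule tensor_cases)
  fix p assume p: "S = tensor_class M N p"
  show ?thesis
    unfolding p tensor_map_tensor_class[OF assms(2,3)] tensor_eval_class[OF assms(1)]
      tensor_eval_class[OF bilinear_form_comp[OF assms(1-3)]] by (rule linext_push)
qed

section \<open>Pure tensors and products\<close>

definition pure_tensor ::
  "('f::field, 'u, 'm) module_scheme \<Rightarrow> ('f, 'v, 'n) module_scheme \<Rightarrow> 'u \<Rightarrow> 'v \<Rightarrow> ('u \<times> 'v \<Rightarrow>\<^sub>0 'f) set" where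
  "pure_tensor M N u v = tensor_class M N (pair_pm u v)"

lemma pure_tensor_closed: "u \<in> carrier M \<Longrightarrow> v \<in> carrier N \<Longrightarrow> pure_tensor M N u v \<in> carrier (tensor_product M N)"
  unfolding pure_tensor_def by (rule tensor_class_closed) simp

lemma tensor_eval_pure_tensor: "bilinear_form M N b \<Longrightarrow> tensor_eval b (pure_tensor M N u v) = b (u, v)"
  by (simp add: pure_tensor_def tensor_eval_class)

text \<open>
  Scalars need no separate case, as they can be absorbed into the first factor.
\<close>

lemma tensor_induct [consumes 2, case_names zero add]:
  assumes M: "closed_space M" and S: "S \<in> carrier (tensor_product M N)"
    and zero: "P \<zero>\<^bsub>tensor_product M N\<^esub>"
    and add: "\<And>S u v. S \<in> carrier (tensor_product M N) \<Longrightarrow> P S \<Longrightarrow> u \<in> carrier M \<Longrightarrow> v \<in> carrier N \<Longrightarrow>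
                P (S \<oplus>\<^bsub>tensor_product M N\<^esub> pure_tensor M N u v)"
  shows "P S"
  using S
proof (rule tensor_cases)
  fix p assume p: "S = tensor_class M N p" "Poly_Mapping.keys p \<subseteq> carrier M \<times> carrier N"
  let ?s = "\<lambda>K. \<Sum>k\<in>K. Poly_Mapping.single k (Poly_Mapping.lookup p k)"
  have "P (tensor_class M N (?s K)) \<and> tensor_class M N (?s K) \<in> carrier (tensor_product M N)"
    if "finite K" "K \<subseteq> Poly_Mapping.keys p" for K
    using that
  proof (induction K rule: finite_induct)
    case empty
    then show ?case using zero tensor_zero_closed[of M N] by (simp add: zero_tensor)
  next
    case (insert k K)
    obtain u v where k: "k = (u, v)" "u \<in> carrier M" "v \<in> carrier N"
      using insert.prems p(2) by auto
    define c where "c = Poly_Mapping.lookup p k"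
    have cu: "c \<odot>\<^bsub>M\<^esub> u \<in> carrier M"
      using M k by (simp add: closed_space_def)
    have "tensor_class M N (?s (insert k K)) = tensor_class M N (?s K + pair_pm (c \<odot>\<^bsub>M\<^esub> u) v)"
    proof (rule tensor_class_eqI)
      fix b assume "bilinear_form M N b"
      then have "b (c \<odot>\<^bsub>M\<^esub> u, v) = c * b (u, v)"
        using k by (simp add: bilinear_form_def)
      then show "linext b (?s (insert k K)) = linext b (?s K + pair_pm (c \<odot>\<^bsub>M\<^esub> u) v)"
        using insert.hyps by (simp add: linext_add c_def[symmetric] k(1)[symmetric] add.commute)
    qed
    also have "\<dots> = tensor_class M N (?s K) \<oplus>\<^bsub>tensor_product M N\<^esub> pure_tensor M N (c \<odot>\<^bsub>M\<^esub> u) v"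
      by (simp add: add_tensor_class pure_tensor_def)
    finally have eq: "tensor_class M N (?s (insert k K)) = tensor_class M N (?s K) \<oplus>\<^bsub>tensor_product M N\<^esub> pure_tensor M N (c \<odot>\<^bsub>M\<^esub> u) v" .
    have IH: "P (tensor_class M N (?s K))" "tensor_class M N (?s K) \<in> carrier (tensor_product M N)"
      using insert.IH insert.prems by auto
    show ?case
      unfolding eq using add[OF IH(2,1) cu k(3)] tensor_add_closed[OF IH(2) pure_tensor_closed[OF cu k(3)]] by blast
  qed
  from this[OF finite_keys order_refl] have "P (tensor_class M N (?s (Poly_Mapping.keys p)))" ..
  also have "?s (Poly_Mapping.keys p) = p"
    by (rule poly_mapping_sum_single)
  finally show ?thesis by (simp add: p(1))
qed

lemma linext_fun_add: "linext (\<lambda>k. f k + g k) p = linext f p + linext g p"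
  by (simp add: linext_def distrib_left sum.distrib)

lemma linext_fun_scale: "linext (\<lambda>k. c * f k) p = c * linext f p"
  unfolding linext_def sum_distrib_left by (rule sum.cong[OF refl mult.left_commute])

lemma tensor_eval_fun_add: "tensor_eval (\<lambda>k. f k + g k) S = tensor_eval f S + tensor_eval g S"
  by (simp add: tensor_eval_def linext_fun_add)

lemma tensor_eval_fun_scale: "tensor_eval (\<lambda>k. c * f k) S = c * tensor_eval f S"
  by (simp add: tensor_eval_def linext_fun_scale)

lemma bilinear_form_linext:
  assumes "\<And>k. k \<in> Poly_Mapping.keys q \<Longrightarrow> bilinear_form M N (\<lambda>k'. G k' k)"
  shows "bilinear_form M N (\<lambda>k'. linext (G k') q)"
  using assms unfolding bilinear_form_def
  by (auto simp flip: linext_fun_add linext_fun_scale intro!: linext_cong)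

lemma bilinear_form_tensor_eval:
  assumes M: "closed_space M" and N: "closed_space N"
    and G: "\<And>k. k \<in> carrier M \<times> carrier N \<Longrightarrow> bilinear_form M' N' (G k)"
    and G': "\<And>k'. k' \<in> carrier M' \<times> carrier N' \<Longrightarrow> bilinear_form M N (\<lambda>k. G k k')"
    and T: "T \<in> carrier (tensor_product M' N')"
  shows "bilinear_form M N (\<lambda>k. tensor_eval (G k) T)"
  using T
proof (rule tensor_cases)
  fix q assume q: "T = tensor_class M' N' q" "Poly_Mapping.keys q \<subseteq> carrier M' \<times> carrier N'"
  have "bilinear_form M N (\<lambda>k. linext (G k) q)"
    using q(2) G' by (intro bilinear_form_linext) blast
  also have "bilinear_form M N (\<lambda>k. linext (G k) q) \<longleftrightarrow> bilinear_form M N (\<lambda>k. tensor_eval (G k) T)"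
    using M N by (rule bilinear_form_cong) (simp add: q(1) tensor_eval_class G)
  finally show ?thesis .
qed

text \<open>
  Iterated evaluation: a family of forms that is bilinear in each of two pairs of variables induces a
  bilinear form on a pair of tensor products.
\<close>

lemma bilinear_form_tensor_eval2:
  assumes M: "closed_space M" and N: "closed_space N"
    and G: "\<And>k. k \<in> carrier M \<times> carrier N \<Longrightarrow> bilinear_form M' N' (G k)"
    and G': "\<And>k'. k' \<in> carrier M' \<times> carrier N' \<Longrightarrow> bilinear_form M N (\<lambda>k. G k k')"
  shows "bilinear_form (tensor_product M N) (tensor_product M' N') (\<lambda>(S, T). tensor_eval (\<lambda>k. tensor_eval (G k) T) S)"
proof -
  note bil = bilinear_form_tensor_eval[OF M N G G']
  have "tensor_eval (\<lambda>k. tensor_eval (G k) (T \<oplus>\<^bsub>tensor_product M' N'\<^esub> T')) S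
      = tensor_eval (\<lambda>k. tensor_eval (G k) T + tensor_eval (G k) T') S"
    if "S \<in> carrier (tensor_product M N)" "T \<in> carrier (tensor_product M' N')"
       "T' \<in> carrier (tensor_product M' N')" for S T T'
    using M N _ that(1)
    by (rule tensor_eval_cong) (use that in \<open>auto intro!: bil tensor_add_closed simp: tensor_eval_add[OF G]\<close>)
  moreover have "tensor_eval (\<lambda>k. tensor_eval (G k) (c \<odot>\<^bsub>tensor_product M' N'\<^esub> T)) S = tensor_eval (\<lambda>k. c * tensor_eval (G k) T) S"
    if "S \<in> carrier (tensor_product M N)" "T \<in> carrier (tensor_product M' N')" for c S T
    using M N _ that(1)
    by (rule tensor_eval_cong) (use that in \<open>auto intro!: bil tensor_smult_closed simp: tensor_eval_smult[OF G]\<close>)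
  ultimately show ?thesis
    unfolding bilinear_form_def[of "tensor_product M N"]
    by (auto simp: tensor_eval_add[OF bil] tensor_eval_smult[OF bil] tensor_eval_fun_add tensor_eval_fun_scale)
qed

definition bilinear_product :: "('f, 'u, 'm) module_scheme \<Rightarrow> bool" where
  "bilinear_product M \<longleftrightarrow>
     (\<forall>x\<in>carrier M. \<forall>y\<in>carrier M. x \<otimes>\<^bsub>M\<^esub> y \<in> carrier M) \<and>
     (\<forall>x\<in>carrier M. \<forall>y\<in>carrier M. \<forall>z\<in>carrier M.
        (x \<oplus>\<^bsub>M\<^esub> y) \<otimes>\<^bsub>M\<^esub> z = x \<otimes>\<^bsub>M\<^esub> z \<oplus>\<^bsub>M\<^esub> y \<otimes>\<^bsub>M\<^esub> z \<and>
        z \<otimes>\<^bsub>M\<^esub> (x \<oplus>\<^bsub>M\<^esub> y) = z \<otimes>\<^bsub>M\<^esub> x \<oplus>\<^bsub>M\<^esub> z \<otimes>\<^bsub>M\<^esub> y) \<and>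
     (\<forall>c. \<forall>x\<in>carrier M. \<forall>y\<in>carrier M.
        (c \<odot>\<^bsub>M\<^esub> x) \<otimes>\<^bsub>M\<^esub> y = c \<odot>\<^bsub>M\<^esub> (x \<otimes>\<^bsub>M\<^esub> y) \<and> x \<otimes>\<^bsub>M\<^esub> (c \<odot>\<^bsub>M\<^esub> y) = c \<odot>\<^bsub>M\<^esub> (x \<otimes>\<^bsub>M\<^esub> y))"

lemma linear_between_mult:
  "bilinear_product M \<Longrightarrow> x \<in> carrier M \<Longrightarrow> linear_between M M (\<lambda>y. x \<otimes>\<^bsub>M\<^esub> y)"
  by (simp add: bilinear_product_def linear_between_def)

lemma keys_bilinear_relations:
  fixes M :: "('f::field, 'u, 'm) module_scheme" and N :: "('f, 'v, 'n) module_scheme"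
  assumes "closed_space M" "closed_space N" "r \<in> bilinear_relations M N"
  shows "Poly_Mapping.keys r \<subseteq> carrier M \<times> carrier N"
  using assms(3) unfolding bilinear_relations_def
proof (induction rule: pm.span_induct_alt)
  case (step c x y)
  have s: "Poly_Mapping.keys (Poly_Mapping.single k d) \<subseteq> carrier M \<times> carrier N" if "k \<in> carrier M \<times> carrier N" for k and d :: 'f
    using that by auto
  have d: "Poly_Mapping.keys (p - q) \<subseteq> Poly_Mapping.keys p \<union> Poly_Mapping.keys q" for p q :: "'u \<times> 'v \<Rightarrow>\<^sub>0 'f"
    by (rule keys_diff)
  have "Poly_Mapping.keys x \<subseteq> carrier M \<times> carrier N"
    using step(1) assms(1,2) unfolding closed_space_def
    by (elim UnE CollectE exE conjE)
      (simp only:, intro order_trans[OF d] order_trans[OF keys_scale_pm] Un_least s; simp)+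
  then show ?case
    using step(2) Poly_Mapping.keys_add[of "scale_pm c x" y] keys_scale_pm[of c x] by blast
qed simp

context
  fixes M :: "('f::field, 'u, 'm) module_scheme" and N :: "('f, 'v, 'n) module_scheme"
  assumes M: "closed_space M" "bilinear_product M" and N: "closed_space N" "bilinear_product N"
begin

definition mult_form :: "('u \<times> 'v \<Rightarrow> 'f) \<Rightarrow> 'u \<times> 'v \<Rightarrow> 'u \<times> 'v \<Rightarrow> 'f" where
  "mult_form b k k' = b (fst k \<otimes>\<^bsub>M\<^esub> fst k', snd k \<otimes>\<^bsub>N\<^esub> snd k')"

lemma bilinear_mult_form:
  assumes "bilinear_form M N b"
  shows "k \<in> carrier M \<times> carrier N \<Longrightarrow> bilinear_form M N (mult_form b k)"
    and "k' \<in> carrier M \<times> carrier N \<Longrightarrow> bilinear_form M N (\<lambda>k. mult_form b k k')"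
  using assms M N by (auto simp: bilinear_form_def mult_form_def bilinear_product_def)

lemma linext_mult_free:
  "linext b (p \<otimes>\<^bsub>free_pairs M N\<^esub> q) = linext (\<lambda>k. linext (mult_form b k) q) p"
proof -
  have "linext b (p \<otimes>\<^bsub>free_pairs M N\<^esub> q) = (\<Sum>k\<in>Poly_Mapping.keys p. \<Sum>k'\<in>Poly_Mapping.keys q.
      (Poly_Mapping.lookup p k * Poly_Mapping.lookup q k') * mult_form b k k')"
    by (simp add: free_pairs_def linext_sum case_prod_beta mult_form_def)
  also have "\<dots> = (\<Sum>k\<in>Poly_Mapping.keys p. Poly_Mapping.lookup p k *
      (\<Sum>k'\<in>Poly_Mapping.keys q. Poly_Mapping.lookup q k' * mult_form b k k'))"
    unfolding sum_distrib_left mult.assoc ..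
  finally show ?thesis
    unfolding linext_def .
qed

lemma mult_tensor_class:
  assumes "Poly_Mapping.keys p \<subseteq> carrier M \<times> carrier N" "Poly_Mapping.keys q \<subseteq> carrier M \<times> carrier N"
  shows "tensor_class M N p \<otimes>\<^bsub>tensor_product M N\<^esub> tensor_class M N q = tensor_class M N (p \<otimes>\<^bsub>free_pairs M N\<^esub> q)"
proof -
  have keys: "Poly_Mapping.keys a \<subseteq> carrier M \<times> carrier N"
    if "a \<in> tensor_class M N p" for a
    using keys_bilinear_relations[OF M(1) N(1), of "a - p"] that assms(1)
      Poly_Mapping.keys_add[of "a - p" p] by (auto simp: mem_tensor_class_iff)
  have eq: "linext b (a \<otimes>\<^bsub>free_pairs M N\<^esub> c) = linext b (p \<otimes>\<^bsub>free_pairs M N\<^esub> q)"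
    if b: "bilinear_form M N b" and a: "a \<in> tensor_class M N p" and c: "c \<in> tensor_class M N q" for a b c
  proof -
    have "linext (\<lambda>k. linext (mult_form b k) c) a = linext (\<lambda>k. linext (mult_form b k) q) a"
      using keys[OF a] by (intro linext_cong linext_mem_class[OF bilinear_mult_form(1)[OF b] c]) blast
    also have "\<dots> = linext (\<lambda>k. linext (mult_form b k) q) p"
      using assms(2) by (intro linext_mem_class[OF bilinear_form_linext a] bilinear_mult_form(2)[OF b]) blast
    finally show ?thesis by (simp only: linext_mult_free)
  qed
  have "tensor_class M N p \<otimes>\<^bsub>tensor_product M N\<^esub> tensor_class M N q
      = (\<Union>(a, c)\<in>tensor_class M N p \<times> tensor_class M N q. tensor_class M N (a \<otimes>\<^bsub>free_pairs M N\<^esub> c))"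
    by (auto simp: tensor_product_def quotient_module_def rcoset_mult_def tensor_class_def[of M N])
  also have "\<dots> = (\<Union>k\<in>tensor_class M N p \<times> tensor_class M N q. tensor_class M N (fst k \<otimes>\<^bsub>free_pairs M N\<^esub> snd k))"
    by auto
  also have "\<dots> = tensor_class M N (p \<otimes>\<^bsub>free_pairs M N\<^esub> q)"
    using self_mem_tensor_class by (intro Union_tensor_class_eq) (auto intro!: eq)
  finally show ?thesis .
qed

text \<open>
  Evaluation of a product as an iterated evaluation. This reduces identities for the bracket to
  identities between the products of representatives.
\<close>

lemma tensor_eval_mult:
  assumes b: "bilinear_form M N b" and S: "S \<in> carrier (tensor_product M N)" and T: "T \<in> carrier (tensor_product M N)"
  shows "tensor_eval b (S \<otimes>\<^bsub>tensor_product M N\<^esub> T) = tensor_eval (\<lambda>k. tensor_eval (mult_form b k) T) S"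
proof -
  obtain p where p: "S = tensor_class M N p" "Poly_Mapping.keys p \<subseteq> carrier M \<times> carrier N"
    using S by (rule tensor_cases)
  obtain q where q: "T = tensor_class M N q" "Poly_Mapping.keys q \<subseteq> carrier M \<times> carrier N"
    using T by (rule tensor_cases)
  have "tensor_eval (\<lambda>k. tensor_eval (mult_form b k) T) S = linext (\<lambda>k. tensor_eval (mult_form b k) T) p"
    unfolding p(1) by (intro tensor_eval_class bilinear_form_tensor_eval[OF M(1) N(1) _ _ T] bilinear_mult_form b)
  also have "\<dots> = linext (\<lambda>k. linext (mult_form b k) q) p"
    unfolding q(1) by (intro linext_cong tensor_eval_class bilinear_mult_form b subsetD[OF p(2)])
  also have "\<dots> = tensor_eval b (S \<otimes>\<^bsub>tensor_product M N\<^esub> T)"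
    unfolding p(1) q(1) mult_tensor_class[OF p(2) q(2)] tensor_eval_class[OF b] linext_mult_free ..
  finally show ?thesis ..
qed

lemma tensor_mult_closed:
  assumes S: "S \<in> carrier (tensor_product M N)" and T: "T \<in> carrier (tensor_product M N)"
  shows "S \<otimes>\<^bsub>tensor_product M N\<^esub> T \<in> carrier (tensor_product M N)"
proof -
  obtain p where p: "S = tensor_class M N p" "Poly_Mapping.keys p \<subseteq> carrier M \<times> carrier N"
    using S by (rule tensor_cases)
  obtain q where q: "T = tensor_class M N q" "Poly_Mapping.keys q \<subseteq> carrier M \<times> carrier N"
    using T by (rule tensor_cases)
  have prod: "(fst k \<otimes>\<^bsub>M\<^esub> fst k', snd k \<otimes>\<^bsub>N\<^esub> snd k') \<in> carrier M \<times> carrier N"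
    if "k \<in> Poly_Mapping.keys p" "k' \<in> Poly_Mapping.keys q" for k k'
    using subsetD[OF p(2) that(1)] subsetD[OF q(2) that(2)] M(2) N(2) by (auto simp: bilinear_product_def)
  have "p \<otimes>\<^bsub>free_pairs M N\<^esub> q = (\<Sum>k\<in>Poly_Mapping.keys p. \<Sum>k'\<in>Poly_Mapping.keys q.
      Poly_Mapping.single (fst k \<otimes>\<^bsub>M\<^esub> fst k', snd k \<otimes>\<^bsub>N\<^esub> snd k') (Poly_Mapping.lookup p k * Poly_Mapping.lookup q k'))"
    by (simp add: free_pairs_def case_prod_beta)
  also have "Poly_Mapping.keys \<dots> \<subseteq> carrier M \<times> carrier N"
    by (intro order_trans[OF keys_sum] UN_least) (use prod in simp)
  finally have "Poly_Mapping.keys (p \<otimes>\<^bsub>free_pairs M N\<^esub> q) \<subseteq> carrier M \<times> carrier N" .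
  then show ?thesis
    unfolding p(1) q(1) mult_tensor_class[OF p(2) q(2)] by (rule tensor_class_closed)
qed

lemma bilinear_product_tensor: "bilinear_product (tensor_product M N)"
proof -
  have bil: "bilinear_form (tensor_product M N) (tensor_product M N)
      (\<lambda>(S, T). tensor_eval (\<lambda>k. tensor_eval (mult_form b k) T) S)" if "bilinear_form M N b" for b
    by (intro bilinear_form_tensor_eval2 M(1) N(1) bilinear_mult_form that)
  note rule = tensor_ext[of _ M N] and closed = tensor_mult_closed tensor_add_closed tensor_smult_closed
  note bil' = bil[unfolded bilinear_form_def[of "tensor_product M N"], simplified]
  show ?thesis
    unfolding bilinear_product_def
    by (intro conjI ballI allI; (rule rule)?;
        simp add: closed tensor_eval_mult tensor_eval_add tensor_eval_smult bil')
qed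

end

lemma add_pure_tensor_add_right:
  assumes "closed_space N" "S \<in> carrier (tensor_product M N)" "u \<in> carrier M" "v \<in> carrier N" "v' \<in> carrier N"
  shows "S \<oplus>\<^bsub>tensor_product M N\<^esub> pure_tensor M N u (v \<oplus>\<^bsub>N\<^esub> v')
       = S \<oplus>\<^bsub>tensor_product M N\<^esub> pure_tensor M N u v \<oplus>\<^bsub>tensor_product M N\<^esub> pure_tensor M N u v'"
proof -
  have "v \<oplus>\<^bsub>N\<^esub> v' \<in> carrier N"
    using assms by (simp add: closed_space_def)
  then show ?thesis
    using assms
    by (intro tensor_ext[of _ M N])
      (auto simp: bilinear_form_def tensor_eval_add tensor_eval_pure_tensor tensor_add_closed pure_tensor_closed)
qed

lemma add_pure_tensor_add_left:
  assumes "closed_space M" "S \<in> carrier (tensor_product M N)" "u \<in> carrier M" "u' \<in> carrier M" "v \<in> carrier N"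
  shows "S \<oplus>\<^bsub>tensor_product M N\<^esub> pure_tensor M N (u \<oplus>\<^bsub>M\<^esub> u') v
       = S \<oplus>\<^bsub>tensor_product M N\<^esub> pure_tensor M N u v \<oplus>\<^bsub>tensor_product M N\<^esub> pure_tensor M N u' v"
proof -
  have "u \<oplus>\<^bsub>M\<^esub> u' \<in> carrier M"
    using assms by (simp add: closed_space_def)
  then show ?thesis
    using assms
    by (intro tensor_ext[of _ M N])
      (auto simp: bilinear_form_def tensor_eval_add tensor_eval_pure_tensor tensor_add_closed pure_tensor_closed)
qed

lemma tensor_idem_zero:
  assumes "S \<in> carrier (tensor_product M N)" "S = S \<oplus>\<^bsub>tensor_product M N\<^esub> S"
  shows "S = \<zero>\<^bsub>tensor_product M N\<^esub>"
proof (rule tensor_ext[of _ M N])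
  fix b assume b: "bilinear_form M N b"
  have "tensor_eval b S = tensor_eval b S + tensor_eval b S"
    using assms(2) tensor_eval_add[OF b assms(1,1)] by metis
  then have "tensor_eval b S = 0"
    by (rule add_cancel_right_right[THEN iffD1])
  then show "tensor_eval b S = tensor_eval b \<zero>\<^bsub>tensor_product M N\<^esub>"
    by (simp add: tensor_eval_zero[OF b])
qed (use assms tensor_zero_closed in auto)

section \<open>The Witt algebra\<close>

lemma lookup_single_times:
  fixes p :: "'f::field \<Rightarrow>\<^sub>0 'f"
  shows "Poly_Mapping.lookup (Poly_Mapping.single \<gamma> 1 * p) \<alpha> = Poly_Mapping.lookup p (\<alpha> - \<gamma>)"
proof -
  have *: "\<alpha> = l + q \<longleftrightarrow> q = \<alpha> - l" for l q
    by (auto simp: algebra_simps)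
  have "Poly_Mapping.lookup (Poly_Mapping.single \<gamma> 1 * p) \<alpha>
      = (\<Sum>l. (Poly_Mapping.lookup p (\<alpha> - l) when \<gamma> = l))"
    unfolding lookup_mult * Sum_any_when_equal lookup_single when_mult by simp
  then show ?thesis
    unfolding Sum_any_when_equal' .
qed

lemma lookup_euler_op: "Poly_Mapping.lookup (euler_op p) \<alpha> = \<alpha> * Poly_Mapping.lookup p \<alpha>"
  by (auto simp: euler_op_def lookup_mapp when_def not_in_keys_iff_lookup_eq_zero)

lemma euler_op_add: "euler_op (p + q) = euler_op p + euler_op q"
  by (rule poly_mapping_eqI) (simp add: lookup_euler_op lookup_add distrib_left)

lemma scale_pm_eq_single: "scale_pm c p = Poly_Mapping.single 0 c * (p :: 'f::field \<Rightarrow>\<^sub>0 'f)"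
  by (rule mult_map_scale_conv_mult)

lemma euler_op_scale: "euler_op (scale_pm c p) = scale_pm c (euler_op p)"
  by (rule poly_mapping_eqI) (simp add: lookup_euler_op)

lemma keys_euler_op: "Poly_Mapping.keys (euler_op p) \<subseteq> Poly_Mapping.keys p"
  unfolding euler_op_def by (rule keys_mapp_subset)

lemma witt_simps:
  "carrier (witt_algebra \<Gamma>) = {p. Poly_Mapping.keys p \<subseteq> \<Gamma>}"
  "p \<otimes>\<^bsub>witt_algebra \<Gamma>\<^esub> q = p * euler_op q - q * euler_op p"
  "p \<oplus>\<^bsub>witt_algebra \<Gamma>\<^esub> q = p + q"
  "c \<odot>\<^bsub>witt_algebra \<Gamma>\<^esub> p = scale_pm c p"
  by (simp_all add: witt_algebra_def)

lemma closed_space_witt: "closed_space (witt_algebra \<Gamma>)"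
  by (auto simp: closed_space_def witt_simps
      dest!: subsetD[OF Poly_Mapping.keys_add] subsetD[OF keys_scale_pm])

text \<open>
  The bracket \<open>[e\<^sup>\<gamma> \<partial>, e\<^sup>\<delta> \<partial>] = (\<delta> - \<gamma>) e\<^bsup>\<gamma>+\<delta>\<^esup> \<partial>\<close>, read at the exponent \<open>\<alpha> = \<gamma> + \<delta>\<close>.
\<close>

lemma lookup_witt_mult:
  "Poly_Mapping.lookup (Poly_Mapping.single \<gamma> 1 \<otimes>\<^bsub>witt_algebra \<Gamma>\<^esub> p) \<alpha>
   = (\<alpha> - 2 * \<gamma>) * Poly_Mapping.lookup p (\<alpha> - \<gamma>)"
proof -
  have "euler_op (Poly_Mapping.single \<gamma> 1) = scale_pm \<gamma> (Poly_Mapping.single \<gamma> 1)"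
    by (rule poly_mapping_eqI) (auto simp: lookup_euler_op lookup_single when_def)
  then have eq: "Poly_Mapping.single \<gamma> 1 \<otimes>\<^bsub>witt_algebra \<Gamma>\<^esub> p
      = Poly_Mapping.single \<gamma> 1 * euler_op p - scale_pm \<gamma> (Poly_Mapping.single \<gamma> 1 * p)"
    by (simp only: witt_simps scale_pm_eq_single ac_simps)
  have "(\<alpha> - \<gamma>) * x - \<gamma> * x = (\<alpha> - 2 * \<gamma>) * x" for x
    by (simp add: algebra_simps)
  then show ?thesis
    unfolding eq lookup_minus lookup_scale_pm lookup_single_times lookup_euler_op .
qed

lemma bilinear_product_witt:
  assumes "\<And>a b. a \<in> \<Gamma> \<Longrightarrow> b \<in> \<Gamma> \<Longrightarrow> a + b \<in> \<Gamma>"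
  shows "bilinear_product (witt_algebra \<Gamma>)"
  unfolding bilinear_product_def
proof (intro conjI ballI allI)
  have mult: "Poly_Mapping.keys (p * q) \<subseteq> \<Gamma>" if "Poly_Mapping.keys p \<subseteq> \<Gamma>" "Poly_Mapping.keys q \<subseteq> \<Gamma>" for p q :: "'a \<Rightarrow>\<^sub>0 'a"
    using keys_mult[of p q] that assms by blast
  fix x y assume "x \<in> carrier (witt_algebra \<Gamma>)" "y \<in> carrier (witt_algebra \<Gamma>)"
  then have "Poly_Mapping.keys (x * euler_op y) \<subseteq> \<Gamma>" "Poly_Mapping.keys (y * euler_op x) \<subseteq> \<Gamma>"
    using keys_euler_op[of x] keys_euler_op[of y] by (auto simp: witt_simps dest!: subsetD[OF mult, rotated 2])
  then show "x \<otimes>\<^bsub>witt_algebra \<Gamma>\<^esub> y \<in> carrier (witt_algebra \<Gamma>)"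
    using keys_diff[of "x * euler_op y" "y * euler_op x"] by (auto simp: witt_simps)
next
  fix c x y
  show "(c \<odot>\<^bsub>witt_algebra \<Gamma>\<^esub> x) \<otimes>\<^bsub>witt_algebra \<Gamma>\<^esub> y = c \<odot>\<^bsub>witt_algebra \<Gamma>\<^esub> (x \<otimes>\<^bsub>witt_algebra \<Gamma>\<^esub> y)"
    unfolding witt_simps euler_op_scale unfolding scale_pm_eq_single by (simp add: algebra_simps)
  show "x \<otimes>\<^bsub>witt_algebra \<Gamma>\<^esub> (c \<odot>\<^bsub>witt_algebra \<Gamma>\<^esub> y) = c \<odot>\<^bsub>witt_algebra \<Gamma>\<^esub> (x \<otimes>\<^bsub>witt_algebra \<Gamma>\<^esub> y)"
    unfolding witt_simps euler_op_scale unfolding scale_pm_eq_single by (simp add: algebra_simps)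
qed (simp_all add: witt_simps euler_op_add algebra_simps)

section \<open>Coordinates for the generalized map Virasoro algebra\<close>

lemma additive_subgroup_type_algebra:
  fixes \<Gamma> :: "'f::field_char_0 set"
  assumes "additive_subgroup \<Gamma> (ring_of_type_algebra :: 'f ring)"
  shows "0 \<in> \<Gamma>" "a \<in> \<Gamma> \<Longrightarrow> b \<in> \<Gamma> \<Longrightarrow> a + b \<in> \<Gamma>" "a \<in> \<Gamma> \<Longrightarrow> - a \<in> \<Gamma>"
proof -
  let ?R = "ring_of_type_algebra :: 'f ring"
  interpret G: additive_subgroup \<Gamma> ?R by fact
  interpret cring ?R by (rule cring_from_type_algebra)
  show "0 \<in> \<Gamma>" using G.zero_closed by (simp add: ring_of_type_algebra_def)
  show "a + b \<in> \<Gamma>" if "a \<in> \<Gamma>" "b \<in> \<Gamma>"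
    using G.a_closed[OF that] by (simp add: ring_of_type_algebra_def)
  show "- a \<in> \<Gamma>" if "a \<in> \<Gamma>"
  proof -
    have "\<ominus>\<^bsub>?R\<^esub> a = - a"
      by (rule minus_equality) (simp_all add: ring_of_type_algebra_def)
    then show ?thesis using G.a_inv_closed[OF that] by simp
  qed
qed

lemma algebra_type_algebra:
  fixes A :: "('f::field_char_0, 'a) module"
  assumes "algebra (ring_of_type_algebra :: 'f ring) A"
  shows "closed_space A" "bilinear_product A" "\<one>\<^bsub>A\<^esub> \<in> carrier A" "\<And>a. a \<in> carrier A \<Longrightarrow> \<one>\<^bsub>A\<^esub> \<otimes>\<^bsub>A\<^esub> a = a"
proof -
  let ?R = "ring_of_type_algebra :: 'f ring"
  interpret algebra ?R A by fact
  have R [simp]: "c \<in> carrier ?R" for c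
    by (simp add: ring_of_type_algebra_def)
  show "closed_space A" by (simp add: closed_space_def)
  show "bilinear_product A"
    unfolding bilinear_product_def
    by (auto simp: smult_assoc2 l_distr r_distr) (metis m_comm R smult_assoc2 smult_closed)
  show "\<one>\<^bsub>A\<^esub> \<in> carrier A" "\<And>a. a \<in> carrier A \<Longrightarrow> \<one>\<^bsub>A\<^esub> \<otimes>\<^bsub>A\<^esub> a = a" by simp_all
qed

locale map_virasoro_algebra =
  fixes \<Gamma> :: "'f::field_char_0 set" and A :: "('f, 'a) module"
  assumes Gamma_0: "0 \<in> \<Gamma>" and Gamma_1: "1 \<in> \<Gamma>"
    and Gamma_add: "a \<in> \<Gamma> \<Longrightarrow> b \<in> \<Gamma> \<Longrightarrow> a + b \<in> \<Gamma>" and Gamma_minus: "a \<in> \<Gamma> \<Longrightarrow> - a \<in> \<Gamma>"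
    and A_closed: "closed_space A" and A_mult: "bilinear_product A"
    and A_one: "\<one>\<^bsub>A\<^esub> \<in> carrier A" and A_one_mult: "x \<in> carrier A \<Longrightarrow> \<one>\<^bsub>A\<^esub> \<otimes>\<^bsub>A\<^esub> x = x"
begin

abbreviation "W \<equiv> witt_algebra \<Gamma>"
abbreviation "L \<equiv> map_virasoro \<Gamma> A"
abbreviation "V \<equiv> tensor_product L L"
abbreviation "act \<equiv> adjoint_diagonal_action L"

lemma Ints_Gamma: "n \<in> \<int> \<Longrightarrow> n \<in> \<Gamma>"
proof (elim Ints_cases)
  have nat: "of_nat k \<in> \<Gamma>" for k
    by (induction k) (auto intro: Gamma_0 Gamma_1 Gamma_add)
  fix z assume "n = of_int z"
  then show ?thesis
    using nat[of "nat z"] Gamma_minus[OF nat[of "nat (- z)"]] by (cases "z \<ge> 0") auto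
qed

lemma W_closed: "closed_space W" and W_mult: "bilinear_product W"
  by (simp_all add: closed_space_witt bilinear_product_witt Gamma_add)

lemma L_eq: "L = tensor_product W A"
  by (simp add: map_virasoro_def)

lemma L_closed: "closed_space L" and L_mult: "bilinear_product L"
  unfolding L_eq by (simp_all add: closed_space_tensor bilinear_product_tensor W_closed W_mult A_closed A_mult)

lemma A_smult_closed: "x \<in> carrier A \<Longrightarrow> c \<odot>\<^bsub>A\<^esub> x \<in> carrier A"
  using A_closed by (simp add: closed_space_def)

text \<open>
  The element \<open>L\<^sub>\<alpha> a\<close>.
\<close>

definition Lgen :: "'f \<Rightarrow> 'a \<Rightarrow> (('f \<Rightarrow>\<^sub>0 'f) \<times> 'a \<Rightarrow>\<^sub>0 'f) set" where
  "Lgen \<alpha> a = pure_tensor W A (Poly_Mapping.single \<alpha> 1) a"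

lemma single_W: "\<alpha> \<in> \<Gamma> \<Longrightarrow> Poly_Mapping.single \<alpha> c \<in> carrier W"
  by (simp add: witt_simps)

lemma Lgen_closed: "\<alpha> \<in> \<Gamma> \<Longrightarrow> a \<in> carrier A \<Longrightarrow> Lgen \<alpha> a \<in> carrier L"
  unfolding Lgen_def L_eq by (intro pure_tensor_closed single_W)

lemma tensor_eval_Lgen: "bilinear_form W A b \<Longrightarrow> tensor_eval b (Lgen \<alpha> a) = b (Poly_Mapping.single \<alpha> 1, a)"
  by (simp add: Lgen_def tensor_eval_pure_tensor)

lemmas W_form_simps = bilinear_form_def[of W A, unfolded witt_simps]

lemma Lgen_smult:
  assumes "\<alpha> \<in> \<Gamma>" "a \<in> carrier A"
  shows "Lgen \<alpha> (c \<odot>\<^bsub>A\<^esub> a) = c \<odot>\<^bsub>L\<^esub> Lgen \<alpha> a"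
  unfolding L_eq
proof (rule tensor_ext[of _ W A])
  fix b assume b: "bilinear_form W A b"
  then have "b (Poly_Mapping.single \<alpha> 1, c \<odot>\<^bsub>A\<^esub> a) = c * b (Poly_Mapping.single \<alpha> 1, a)"
    using assms unfolding bilinear_form_def by (blast intro: single_W)
  then show "tensor_eval b (Lgen \<alpha> (c \<odot>\<^bsub>A\<^esub> a)) = tensor_eval b (c \<odot>\<^bsub>tensor_product W A\<^esub> Lgen \<alpha> a)"
    using Lgen_closed[OF assms] by (simp add: b tensor_eval_Lgen tensor_eval_smult L_eq)
qed (use Lgen_closed[OF assms] Lgen_closed[OF assms(1) A_smult_closed[OF assms(2)]] in
    \<open>simp_all add: L_eq tensor_smult_closed\<close>)

text \<open>
  The elements \<open>L\<^sub>\<alpha> a\<close> span: an element of the Witt algebra is the sum of its homogeneous components,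
  whose coefficients can be moved to the factor \<open>A\<close>.
\<close>

lemma L_induct [consumes 1, case_names zero add]:
  assumes S: "S \<in> carrier L" and zero: "P \<zero>\<^bsub>L\<^esub>"
    and add: "\<And>S \<alpha> a. S \<in> carrier L \<Longrightarrow> P S \<Longrightarrow> \<alpha> \<in> \<Gamma> \<Longrightarrow> a \<in> carrier A \<Longrightarrow> P (S \<oplus>\<^bsub>L\<^esub> Lgen \<alpha> a)"
  shows "P S"
  using W_closed S[unfolded L_eq]
proof (induction rule: tensor_induct)
  case zero
  show ?case using assms(2) by (simp add: L_eq)
next
  case (add S u v)
  let ?T = "tensor_product W A"
  let ?s = "\<lambda>K. \<Sum>k\<in>K. Poly_Mapping.single k (Poly_Mapping.lookup u k)"
  have u: "Poly_Mapping.keys u \<subseteq> \<Gamma>"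
    using add.hyps by (simp add: witt_simps)
  have "?s K \<in> carrier W \<and> P (S \<oplus>\<^bsub>?T\<^esub> pure_tensor W A (?s K) v)" if "finite K" "K \<subseteq> Poly_Mapping.keys u" for K
    using that
  proof (induction K rule: finite_induct)
    case empty
    have "S \<oplus>\<^bsub>?T\<^esub> pure_tensor W A 0 v = S"
    proof (rule tensor_ext[of _ W A])
      fix b assume b: "bilinear_form W A b"
      have "b (scale_pm 0 0, v) = 0 * b (0, v)"
        using b \<open>v \<in> carrier A\<close> unfolding W_form_simps by fastforce
      moreover have "scale_pm 0 0 = (0 :: 'f \<Rightarrow>\<^sub>0 'f)"
        by (rule poly_mapping_eqI) simp
      ultimately have "b (0, v) = 0" by simp
      then show "tensor_eval b (S \<oplus>\<^bsub>?T\<^esub> pure_tensor W A 0 v) = tensor_eval b S"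
        using add.hyps by (simp add: tensor_eval_add[OF b] tensor_eval_pure_tensor[OF b] pure_tensor_closed witt_simps)
    qed (use add.hyps in \<open>simp_all add: tensor_add_closed pure_tensor_closed witt_simps\<close>)
    then show ?case using add.IH by (simp add: witt_simps)
  next
    case (insert \<alpha> K)
    let ?c = "Poly_Mapping.lookup u \<alpha>"
    have K: "?s K \<in> carrier W" "P (S \<oplus>\<^bsub>?T\<^esub> pure_tensor W A (?s K) v)" and \<alpha>: "\<alpha> \<in> \<Gamma>"
      using insert u by auto
    have sum: "?s (insert \<alpha> K) = ?s K \<oplus>\<^bsub>W\<^esub> (?c \<odot>\<^bsub>W\<^esub> Poly_Mapping.single \<alpha> 1)"
      using insert.hyps by (simp add: witt_simps add.commute)
    have mem: "?c \<odot>\<^bsub>W\<^esub> Poly_Mapping.single \<alpha> 1 \<in> carrier W"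
      using \<alpha> by (simp add: witt_simps)
    then have ins: "?s (insert \<alpha> K) \<in> carrier W"
      unfolding sum using K(1) W_closed by (simp add: closed_space_def)
    have cv: "?c \<odot>\<^bsub>A\<^esub> v \<in> carrier A"
      using add.hyps by (simp add: A_smult_closed)
    have lg: "Lgen \<alpha> (?c \<odot>\<^bsub>A\<^esub> v) \<in> carrier ?T"
      using Lgen_closed[OF \<alpha> cv] by (simp add: L_eq)
    have "S \<oplus>\<^bsub>?T\<^esub> pure_tensor W A (?s (insert \<alpha> K)) v
        = S \<oplus>\<^bsub>?T\<^esub> pure_tensor W A (?s K) v \<oplus>\<^bsub>?T\<^esub> Lgen \<alpha> (?c \<odot>\<^bsub>A\<^esub> v)"
    proof (rule tensor_ext[of _ W A])
      fix b assume b: "bilinear_form W A b"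
      have "b (?s (insert \<alpha> K), v) = b (?s K, v) + b (?c \<odot>\<^bsub>W\<^esub> Poly_Mapping.single \<alpha> 1, v)"
        unfolding sum using b K(1) mem add.hyps unfolding bilinear_form_def by blast
      moreover have "b (?c \<odot>\<^bsub>W\<^esub> Poly_Mapping.single \<alpha> 1, v) = b (Poly_Mapping.single \<alpha> 1, ?c \<odot>\<^bsub>A\<^esub> v)"
        using b single_W[OF \<alpha>, of 1] add.hyps unfolding bilinear_form_def by simp
      ultimately show "tensor_eval b (S \<oplus>\<^bsub>?T\<^esub> pure_tensor W A (?s (insert \<alpha> K)) v)
          = tensor_eval b (S \<oplus>\<^bsub>?T\<^esub> pure_tensor W A (?s K) v \<oplus>\<^bsub>?T\<^esub> Lgen \<alpha> (?c \<odot>\<^bsub>A\<^esub> v))"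
        using add.hyps K(1) ins lg
        by (simp add: tensor_eval_add[OF b] tensor_eval_pure_tensor[OF b] tensor_eval_Lgen[OF b] pure_tensor_closed tensor_add_closed)
    qed (use add.hyps K(1) ins lg in \<open>simp_all only: tensor_add_closed pure_tensor_closed\<close>)
    moreover have "P (S \<oplus>\<^bsub>?T\<^esub> pure_tensor W A (?s K) v \<oplus>\<^bsub>?T\<^esub> Lgen \<alpha> (?c \<odot>\<^bsub>A\<^esub> v))"
      using assms(3)[OF _ K(2) \<alpha> cv] add.hyps K(1) unfolding L_eq
      by (simp add: tensor_add_closed pure_tensor_closed)
    ultimately show ?case using ins by simp
  qed
  from this[OF finite_keys order_refl] have "P (S \<oplus>\<^bsub>?T\<^esub> pure_tensor W A (?s (Poly_Mapping.keys u)) v)" ..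
  also have "?s (Poly_Mapping.keys u) = u"
    by (rule poly_mapping_sum_single)
  finally show ?case .
qed

lemma Lgen_add:
  assumes "\<alpha> \<in> \<Gamma>" "a \<in> carrier A" "b \<in> carrier A"
  shows "Lgen \<alpha> (a \<oplus>\<^bsub>A\<^esub> b) = Lgen \<alpha> a \<oplus>\<^bsub>L\<^esub> Lgen \<alpha> b"
proof -
  have ab: "a \<oplus>\<^bsub>A\<^esub> b \<in> carrier A"
    using assms A_closed by (simp add: closed_space_def)
  note closed = Lgen_closed[OF assms(1) ab] Lgen_closed[OF assms(1,2)] Lgen_closed[OF assms(1,3)]
  show ?thesis
    unfolding L_eq
  proof (rule tensor_ext[of _ W A])
    fix f assume f: "bilinear_form W A f"
    then have "f (Poly_Mapping.single \<alpha> 1, a \<oplus>\<^bsub>A\<^esub> b) = f (Poly_Mapping.single \<alpha> 1, a) + f (Poly_Mapping.single \<alpha> 1, b)"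
      using assms unfolding bilinear_form_def by (blast intro: single_W)
    then show "tensor_eval f (Lgen \<alpha> (a \<oplus>\<^bsub>A\<^esub> b)) = tensor_eval f (Lgen \<alpha> a \<oplus>\<^bsub>tensor_product W A\<^esub> Lgen \<alpha> b)"
      using closed by (simp add: f tensor_eval_Lgen tensor_eval_add L_eq)
  qed (use closed in \<open>simp_all add: L_eq tensor_add_closed\<close>)
qed

text \<open>
  For generators \<open>e\<^sup>\<gamma> \<otimes> a\<close> and \<open>e\<^sup>\<delta> \<otimes> b\<close> the value is \<open>l (a, b)\<close> if \<open>(\<gamma>, \<delta>) = (\<alpha>, \<beta>)\<close> and zero
  otherwise; \<open>coord_form\<close> extends this to \<open>L\<close> in both arguments.
\<close>

definition generator_form :: "('a \<times> 'a \<Rightarrow> 'f) \<Rightarrow> 'f \<Rightarrow> 'f \<Rightarrow> ('f \<Rightarrow>\<^sub>0 'f) \<times> 'a \<Rightarrow> ('f \<Rightarrow>\<^sub>0 'f) \<times> 'a \<Rightarrow> 'f" where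
  "generator_form l \<alpha> \<beta> k k' = Poly_Mapping.lookup (fst k) \<alpha> * Poly_Mapping.lookup (fst k') \<beta> * l (snd k, snd k')"

lemma bilinear_generator_form:
  assumes "bilinear_form A A l"
  shows "k \<in> carrier W \<times> carrier A \<Longrightarrow> bilinear_form W A (generator_form l \<alpha> \<beta> k)"
    and "k' \<in> carrier W \<times> carrier A \<Longrightarrow> bilinear_form W A (\<lambda>k. generator_form l \<alpha> \<beta> k k')"
  using assms by (auto simp: bilinear_form_def generator_form_def witt_simps lookup_add algebra_simps)

definition coord_form where
  "coord_form l \<alpha> \<beta> = (\<lambda>(P, Q). tensor_eval (\<lambda>k. tensor_eval (generator_form l \<alpha> \<beta> k) Q) P)"

lemma bilinear_coord_form: "bilinear_form A A l \<Longrightarrow> bilinear_form L L (coord_form l \<alpha> \<beta>)"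
  unfolding coord_form_def L_eq by (intro bilinear_form_tensor_eval2 W_closed A_closed bilinear_generator_form)

definition coord where "coord l w \<alpha> \<beta> = tensor_eval (coord_form l \<alpha> \<beta>) w"

lemma coord_add: "bilinear_form A A l \<Longrightarrow> w \<in> carrier V \<Longrightarrow> w' \<in> carrier V \<Longrightarrow>
    coord l (w \<oplus>\<^bsub>V\<^esub> w') \<alpha> \<beta> = coord l w \<alpha> \<beta> + coord l w' \<alpha> \<beta>"
  unfolding coord_def by (intro tensor_eval_add bilinear_coord_form)

lemma coord_smult: "bilinear_form A A l \<Longrightarrow> w \<in> carrier V \<Longrightarrow> coord l (c \<odot>\<^bsub>V\<^esub> w) \<alpha> \<beta> = c * coord l w \<alpha> \<beta>"
  unfolding coord_def by (intro tensor_eval_smult bilinear_coord_form)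

lemma coord_minus: "bilinear_form A A l \<Longrightarrow> w \<in> carrier V \<Longrightarrow> w' \<in> carrier V \<Longrightarrow>
    coord l (w \<ominus>\<^bsub>V\<^esub> w') \<alpha> \<beta> = coord l w \<alpha> \<beta> - coord l w' \<alpha> \<beta>"
  unfolding coord_def by (intro tensor_eval_minus bilinear_coord_form)

lemma coord_zero: "bilinear_form A A l \<Longrightarrow> coord l \<zero>\<^bsub>V\<^esub> \<alpha> \<beta> = 0"
  unfolding coord_def by (intro tensor_eval_zero bilinear_coord_form)

definition gen_tensor where "gen_tensor \<alpha> a \<beta> b = pure_tensor L L (Lgen \<alpha> a) (Lgen \<beta> b)"

lemma gen_tensor_closed: "\<alpha> \<in> \<Gamma> \<Longrightarrow> \<beta> \<in> \<Gamma> \<Longrightarrow> a \<in> carrier A \<Longrightarrow> b \<in> carrier A \<Longrightarrow> gen_tensor \<alpha> a \<beta> b \<in> carrier V"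
  unfolding gen_tensor_def by (intro pure_tensor_closed Lgen_closed)

lemma coord_gen_tensor:
  assumes l: "bilinear_form A A l" and "\<gamma> \<in> \<Gamma>" "\<delta> \<in> \<Gamma>" "a \<in> carrier A" "b \<in> carrier A"
  shows "coord l (gen_tensor \<gamma> a \<delta> b) \<alpha> \<beta> = (if \<alpha> = \<gamma> \<and> \<beta> = \<delta> then l (a, b) else 0)"
proof -
  have "coord l (gen_tensor \<gamma> a \<delta> b) \<alpha> \<beta> = tensor_eval (\<lambda>k. tensor_eval (generator_form l \<alpha> \<beta> k) (Lgen \<delta> b)) (Lgen \<gamma> a)"
    unfolding coord_def gen_tensor_def tensor_eval_pure_tensor[OF bilinear_coord_form[OF l]] by (simp add: coord_form_def)
  also have "\<dots> = tensor_eval (generator_form l \<alpha> \<beta> (Poly_Mapping.single \<gamma> 1, a)) (Lgen \<delta> b)"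
    using Lgen_closed[OF assms(3,5)]
    by (intro tensor_eval_Lgen bilinear_form_tensor_eval[where M' = W and N' = A] W_closed A_closed)
      (auto simp: L_eq intro: bilinear_generator_form l)
  also have "\<dots> = generator_form l \<alpha> \<beta> (Poly_Mapping.single \<gamma> 1, a) (Poly_Mapping.single \<delta> 1, b)"
    using assms by (intro tensor_eval_Lgen bilinear_generator_form l) (simp add: single_W)
  finally show ?thesis
    by (auto simp: generator_form_def lookup_single when_def)
qed

lemma V_induct [consumes 1, case_names zero add]:
  assumes S: "S \<in> carrier V" and zero: "P \<zero>\<^bsub>V\<^esub>"
    and add: "\<And>S \<alpha> a \<beta> b. S \<in> carrier V \<Longrightarrow> P S \<Longrightarrow> \<alpha> \<in> \<Gamma> \<Longrightarrow> a \<in> carrier A \<Longrightarrow> \<beta> \<in> \<Gamma> \<Longrightarrow> b \<in> carrier A \<Longrightarrow>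
      P (S \<oplus>\<^bsub>V\<^esub> gen_tensor \<alpha> a \<beta> b)"
  shows "P S"
  using L_closed S
proof (induction rule: tensor_induct)
  case (add S u v)
  interpret L: abelian_group L unfolding L_eq by (rule abelian_group_tensor)
  have zero_form: "b (\<zero>\<^bsub>L\<^esub>, v) = 0" "b (v, \<zero>\<^bsub>L\<^esub>) = 0" if "bilinear_form L L b" "v \<in> carrier L" for b v
  proof -
    have "b (\<zero>\<^bsub>L\<^esub> \<oplus>\<^bsub>L\<^esub> \<zero>\<^bsub>L\<^esub>, v) = b (\<zero>\<^bsub>L\<^esub>, v) + b (\<zero>\<^bsub>L\<^esub>, v)" "b (v, \<zero>\<^bsub>L\<^esub> \<oplus>\<^bsub>L\<^esub> \<zero>\<^bsub>L\<^esub>) = b (v, \<zero>\<^bsub>L\<^esub>) + b (v, \<zero>\<^bsub>L\<^esub>)"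
      using that L.zero_closed unfolding bilinear_form_def by blast+
    then show "b (\<zero>\<^bsub>L\<^esub>, v) = 0" "b (v, \<zero>\<^bsub>L\<^esub>) = 0" by simp_all
  qed
  have left_zero: "T \<oplus>\<^bsub>V\<^esub> pure_tensor L L \<zero>\<^bsub>L\<^esub> v = T" and right_zero: "T \<oplus>\<^bsub>V\<^esub> pure_tensor L L v \<zero>\<^bsub>L\<^esub> = T"
    if "T \<in> carrier V" "v \<in> carrier L" for T v
    using that L.zero_closed
    by (intro tensor_ext[of _ L L]; simp add: tensor_eval_add tensor_eval_pure_tensor zero_form pure_tensor_closed tensor_add_closed)+
  have right: "T \<oplus>\<^bsub>V\<^esub> pure_tensor L L (Lgen \<alpha> a) Q \<in> carrier V \<and> P (T \<oplus>\<^bsub>V\<^esub> pure_tensor L L (Lgen \<alpha> a) Q)"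
    if "Q \<in> carrier L" "T \<in> carrier V" "P T" "\<alpha> \<in> \<Gamma>" "a \<in> carrier A" for T \<alpha> a Q
    using that(1)
  proof (induction rule: L_induct)
    case zero
    show ?case using that right_zero[OF _ Lgen_closed] by simp
  next
    case (add Q \<beta> b)
    then show ?case
      using assms(3)[of "T \<oplus>\<^bsub>V\<^esub> pure_tensor L L (Lgen \<alpha> a) Q" \<alpha> a \<beta> b] that
      by (simp add: add_pure_tensor_add_right[OF L_closed] Lgen_closed gen_tensor_def pure_tensor_closed tensor_add_closed)
  qed
  have "T \<oplus>\<^bsub>V\<^esub> pure_tensor L L u v \<in> carrier V \<and> P (T \<oplus>\<^bsub>V\<^esub> pure_tensor L L u v)"
    if "u \<in> carrier L" "v \<in> carrier L" "T \<in> carrier V" "P T" for T u v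
    using that(1)
  proof (induction rule: L_induct)
    case zero
    show ?case using that left_zero by simp
  next
    case (add Q \<beta> b)
    then show ?case
      using right[of v "T \<oplus>\<^bsub>V\<^esub> pure_tensor L L Q v" \<beta> b] that
      by (simp add: add_pure_tensor_add_left[OF L_closed] Lgen_closed)
  qed
  with add show ?case by blast
qed (fact zero)

lemma finite_support_coord:
  assumes l: "bilinear_form A A l" and w: "w \<in> carrier V"
  shows "finite_support (coord l w)"
  using w
proof (induction rule: V_induct)
  case zero
  show ?case by (simp add: finite_support_def coord_zero[OF l])
next
  case (add S \<alpha> a \<beta> b)
  have "finite_support (coord l (gen_tensor \<alpha> a \<beta> b))"
    unfolding finite_support_def by (rule finite_subset[of _ "{(\<alpha>, \<beta>)}"]) (use add.hyps in \<open>auto simp: coord_gen_tensor[OF l] split: if_splits\<close>)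
  then have "finite_support (\<lambda>x y. coord l S x y + coord l (gen_tensor \<alpha> a \<beta> b) x y)"
    by (intro finite_support_add add.IH)
  also have "(\<lambda>x y. coord l S x y + coord l (gen_tensor \<alpha> a \<beta> b) x y) = coord l (S \<oplus>\<^bsub>V\<^esub> gen_tensor \<alpha> a \<beta> b)"
    using add.hyps by (intro ext) (simp add: coord_add[OF l] gen_tensor_closed)
  finally show ?case .
qed

text \<open>
  Multiplying coordinates by a function and translating them is realised inside \<open>V\<close>, by the same
  element for all forms \<open>l\<close>. This turns the formula for the primitive into an element of \<open>V\<close>.
\<close>

lemma coord_multiplier:
  assumes w: "w \<in> carrier V" and s: "s \<in> \<Gamma>" and t: "t \<in> \<Gamma>"
  shows "\<exists>w'\<in>carrier V. \<forall>l \<alpha> \<beta>. bilinear_form A A l \<longrightarrow> coord l w' \<alpha> \<beta> = h \<alpha> \<beta> * coord l w (\<alpha> + s) (\<beta> + t)"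
  using w
proof (induction rule: V_induct)
  case zero
  show ?case by (intro bexI[of _ "\<zero>\<^bsub>V\<^esub>"]) (auto simp: coord_zero tensor_zero_closed)
next
  case (add S \<gamma> a \<delta> b)
  then obtain w' where w': "w' \<in> carrier V"
    "\<And>l \<alpha> \<beta>. bilinear_form A A l \<Longrightarrow> coord l w' \<alpha> \<beta> = h \<alpha> \<beta> * coord l S (\<alpha> + s) (\<beta> + t)" by blast
  let ?p = "gen_tensor (\<gamma> - s) a (\<delta> - t) b"
  have st: "\<gamma> - s \<in> \<Gamma>" "\<delta> - t \<in> \<Gamma>"
    using Gamma_add[OF _ Gamma_minus] add.hyps s t by (metis diff_conv_add_uminus)+
  then have p: "?p \<in> carrier V" "gen_tensor \<gamma> a \<delta> b \<in> carrier V"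
    using add.hyps by (simp_all add: gen_tensor_closed)
  let ?w = "w' \<oplus>\<^bsub>V\<^esub> h (\<gamma> - s) (\<delta> - t) \<odot>\<^bsub>V\<^esub> ?p"
  have "coord l ?w \<alpha> \<beta> = h \<alpha> \<beta> * coord l (S \<oplus>\<^bsub>V\<^esub> gen_tensor \<gamma> a \<delta> b) (\<alpha> + s) (\<beta> + t)" if l: "bilinear_form A A l" for l \<alpha> \<beta>
    using add.hyps p w' st
    by (auto simp: coord_add[OF l] coord_smult[OF l] coord_gen_tensor[OF l] tensor_smult_closed l distrib_left)
  moreover have "?w \<in> carrier V"
    using w' p by (simp add: tensor_add_closed tensor_smult_closed)
  ultimately show ?case by blast
qed

text \<open>
  A bilinear form \<open>\<Phi>\<close> on \<open>L\<close> restricts to a form \<open>l \<gamma> \<delta>\<close> on \<open>A\<close> for each pair of exponents, and the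
  value of \<open>\<Phi>\<close> at \<open>w\<close> is the sum of the coordinates \<open>coord (l \<gamma> \<delta>) w \<gamma> \<delta>\<close> over any finite set of pairs
  that is large enough. So the coordinates determine the values of all \<open>\<Phi>\<close>.
\<close>

lemma coord_separates:
  assumes w: "w \<in> carrier V" and w': "w' \<in> carrier V"
    and eq: "\<And>l \<alpha> \<beta>. bilinear_form A A l \<Longrightarrow> coord l w \<alpha> \<beta> = coord l w' \<alpha> \<beta>"
  shows "w = w'"
proof (rule tensor_ext[of _ L L])
  fix \<Phi> assume \<Phi>: "bilinear_form L L \<Phi>"
  define l where "l \<gamma> \<delta> = (\<lambda>(a, b). \<Phi> (Lgen \<gamma> a, Lgen \<delta> b))" for \<gamma> \<delta>
  have l: "bilinear_form A A (l \<gamma> \<delta>)" if "\<gamma> \<in> \<Gamma>" "\<delta> \<in> \<Gamma>" for \<gamma> \<delta>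
    using \<Phi> that Lgen_closed unfolding bilinear_form_def l_def by (simp add: Lgen_add Lgen_smult)
  have "\<exists>F. finite F \<and> F \<subseteq> \<Gamma> \<times> \<Gamma> \<and> (\<forall>F'. finite F' \<longrightarrow> F \<subseteq> F' \<longrightarrow> F' \<subseteq> \<Gamma> \<times> \<Gamma> \<longrightarrow>
      tensor_eval \<Phi> w = (\<Sum>(\<gamma>, \<delta>)\<in>F'. coord (l \<gamma> \<delta>) w \<gamma> \<delta>))" if "w \<in> carrier V" for w
    using that
  proof (induction rule: V_induct)
    case zero
    have "(\<Sum>(\<gamma>, \<delta>)\<in>F'. coord (l \<gamma> \<delta>) \<zero>\<^bsub>V\<^esub> \<gamma> \<delta>) = 0" if "F' \<subseteq> \<Gamma> \<times> \<Gamma>" for F'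
      using that by (intro sum.neutral) (auto simp: coord_zero l)
    then show ?case by (auto simp: tensor_eval_zero[OF \<Phi>])
  next
    case (add S \<gamma> a \<delta> b)
    then obtain F where F: "finite F" "F \<subseteq> \<Gamma> \<times> \<Gamma>" and sum: "\<And>F'. finite F' \<Longrightarrow> F \<subseteq> F' \<Longrightarrow> F' \<subseteq> \<Gamma> \<times> \<Gamma> \<Longrightarrow>
      tensor_eval \<Phi> S = (\<Sum>(\<gamma>, \<delta>)\<in>F'. coord (l \<gamma> \<delta>) S \<gamma> \<delta>)" by blast
    have p: "gen_tensor \<gamma> a \<delta> b \<in> carrier V"
      using add.hyps by (simp add: gen_tensor_closed)
    have "tensor_eval \<Phi> (S \<oplus>\<^bsub>V\<^esub> gen_tensor \<gamma> a \<delta> b) = (\<Sum>(\<gamma>', \<delta>')\<in>F'. coord (l \<gamma>' \<delta>') (S \<oplus>\<^bsub>V\<^esub> gen_tensor \<gamma> a \<delta> b) \<gamma>' \<delta>')"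
      if F': "finite F'" "insert (\<gamma>, \<delta>) F \<subseteq> F'" "F' \<subseteq> \<Gamma> \<times> \<Gamma>" for F'
    proof -
      have "(\<Sum>(\<gamma>', \<delta>')\<in>F'. coord (l \<gamma>' \<delta>') (S \<oplus>\<^bsub>V\<^esub> gen_tensor \<gamma> a \<delta> b) \<gamma>' \<delta>')
          = (\<Sum>k\<in>F'. coord (l (fst k) (snd k)) S (fst k) (snd k) + (if k = (\<gamma>, \<delta>) then l \<gamma> \<delta> (a, b) else 0))"
      proof (intro sum.cong refl)
        fix k assume "k \<in> F'"
        then have lk: "bilinear_form A A (l (fst k) (snd k))"
          using F'(3) by (intro l) auto
        show "(case k of (\<gamma>', \<delta>') \<Rightarrow> coord (l \<gamma>' \<delta>') (S \<oplus>\<^bsub>V\<^esub> gen_tensor \<gamma> a \<delta> b) \<gamma>' \<delta>')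
            = coord (l (fst k) (snd k)) S (fst k) (snd k) + (if k = (\<gamma>, \<delta>) then l \<gamma> \<delta> (a, b) else 0)"
          using add.hyps p by (auto simp: case_prod_beta coord_add[OF lk] coord_gen_tensor[OF lk] prod_eq_iff)
      qed
      also have "\<dots> = tensor_eval \<Phi> S + l \<gamma> \<delta> (a, b)"
        using F' sum[of F'] by (simp add: sum.distrib case_prod_beta)
      also have "\<dots> = tensor_eval \<Phi> (S \<oplus>\<^bsub>V\<^esub> gen_tensor \<gamma> a \<delta> b)"
        using add.hyps p by (simp add: tensor_eval_add[OF \<Phi>]) (simp add: gen_tensor_def tensor_eval_pure_tensor[OF \<Phi>] l_def)
      finally show ?thesis ..
    qed
    then show ?case
      using F add.hyps by (intro exI[of _ "insert (\<gamma>, \<delta>) F"]) auto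
  qed
  note expand = this
  obtain F where F: "finite F" "F \<subseteq> \<Gamma> \<times> \<Gamma>" "\<And>F'. finite F' \<Longrightarrow> F \<subseteq> F' \<Longrightarrow> F' \<subseteq> \<Gamma> \<times> \<Gamma> \<Longrightarrow>
      tensor_eval \<Phi> w = (\<Sum>(\<gamma>, \<delta>)\<in>F'. coord (l \<gamma> \<delta>) w \<gamma> \<delta>)" using expand[OF w] by blast
  obtain F' where F': "finite F'" "F' \<subseteq> \<Gamma> \<times> \<Gamma>" "\<And>F''. finite F'' \<Longrightarrow> F' \<subseteq> F'' \<Longrightarrow> F'' \<subseteq> \<Gamma> \<times> \<Gamma> \<Longrightarrow>
      tensor_eval \<Phi> w' = (\<Sum>(\<gamma>, \<delta>)\<in>F''. coord (l \<gamma> \<delta>) w' \<gamma> \<delta>)" using expand[OF w'] by blast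
  have "(\<Sum>(\<gamma>, \<delta>)\<in>F \<union> F'. coord (l \<gamma> \<delta>) w \<gamma> \<delta>) = (\<Sum>(\<gamma>, \<delta>)\<in>F \<union> F'. coord (l \<gamma> \<delta>) w' \<gamma> \<delta>)"
    using F(2) F'(2) by (intro sum.cong) (auto intro!: eq l)
  then show "tensor_eval \<Phi> w = tensor_eval \<Phi> w'"
    using F(3)[of "F \<union> F'"] F'(3)[of "F \<union> F'"] F(1,2) F'(1,2) by simp
qed (fact w w')+

section \<open>The diagonal action in coordinates\<close>

lemma linear_between_id: "linear_between L L (\<lambda>x. x)"
  by (simp add: linear_between_def)

lemma act_closed: "x \<in> carrier L \<Longrightarrow> w \<in> carrier V \<Longrightarrow> act x w \<in> carrier V"
  unfolding adjoint_diagonal_action_def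
  by (intro tensor_add_closed tensor_map_closed linear_between_mult L_mult linear_between_id)

lemma bilinear_act_forms:
  assumes "bilinear_form L L \<Phi>" "x \<in> carrier L"
  shows "bilinear_form L L (\<lambda>(P, Q). \<Phi> (x \<otimes>\<^bsub>L\<^esub> P, Q))" "bilinear_form L L (\<lambda>(P, Q). \<Phi> (P, x \<otimes>\<^bsub>L\<^esub> Q))"
  using bilinear_form_comp[OF assms(1) linear_between_mult[OF L_mult assms(2)] linear_between_id]
    bilinear_form_comp[OF assms(1) linear_between_id linear_between_mult[OF L_mult assms(2)]] .

lemma tensor_eval_act:
  assumes "bilinear_form L L \<Phi>" "x \<in> carrier L" "w \<in> carrier V"
  shows "tensor_eval \<Phi> (act x w) = tensor_eval (\<lambda>(P, Q). \<Phi> (x \<otimes>\<^bsub>L\<^esub> P, Q)) w + tensor_eval (\<lambda>(P, Q). \<Phi> (P, x \<otimes>\<^bsub>L\<^esub> Q)) w"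
  using assms unfolding adjoint_diagonal_action_def
  by (simp add: tensor_eval_add tensor_map_closed tensor_eval_tensor_map linear_between_mult L_mult linear_between_id)

lemma act_add_right:
  "x \<in> carrier L \<Longrightarrow> w \<in> carrier V \<Longrightarrow> w' \<in> carrier V \<Longrightarrow> act x (w \<oplus>\<^bsub>V\<^esub> w') = act x w \<oplus>\<^bsub>V\<^esub> act x w'"
  by (rule tensor_ext[of _ L L])
    (simp_all add: act_closed tensor_add_closed tensor_eval_act tensor_eval_add bilinear_act_forms)

lemma act_smult_right:
  "x \<in> carrier L \<Longrightarrow> w \<in> carrier V \<Longrightarrow> act x (c \<odot>\<^bsub>V\<^esub> w) = c \<odot>\<^bsub>V\<^esub> act x w"
  by (rule tensor_ext[of _ L L])
    (simp_all add: act_closed tensor_smult_closed tensor_eval_act tensor_eval_smult bilinear_act_forms distrib_left)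

lemma act_add_left:
  assumes "x \<in> carrier L" "y \<in> carrier L" "w \<in> carrier V"
  shows "act (x \<oplus>\<^bsub>L\<^esub> y) w = act x w \<oplus>\<^bsub>V\<^esub> act y w"
proof (rule tensor_ext[of _ L L])
  have xy: "x \<oplus>\<^bsub>L\<^esub> y \<in> carrier L"
    using assms L_closed by (simp add: closed_space_def)
  then show "act (x \<oplus>\<^bsub>L\<^esub> y) w \<in> carrier V" "act x w \<oplus>\<^bsub>V\<^esub> act y w \<in> carrier V"
    using assms by (simp_all add: act_closed tensor_add_closed)
  fix \<Phi> assume \<Phi>: "bilinear_form L L \<Phi>"
  have mult: "(x \<oplus>\<^bsub>L\<^esub> y) \<otimes>\<^bsub>L\<^esub> P = x \<otimes>\<^bsub>L\<^esub> P \<oplus>\<^bsub>L\<^esub> y \<otimes>\<^bsub>L\<^esub> P" "x \<otimes>\<^bsub>L\<^esub> P \<in> carrier L" "y \<otimes>\<^bsub>L\<^esub> P \<in> carrier L"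
    if "P \<in> carrier L" for P
    using L_mult assms that by (simp_all add: bilinear_product_def)
  have "tensor_eval (\<lambda>(P, Q). \<Phi> ((x \<oplus>\<^bsub>L\<^esub> y) \<otimes>\<^bsub>L\<^esub> P, Q)) w
      = tensor_eval (\<lambda>k. (\<lambda>(P, Q). \<Phi> (x \<otimes>\<^bsub>L\<^esub> P, Q)) k + (\<lambda>(P, Q). \<Phi> (y \<otimes>\<^bsub>L\<^esub> P, Q)) k) w"
    using L_closed L_closed bilinear_act_forms(1)[OF \<Phi> xy] assms(3)
    by (rule tensor_eval_cong) (use \<Phi> in \<open>simp add: mult bilinear_form_def\<close>)
  moreover have "tensor_eval (\<lambda>(P, Q). \<Phi> (P, (x \<oplus>\<^bsub>L\<^esub> y) \<otimes>\<^bsub>L\<^esub> Q)) w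
      = tensor_eval (\<lambda>k. (\<lambda>(P, Q). \<Phi> (P, x \<otimes>\<^bsub>L\<^esub> Q)) k + (\<lambda>(P, Q). \<Phi> (P, y \<otimes>\<^bsub>L\<^esub> Q)) k) w"
    using L_closed L_closed bilinear_act_forms(2)[OF \<Phi> xy] assms(3)
    by (rule tensor_eval_cong) (use \<Phi> in \<open>simp add: mult bilinear_form_def\<close>)
  ultimately show "tensor_eval \<Phi> (act (x \<oplus>\<^bsub>L\<^esub> y) w) = tensor_eval \<Phi> (act x w \<oplus>\<^bsub>V\<^esub> act y w)"
    using assms xy \<Phi> by (simp add: tensor_eval_act tensor_eval_add act_closed tensor_eval_fun_add)
qed

lemma tensor_eval_Lgen_mult:
  assumes H: "bilinear_form W A H" and \<gamma>: "\<gamma> \<in> \<Gamma>" and a: "a \<in> carrier A" and P: "P \<in> carrier L"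
  shows "tensor_eval H (Lgen \<gamma> a \<otimes>\<^bsub>L\<^esub> P) = tensor_eval (\<lambda>(u, y). H (Poly_Mapping.single \<gamma> 1 \<otimes>\<^bsub>W\<^esub> u, a \<otimes>\<^bsub>A\<^esub> y)) P"
proof -
  note mf = bilinear_mult_form[OF W_closed W_mult A_closed A_mult H]
  have "tensor_eval H (Lgen \<gamma> a \<otimes>\<^bsub>L\<^esub> P) = tensor_eval (\<lambda>k. tensor_eval (mult_form W A H k) P) (Lgen \<gamma> a)"
    using Lgen_closed[OF \<gamma> a] P unfolding L_eq by (intro tensor_eval_mult W_closed W_mult A_closed A_mult H)
  also have "\<dots> = tensor_eval (mult_form W A H (Poly_Mapping.single \<gamma> 1, a)) P"
    using P by (intro tensor_eval_Lgen bilinear_form_tensor_eval[where M' = W and N' = A] W_closed A_closed mf) (simp_all add: L_eq)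
  also have "mult_form W A H (Poly_Mapping.single \<gamma> 1, a)
      = (\<lambda>(u, y). H (Poly_Mapping.single \<gamma> 1 \<otimes>\<^bsub>W\<^esub> u, a \<otimes>\<^bsub>A\<^esub> y))"
    by (simp add: fun_eq_iff mult_form_def[OF W_closed W_mult A_closed A_mult])
  finally show ?thesis .
qed

lemma Lgen_bracket:
  assumes n: "n \<in> \<Gamma>" and \<gamma>: "\<gamma> \<in> \<Gamma>" and a: "a \<in> carrier A"
  shows "Lgen n \<one>\<^bsub>A\<^esub> \<otimes>\<^bsub>L\<^esub> Lgen \<gamma> a = (\<gamma> - n) \<odot>\<^bsub>L\<^esub> Lgen (n + \<gamma>) a"
proof -
  have e: "Poly_Mapping.single n 1 \<otimes>\<^bsub>W\<^esub> Poly_Mapping.single \<gamma> 1 = (\<gamma> - n) \<odot>\<^bsub>W\<^esub> Poly_Mapping.single (n + \<gamma>) 1"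
    by (rule poly_mapping_eqI, unfold lookup_witt_mult witt_simps(4) lookup_scale_pm lookup_single)
      (auto simp: when_def algebra_simps)
  note closed = Lgen_closed[OF n A_one] Lgen_closed[OF \<gamma> a] Lgen_closed[OF Gamma_add[OF n \<gamma>] a]
  show ?thesis
    unfolding L_eq
  proof (rule tensor_ext[of _ W A])
    fix b assume b: "bilinear_form W A b"
    have "bilinear_form W A (\<lambda>(u, y). b (Poly_Mapping.single n 1 \<otimes>\<^bsub>W\<^esub> u, \<one>\<^bsub>A\<^esub> \<otimes>\<^bsub>A\<^esub> y))"
      by (intro bilinear_form_comp b linear_between_mult W_mult A_mult single_W n A_one)
    then have "tensor_eval b (Lgen n \<one>\<^bsub>A\<^esub> \<otimes>\<^bsub>L\<^esub> Lgen \<gamma> a) = b ((\<gamma> - n) \<odot>\<^bsub>W\<^esub> Poly_Mapping.single (n + \<gamma>) 1, a)"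
      by (simp add: tensor_eval_Lgen_mult[OF b n A_one closed(2)] tensor_eval_Lgen e A_one_mult a)
    also have "\<dots> = (\<gamma> - n) * b (Poly_Mapping.single (n + \<gamma>) 1, a)"
      using b a single_W[OF Gamma_add[OF n \<gamma>]] unfolding bilinear_form_def by blast
    finally show "tensor_eval b (Lgen n \<one>\<^bsub>A\<^esub> \<otimes>\<^bsub>tensor_product W A\<^esub> Lgen \<gamma> a)
        = tensor_eval b ((\<gamma> - n) \<odot>\<^bsub>tensor_product W A\<^esub> Lgen (n + \<gamma>) a)"
      using closed(3) by (simp add: L_eq tensor_eval_smult[OF b] tensor_eval_Lgen[OF b])
  next
    show "Lgen n \<one>\<^bsub>A\<^esub> \<otimes>\<^bsub>tensor_product W A\<^esub> Lgen \<gamma> a \<in> carrier (tensor_product W A)"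
      using closed L_mult by (simp add: bilinear_product_def L_eq)
    show "(\<gamma> - n) \<odot>\<^bsub>tensor_product W A\<^esub> Lgen (n + \<gamma>) a \<in> carrier (tensor_product W A)"
      using closed by (simp add: tensor_smult_closed L_eq)
  qed
qed

definition mult_first :: "'a \<Rightarrow> ('a \<times> 'a \<Rightarrow> 'f) \<Rightarrow> 'a \<times> 'a \<Rightarrow> 'f" where "mult_first a l = (\<lambda>(x, y). l (a \<otimes>\<^bsub>A\<^esub> x, y))"
definition mult_second :: "'a \<Rightarrow> ('a \<times> 'a \<Rightarrow> 'f) \<Rightarrow> 'a \<times> 'a \<Rightarrow> 'f" where "mult_second a l = (\<lambda>(x, y). l (x, a \<otimes>\<^bsub>A\<^esub> y))"

lemma bilinear_mult_first_second:
  assumes "bilinear_form A A l" "a \<in> carrier A"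
  shows "bilinear_form A A (mult_first a l)" "bilinear_form A A (mult_second a l)"
proof -
  have id: "linear_between A A (\<lambda>x. x)" by (simp add: linear_between_def)
  note mult = linear_between_mult[OF A_mult assms(2)]
  show "bilinear_form A A (mult_first a l)" "bilinear_form A A (mult_second a l)"
    unfolding mult_first_def mult_second_def by (rule bilinear_form_comp[OF assms(1)]; fact mult id)+
qed

lemma coord_form_Lgen_left:
  assumes l: "bilinear_form A A l" and \<gamma>: "\<gamma> \<in> \<Gamma>" and a: "a \<in> carrier A" and P: "P \<in> carrier L" and Q: "Q \<in> carrier L"
  shows "coord_form l \<alpha> \<beta> (Lgen \<gamma> a \<otimes>\<^bsub>L\<^esub> P, Q) = (\<alpha> - 2 * \<gamma>) * coord_form (mult_first a l) (\<alpha> - \<gamma>) \<beta> (P, Q)"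
proof -
  have "bilinear_form W A (\<lambda>k. tensor_eval (generator_form l \<alpha> \<beta> k) Q)"
    using Q by (intro bilinear_form_tensor_eval[where M' = W and N' = A] W_closed A_closed bilinear_generator_form l) (simp_all add: L_eq)
  then have "coord_form l \<alpha> \<beta> (Lgen \<gamma> a \<otimes>\<^bsub>L\<^esub> P, Q)
      = tensor_eval (\<lambda>(u, y). tensor_eval (generator_form l \<alpha> \<beta> (Poly_Mapping.single \<gamma> 1 \<otimes>\<^bsub>W\<^esub> u, a \<otimes>\<^bsub>A\<^esub> y)) Q) P"
    by (simp add: coord_form_def tensor_eval_Lgen_mult[OF _ \<gamma> a P])
  also have "(\<lambda>(u, y). tensor_eval (generator_form l \<alpha> \<beta> (Poly_Mapping.single \<gamma> 1 \<otimes>\<^bsub>W\<^esub> u, a \<otimes>\<^bsub>A\<^esub> y)) Q)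
      = (\<lambda>k. (\<alpha> - 2 * \<gamma>) * tensor_eval (generator_form (mult_first a l) (\<alpha> - \<gamma>) \<beta> k) Q)"
    unfolding tensor_eval_fun_scale[symmetric] generator_form_def
    by (simp add: fun_eq_iff lookup_witt_mult mult_first_def mult.assoc)
  finally show ?thesis
    by (simp add: coord_form_def tensor_eval_fun_scale)
qed

lemma coord_form_Lgen_right:
  assumes l: "bilinear_form A A l" and \<gamma>: "\<gamma> \<in> \<Gamma>" and a: "a \<in> carrier A" and P: "P \<in> carrier L" and Q: "Q \<in> carrier L"
  shows "coord_form l \<alpha> \<beta> (P, Lgen \<gamma> a \<otimes>\<^bsub>L\<^esub> Q) = (\<beta> - 2 * \<gamma>) * coord_form (mult_second a l) \<alpha> (\<beta> - \<gamma>) (P, Q)"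
proof -
  have mem: "Lgen \<gamma> a \<otimes>\<^bsub>L\<^esub> Q \<in> carrier L"
    using L_mult Lgen_closed[OF \<gamma> a] Q by (simp add: bilinear_product_def)
  have "coord_form l \<alpha> \<beta> (P, Lgen \<gamma> a \<otimes>\<^bsub>L\<^esub> Q) = tensor_eval (\<lambda>k. tensor_eval (generator_form l \<alpha> \<beta> k) (Lgen \<gamma> a \<otimes>\<^bsub>L\<^esub> Q)) P"
    by (simp add: coord_form_def)
  also have "\<dots> = tensor_eval (\<lambda>k. (\<beta> - 2 * \<gamma>) * tensor_eval (generator_form (mult_second a l) \<alpha> (\<beta> - \<gamma>) k) Q) P"
  proof (rule tensor_eval_cong[OF W_closed A_closed])
    show "bilinear_form W A (\<lambda>k. tensor_eval (generator_form l \<alpha> \<beta> k) (Lgen \<gamma> a \<otimes>\<^bsub>L\<^esub> Q))"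
      using mem by (intro bilinear_form_tensor_eval[where M' = W and N' = A] W_closed A_closed bilinear_generator_form l) (simp_all add: L_eq)
    fix u x assume "u \<in> carrier W" "x \<in> carrier A"
    then have "tensor_eval (generator_form l \<alpha> \<beta> (u, x)) (Lgen \<gamma> a \<otimes>\<^bsub>L\<^esub> Q)
        = tensor_eval (\<lambda>(u', y). generator_form l \<alpha> \<beta> (u, x) (Poly_Mapping.single \<gamma> 1 \<otimes>\<^bsub>W\<^esub> u', a \<otimes>\<^bsub>A\<^esub> y)) Q"
      by (intro tensor_eval_Lgen_mult bilinear_generator_form l \<gamma> a Q) simp
    also have "(\<lambda>(u', y). generator_form l \<alpha> \<beta> (u, x) (Poly_Mapping.single \<gamma> 1 \<otimes>\<^bsub>W\<^esub> u', a \<otimes>\<^bsub>A\<^esub> y))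
        = (\<lambda>k. (\<beta> - 2 * \<gamma>) * generator_form (mult_second a l) \<alpha> (\<beta> - \<gamma>) (u, x) k)"
      by (simp add: generator_form_def fun_eq_iff lookup_witt_mult mult_second_def mult.assoc mult.left_commute)
    finally show "tensor_eval (generator_form l \<alpha> \<beta> (u, x)) (Lgen \<gamma> a \<otimes>\<^bsub>L\<^esub> Q)
        = (\<beta> - 2 * \<gamma>) * tensor_eval (generator_form (mult_second a l) \<alpha> (\<beta> - \<gamma>) (u, x)) Q"
      by (simp only: tensor_eval_fun_scale)
  qed (use P in \<open>simp add: L_eq\<close>)
  finally show ?thesis
    by (simp add: coord_form_def tensor_eval_fun_scale)
qed

lemma coord_act:
  assumes l: "bilinear_form A A l" and \<gamma>: "\<gamma> \<in> \<Gamma>" and a: "a \<in> carrier A" and w: "w \<in> carrier V"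
  shows "coord l (act (Lgen \<gamma> a) w) \<alpha> \<beta> = witt_act_pair \<gamma> (coord (mult_first a l) w) (coord (mult_second a l) w) \<alpha> \<beta>"
proof -
  note B = bilinear_coord_form[OF l, of \<alpha> \<beta>] and x = Lgen_closed[OF \<gamma> a]
  have "tensor_eval (\<lambda>(P, Q). coord_form l \<alpha> \<beta> (Lgen \<gamma> a \<otimes>\<^bsub>L\<^esub> P, Q)) w
      = tensor_eval (\<lambda>k. (\<alpha> - 2 * \<gamma>) * coord_form (mult_first a l) (\<alpha> - \<gamma>) \<beta> k) w"
    using L_closed L_closed bilinear_act_forms(1)[OF B x] w
    by (rule tensor_eval_cong) (simp add: coord_form_Lgen_left[OF l \<gamma> a])
  moreover have "tensor_eval (\<lambda>(P, Q). coord_form l \<alpha> \<beta> (P, Lgen \<gamma> a \<otimes>\<^bsub>L\<^esub> Q)) w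
      = tensor_eval (\<lambda>k. (\<beta> - 2 * \<gamma>) * coord_form (mult_second a l) \<alpha> (\<beta> - \<gamma>) k) w"
    using L_closed L_closed bilinear_act_forms(2)[OF B x] w
    by (rule tensor_eval_cong) (simp add: coord_form_Lgen_right[OF l \<gamma> a])
  ultimately show ?thesis
    unfolding coord_def tensor_eval_act[OF B x w] witt_act_pair_def by (simp only: tensor_eval_fun_scale)
qed

text \<open>
  Forms that agree on the carrier of \<open>A\<close> may differ elsewhere as functions.
\<close>

lemma coord_cong:
  assumes l: "bilinear_form A A l" and l': "bilinear_form A A l'" and w: "w \<in> carrier V"
    and eq: "\<And>x y. x \<in> carrier A \<Longrightarrow> y \<in> carrier A \<Longrightarrow> l (x, y) = l' (x, y)"
  shows "coord l w \<alpha> \<beta> = coord l' w \<alpha> \<beta>"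
  using w
proof (induction rule: V_induct)
  case (add S \<gamma> a \<delta> b)
  then show ?case
    by (simp add: coord_add[OF l] coord_add[OF l'] coord_gen_tensor[OF l] coord_gen_tensor[OF l'] gen_tensor_closed eq)
qed (simp add: coord_zero l l')

lemma coord_act_one:
  assumes l: "bilinear_form A A l" and n: "n \<in> \<Gamma>" and w: "w \<in> carrier V"
  shows "coord l (act (Lgen n \<one>\<^bsub>A\<^esub>) w) \<alpha> \<beta> = witt_act n (coord l w) \<alpha> \<beta>"
proof -
  have "coord (mult_first \<one>\<^bsub>A\<^esub> l) w \<alpha> \<beta> = coord l w \<alpha> \<beta>" "coord (mult_second \<one>\<^bsub>A\<^esub> l) w \<alpha> \<beta> = coord l w \<alpha> \<beta>" for \<alpha> \<beta>
    by (intro coord_cong bilinear_mult_first_second l w A_one; simp add: mult_first_def mult_second_def A_one_mult)+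
  then show ?thesis
    by (simp add: coord_act[OF l n A_one w] witt_act_pair_def witt_act_def)
qed

section \<open>Derivations and first cohomology\<close>

text \<open>
  The argument outlined at the beginning: the primitive of the cocycle on the integral Witt algebra
  is realised by \<open>v\<close>, and the difference with the inner derivation of \<open>v\<close> vanishes on all generators.
\<close>

lemma derivation_eq_act:
  assumes D: "lie_derivation L V act D"
  shows "\<exists>v\<in>carrier V. \<forall>x\<in>carrier L. D x = act x v"
proof -
  have D_closed: "D x \<in> carrier V" if "x \<in> carrier L" for x
    using D that by (auto simp: lie_derivation_def linear_between_def)
  have D_add: "D (x \<oplus>\<^bsub>L\<^esub> y) = D x \<oplus>\<^bsub>V\<^esub> D y" if "x \<in> carrier L" "y \<in> carrier L" for x y
    using D that by (auto simp: lie_derivation_def linear_between_def)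
  have D_smult: "D (c \<odot>\<^bsub>L\<^esub> x) = c \<odot>\<^bsub>V\<^esub> D x" if "x \<in> carrier L" for c x
    using D that by (auto simp: lie_derivation_def linear_between_def)
  have D_bracket: "D (x \<otimes>\<^bsub>L\<^esub> y) = act x (D y) \<ominus>\<^bsub>V\<^esub> act y (D x)" if "x \<in> carrier L" "y \<in> carrier L" for x y
    using D that by (auto simp: lie_derivation_def)
  let ?one = "\<one>\<^bsub>A\<^esub>"
  have Lgen1: "Lgen n ?one \<in> carrier L" if "n \<in> \<Gamma>" for n
    using that A_one by (rule Lgen_closed)
  \<comment> \<open>The derivation identity for \<open>[L\<^sub>n 1, L\<^sub>\<gamma> a] = (\<gamma> - n) L\<^bsub>n+\<gamma>\<^esub> a\<close>, in coordinates.\<close>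
  have coord_bracket: "(\<gamma> - n) * coord l (D (Lgen (n + \<gamma>) a)) \<alpha> \<beta>
      = witt_act n (coord l (D (Lgen \<gamma> a))) \<alpha> \<beta>
        - witt_act_pair \<gamma> (coord (mult_first a l) (D (Lgen n ?one))) (coord (mult_second a l) (D (Lgen n ?one))) \<alpha> \<beta>"
    if l: "bilinear_form A A l" and n: "n \<in> \<Gamma>" and \<gamma>: "\<gamma> \<in> \<Gamma>" and a: "a \<in> carrier A" for l n \<gamma> a \<alpha> \<beta>
  proof -
    note x = Lgen1[OF n] and y = Lgen_closed[OF \<gamma> a] and z = Lgen_closed[OF Gamma_add[OF n \<gamma>] a]
    have "(\<gamma> - n) * coord l (D (Lgen (n + \<gamma>) a)) \<alpha> \<beta> = coord l (D ((\<gamma> - n) \<odot>\<^bsub>L\<^esub> Lgen (n + \<gamma>) a)) \<alpha> \<beta>"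
      by (simp add: D_smult[OF z] coord_smult[OF l D_closed[OF z]])
    also have "\<dots> = coord l (act (Lgen n ?one) (D (Lgen \<gamma> a)) \<ominus>\<^bsub>V\<^esub> act (Lgen \<gamma> a) (D (Lgen n ?one))) \<alpha> \<beta>"
      by (simp add: Lgen_bracket[OF n \<gamma> a, symmetric] D_bracket[OF x y])
    finally show ?thesis
      by (simp add: coord_minus[OF l] act_closed x y D_closed coord_act_one[OF l n] coord_act[OF l \<gamma> a])
  qed
  define d where "d l n = coord l (D (Lgen n ?one))" for l n
  have d_cocycle: "cocycle (d l)" if l: "bilinear_form A A l" for l
  proof -
    have "coord (mult_first ?one l) (D (Lgen n ?one)) \<alpha> \<beta> = d l n \<alpha> \<beta>" "coord (mult_second ?one l) (D (Lgen n ?one)) \<alpha> \<beta> = d l n \<alpha> \<beta>"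
      if "n \<in> \<int>" for n \<alpha> \<beta>
      unfolding d_def
      by (intro coord_cong bilinear_mult_first_second l A_one D_closed Lgen1 Ints_Gamma that; simp add: mult_first_def mult_second_def A_one_mult)+
    then show ?thesis
      unfolding cocycle_def
      using coord_bracket[OF l Ints_Gamma Ints_Gamma A_one]
      by (simp add: witt_act_pair_def witt_act_def d_def)
  qed
  obtain v where v: "v \<in> carrier V"
    and coord_v: "\<And>l \<alpha> \<beta>. bilinear_form A A l \<Longrightarrow> coord l v \<alpha> \<beta> = cocycle_primitive (d l) \<alpha> \<beta>"
  proof -
    have G: "0 \<in> \<Gamma>" "1 \<in> \<Gamma>" "2 \<in> \<Gamma>" "-1 \<in> \<Gamma>"
      by (intro Ints_Gamma; simp)+
    note DV = D_closed[OF Lgen1]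
    \<comment> \<open>One element for each term of the formula for the primitive: three on the line of degree zero,
      and \<open>w4\<close> off that line.\<close>
    obtain w1 where w1: "w1 \<in> carrier V" "\<And>l \<alpha> \<beta>. bilinear_form A A l \<Longrightarrow> coord l w1 \<alpha> \<beta>
        = (if \<alpha> + \<beta> = 0 then (\<alpha> - 2) * (\<alpha> - 4) / 12 else 0) * coord l (D (Lgen 1 ?one)) (\<alpha> + (-1)) (\<beta> + 2)"
      using coord_multiplier[OF DV[OF G(2)] G(4,3), of "\<lambda>\<alpha> \<beta>. if \<alpha> + \<beta> = 0 then (\<alpha> - 2) * (\<alpha> - 4) / 12 else 0"] by blast
    obtain w2 where w2: "w2 \<in> carrier V" "\<And>l \<alpha> \<beta>. bilinear_form A A l \<Longrightarrow> coord l w2 \<alpha> \<beta>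
        = (if \<alpha> + \<beta> = 0 then \<alpha> * (\<alpha> - 4) / 12 else 0) * coord l (D (Lgen 1 ?one)) (\<alpha> + 0) (\<beta> + 1)"
      using coord_multiplier[OF DV[OF G(2)] G(1,2), of "\<lambda>\<alpha> \<beta>. if \<alpha> + \<beta> = 0 then \<alpha> * (\<alpha> - 4) / 12 else 0"] by blast
    obtain w3 where w3: "w3 \<in> carrier V" "\<And>l \<alpha> \<beta>. bilinear_form A A l \<Longrightarrow> coord l w3 \<alpha> \<beta>
        = (if \<alpha> + \<beta> = 0 then - ((\<alpha> - 2) * (\<alpha> - 3)) / 12 else 0) * coord l (D (Lgen 2 ?one)) (\<alpha> + 0) (\<beta> + 2)"
      using coord_multiplier[OF DV[OF G(3)] G(1,3), of "\<lambda>\<alpha> \<beta>. if \<alpha> + \<beta> = 0 then - ((\<alpha> - 2) * (\<alpha> - 3)) / 12 else 0"] by blast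
    obtain w4 where w4: "w4 \<in> carrier V" "\<And>l \<alpha> \<beta>. bilinear_form A A l \<Longrightarrow> coord l w4 \<alpha> \<beta>
        = (if \<alpha> + \<beta> = 0 then 0 else 1 / (\<alpha> + \<beta>)) * coord l (D (Lgen 0 ?one)) (\<alpha> + 0) (\<beta> + 0)"
      using coord_multiplier[OF DV[OF G(1)] G(1,1), of "\<lambda>\<alpha> \<beta>. if \<alpha> + \<beta> = 0 then 0 else 1 / (\<alpha> + \<beta>)"] by blast
    show thesis
    proof
      show "w1 \<oplus>\<^bsub>V\<^esub> w2 \<oplus>\<^bsub>V\<^esub> w3 \<oplus>\<^bsub>V\<^esub> w4 \<in> carrier V"
        by (intro tensor_add_closed w1 w2 w3 w4)
      show "coord l (w1 \<oplus>\<^bsub>V\<^esub> w2 \<oplus>\<^bsub>V\<^esub> w3 \<oplus>\<^bsub>V\<^esub> w4) \<alpha> \<beta> = cocycle_primitive (d l) \<alpha> \<beta>" if l: "bilinear_form A A l" for l \<alpha> \<beta>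
        by (simp add: coord_add[OF l] tensor_add_closed w1 w2 w3 w4 l cocycle_primitive_def d_def add_divide_distrib diff_divide_distrib)
    qed
  qed
  have d: "d l n \<alpha> \<beta> = witt_act n (coord l v) \<alpha> \<beta>" if l: "bilinear_form A A l" and n: "n \<in> \<int>" for l n \<alpha> \<beta>
  proof -
    have coord_v': "coord l v = cocycle_primitive (d l)"
      using coord_v[OF l] by (intro ext) simp
    have "finite_support (d l m)" if "m \<in> \<int>" for m
      unfolding d_def using finite_support_coord[OF l] D_closed[OF Lgen1[OF Ints_Gamma[OF that]]] .
    then show ?thesis
      unfolding coord_v' using d_cocycle[OF l] finite_support_coord[OF l v] n
      by (intro cocycle_eq_witt_act_cocycle_primitive) (simp_all add: coord_v')
  qed
  have gen: "D (Lgen \<gamma> a) = act (Lgen \<gamma> a) v" if \<gamma>: "\<gamma> \<in> \<Gamma>" and a: "a \<in> carrier A" for \<gamma> a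
  proof (rule coord_separates)
    fix l \<alpha> \<beta> assume l: "bilinear_form A A l"
    \<comment> \<open>The coordinates of the difference at \<open>L\<^sub>\<gamma> a\<close>. As the difference kills \<open>L\<^sub>n 1\<close>, the action of
      \<open>L\<^sub>n 1\<close> takes \<open>f \<gamma>\<close> to a multiple of \<open>f (n + \<gamma>)\<close>.\<close>
    define f where "f \<gamma> \<alpha> \<beta> = coord l (D (Lgen \<gamma> a)) \<alpha> \<beta> - coord l (act (Lgen \<gamma> a) v) \<alpha> \<beta>" for \<gamma> \<alpha> \<beta>
    have f: "witt_act n (f \<gamma>) \<alpha> \<beta> = (\<gamma> - n) * f (n + \<gamma>) \<alpha> \<beta>" if n: "n \<in> \<int>" and \<gamma>: "\<gamma> \<in> \<Gamma>" for n \<gamma> \<alpha> \<beta>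
    proof -
      note n' = Ints_Gamma[OF n]
      let ?F = "coord (mult_first a l) v" and ?G = "coord (mult_second a l) v"
      have act: "coord l (act (Lgen \<gamma> a) v) = witt_act_pair \<gamma> ?F ?G" if "\<gamma> \<in> \<Gamma>" for \<gamma>
        by (intro ext) (rule coord_act[OF l that a v])
      have "coord (mult_first a l) (D (Lgen n ?one)) = witt_act n ?F" "coord (mult_second a l) (D (Lgen n ?one)) = witt_act n ?G"
        using d[OF bilinear_mult_first_second(1)[OF l a] n] d[OF bilinear_mult_first_second(2)[OF l a] n] by (auto simp: d_def fun_eq_iff)
      then have "(\<gamma> - n) * coord l (D (Lgen (n + \<gamma>) a)) \<alpha> \<beta>
          = witt_act n (coord l (D (Lgen \<gamma> a))) \<alpha> \<beta> - witt_act_pair \<gamma> (witt_act n ?F) (witt_act n ?G) \<alpha> \<beta>"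
        using coord_bracket[OF l n' \<gamma> a] by simp
      moreover have "(\<gamma> - n) * coord l (act (Lgen (n + \<gamma>) a) v) \<alpha> \<beta>
          = witt_act n (coord l (act (Lgen \<gamma> a) v)) \<alpha> \<beta> - witt_act_pair \<gamma> (witt_act n ?F) (witt_act n ?G) \<alpha> \<beta>"
        unfolding act[OF Gamma_add[OF n' \<gamma>]] act[OF \<gamma>] by (rule witt_act_pair_commutator)
      moreover have "witt_act n (f \<gamma>) \<alpha> \<beta> = witt_act n (coord l (D (Lgen \<gamma> a))) \<alpha> \<beta> - witt_act n (coord l (act (Lgen \<gamma> a) v)) \<alpha> \<beta>"
        by (simp add: witt_act_def f_def algebra_simps)
      ultimately show ?thesis
        by (simp add: f_def right_diff_distrib)
    qed
    have fun_f: "witt_act n (f \<gamma>) = (\<lambda>\<alpha> \<beta>. (\<gamma> - n) * f (n + \<gamma>) \<alpha> \<beta>)" if "n \<in> \<int>" "\<gamma> \<in> \<Gamma>" for n \<gamma>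
      using f[OF that] by (intro ext)
    have "f \<gamma> \<alpha> \<beta> = 0"
    proof (rule witt_eigenfunction_vanishes[where f = "f \<gamma>" and c = "\<lambda>n. (\<gamma> - n) * (\<gamma> + 2 * n)"])
      show "finite_support (f \<gamma>)"
        unfolding f_def using Lgen_closed[OF \<gamma> a] v
        by (intro finite_support_diff finite_support_coord l D_closed act_closed)
      fix n \<alpha> \<beta> assume n: "n \<in> (\<int> :: 'f set)"
      have "witt_act (-n) (witt_act n (f \<gamma>)) \<alpha> \<beta> = (\<gamma> - n) * witt_act (-n) (f (n + \<gamma>)) \<alpha> \<beta>"
        unfolding fun_f[OF n \<gamma>] by (simp add: witt_act_def algebra_simps)
      also have "\<dots> = (\<gamma> - n) * ((n + \<gamma> + n) * f \<gamma> \<alpha> \<beta>)"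
        using f[of "-n" "n + \<gamma>" \<alpha> \<beta>] n Gamma_add[OF Ints_Gamma[OF n] \<gamma>] by simp
      finally show "witt_act (-n) (witt_act n (f \<gamma>)) \<alpha> \<beta> = (\<gamma> - n) * (\<gamma> + 2 * n) * f \<gamma> \<alpha> \<beta>"
        by (simp add: algebra_simps)
    qed
    then show "coord l (D (Lgen \<gamma> a)) \<alpha> \<beta> = coord l (act (Lgen \<gamma> a) v) \<alpha> \<beta>"
      by (simp add: f_def)
  qed (use Lgen_closed[OF \<gamma> a] v in \<open>simp_all add: D_closed act_closed\<close>)
  have "D x = act x v" if "x \<in> carrier L" for x
    using that
  proof (induction rule: L_induct)
    case zero
    have z: "\<zero>\<^bsub>L\<^esub> \<in> carrier L"
      unfolding L_eq by (rule tensor_zero_closed)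
    interpret L: abelian_group L unfolding L_eq by (rule abelian_group_tensor)
    have "D \<zero>\<^bsub>L\<^esub> = D \<zero>\<^bsub>L\<^esub> \<oplus>\<^bsub>V\<^esub> D \<zero>\<^bsub>L\<^esub>" "act \<zero>\<^bsub>L\<^esub> v = act \<zero>\<^bsub>L\<^esub> v \<oplus>\<^bsub>V\<^esub> act \<zero>\<^bsub>L\<^esub> v"
      using D_add[OF z z] act_add_left[OF z z v] by simp_all
    then show ?case
      using tensor_idem_zero D_closed[OF z] act_closed[OF z v] by metis
  next
    case (add S \<gamma> a)
    then show ?case
      by (simp add: D_add act_add_left Lgen_closed gen v)
  qed
  with v show ?thesis by blast
qed

lemma derivation_inner:
  "lie_derivation L V act D \<Longrightarrow> inner_derivation L V act D"
  using derivation_eq_act by (simp add: inner_derivation_def)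

lemma Inn_eq_Der: "Inn L V act = carrier (Der_module L V act)"
  using derivation_inner by (auto simp: Inn_def Der_module_def inner_derivation_def)

text \<open>
  Derivations are stated on the carrier of \<open>L\<close>, so \<open>F\<close> is arbitrary elsewhere; for \<open>H1\<close> it will be an
  extensional function.
\<close>

lemma lie_derivation_lincomb:
  assumes D: "lie_derivation L V act D" and E: "lie_derivation L V act E"
    and F: "\<And>x. x \<in> carrier L \<Longrightarrow> F x = D x \<oplus>\<^bsub>V\<^esub> c \<odot>\<^bsub>V\<^esub> E x"
  shows "lie_derivation L V act F"
proof -
  have D_simps: "\<And>x. x \<in> carrier L \<Longrightarrow> D x \<in> carrier V"
    "\<And>x y. x \<in> carrier L \<Longrightarrow> y \<in> carrier L \<Longrightarrow> D (x \<oplus>\<^bsub>L\<^esub> y) = D x \<oplus>\<^bsub>V\<^esub> D y"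
    "\<And>c x. x \<in> carrier L \<Longrightarrow> D (c \<odot>\<^bsub>L\<^esub> x) = c \<odot>\<^bsub>V\<^esub> D x"
    "\<And>x y. x \<in> carrier L \<Longrightarrow> y \<in> carrier L \<Longrightarrow> D (x \<otimes>\<^bsub>L\<^esub> y) = act x (D y) \<ominus>\<^bsub>V\<^esub> act y (D x)"
    using D by (auto simp: lie_derivation_def linear_between_def)
  have E_simps: "\<And>x. x \<in> carrier L \<Longrightarrow> E x \<in> carrier V"
    "\<And>x y. x \<in> carrier L \<Longrightarrow> y \<in> carrier L \<Longrightarrow> E (x \<oplus>\<^bsub>L\<^esub> y) = E x \<oplus>\<^bsub>V\<^esub> E y"
    "\<And>c x. x \<in> carrier L \<Longrightarrow> E (c \<odot>\<^bsub>L\<^esub> x) = c \<odot>\<^bsub>V\<^esub> E x"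
    "\<And>x y. x \<in> carrier L \<Longrightarrow> y \<in> carrier L \<Longrightarrow> E (x \<otimes>\<^bsub>L\<^esub> y) = act x (E y) \<ominus>\<^bsub>V\<^esub> act y (E x)"
    using E by (auto simp: lie_derivation_def linear_between_def)
  have L_simps: "x \<oplus>\<^bsub>L\<^esub> y \<in> carrier L" "x \<otimes>\<^bsub>L\<^esub> y \<in> carrier L" "c \<odot>\<^bsub>L\<^esub> x \<in> carrier L"
    if "x \<in> carrier L" "y \<in> carrier L" for x y c
    using L_closed L_mult that by (auto simp: closed_space_def bilinear_product_def)
  note closed = D_simps(1) E_simps(1) tensor_add_closed tensor_smult_closed tensor_minus_closed act_closed
  note tensor_eval = tensor_eval_add tensor_eval_smult tensor_eval_minus
  show ?thesis
    unfolding lie_derivation_def linear_between_def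
  proof (intro conjI ballI allI Pi_I)
    fix x assume x: "x \<in> carrier L"
    then show "F x \<in> carrier V"
      by (simp add: F closed)
    show "F (b \<odot>\<^bsub>L\<^esub> x) = b \<odot>\<^bsub>V\<^esub> F x" for b
      using x by (intro tensor_ext[of _ L L]) (simp_all add: F closed L_simps D_simps(3) E_simps(3) tensor_eval algebra_simps)
    fix y assume y: "y \<in> carrier L"
    show "F (x \<oplus>\<^bsub>L\<^esub> y) = F x \<oplus>\<^bsub>V\<^esub> F y"
      using x y by (intro tensor_ext[of _ L L]) (simp_all add: F closed L_simps D_simps(2) E_simps(2) tensor_eval algebra_simps)
    show "F (x \<otimes>\<^bsub>L\<^esub> y) = act x (F y) \<ominus>\<^bsub>V\<^esub> act y (F x)"
      using x y by (intro tensor_ext[of _ L L])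
        (simp_all add: F closed L_simps D_simps(4) E_simps(4) act_add_right act_smult_right tensor_eval algebra_simps)
  qed
qed

lemma lie_derivation_zero: "lie_derivation L V act (\<lambda>x\<in>carrier L. \<zero>\<^bsub>V\<^esub>)"
proof -
  have zero: "\<zero>\<^bsub>V\<^esub> \<in> carrier V"
    by (rule tensor_zero_closed)
  have L_simps: "x \<oplus>\<^bsub>L\<^esub> y \<in> carrier L" "x \<otimes>\<^bsub>L\<^esub> y \<in> carrier L" "c \<odot>\<^bsub>L\<^esub> x \<in> carrier L"
    if "x \<in> carrier L" "y \<in> carrier L" for x y c
    using L_closed L_mult that by (auto simp: closed_space_def bilinear_product_def)
  have add: "\<zero>\<^bsub>V\<^esub> = \<zero>\<^bsub>V\<^esub> \<oplus>\<^bsub>V\<^esub> \<zero>\<^bsub>V\<^esub>" and smult: "\<zero>\<^bsub>V\<^esub> = c \<odot>\<^bsub>V\<^esub> \<zero>\<^bsub>V\<^esub>" for c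
    by (rule tensor_ext[of _ L L];
        simp add: zero tensor_add_closed tensor_smult_closed tensor_eval_add tensor_eval_smult tensor_eval_zero)+
  have act: "act x \<zero>\<^bsub>V\<^esub> = \<zero>\<^bsub>V\<^esub>" if "x \<in> carrier L" for x
    using act_add_right[OF that zero zero] add act_closed[OF that zero] tensor_idem_zero by metis
  have minus: "\<zero>\<^bsub>V\<^esub> = \<zero>\<^bsub>V\<^esub> \<ominus>\<^bsub>V\<^esub> \<zero>\<^bsub>V\<^esub>"
    using zero by (simp add: tensor_minus flip: add smult)
  show ?thesis
    unfolding lie_derivation_def linear_between_def
    by (auto simp: L_simps act zero simp flip: add smult minus)
qed

text \<open>
  Inner derivations and derivations coincide, so the quotient is that of a group by itself: every
  coset of \<open>Inn\<close> is \<open>Inn\<close>.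
\<close>

lemma H1_zero: "carrier (H1 L V act) = {\<zero>\<^bsub>H1 L V act\<^esub>}"
proof -
  let ?M = "Der_module L V act"
  have mem: "E \<in> carrier ?M \<longleftrightarrow> E \<in> extensional (carrier L) \<and> lie_derivation L V act E" for E
    by (simp add: Der_module_def)
  have add: "D \<oplus>\<^bsub>?M\<^esub> E = (\<lambda>x\<in>carrier L. D x \<oplus>\<^bsub>V\<^esub> E x)" for D E
    by (simp add: Der_module_def)
  have V_closed: "E x \<in> carrier V" if "E \<in> carrier ?M" "x \<in> carrier L" for E x
    using that by (auto simp: mem lie_derivation_def linear_between_def)
  have cancel: "S \<oplus>\<^bsub>V\<^esub> (- 1) \<odot>\<^bsub>V\<^esub> T \<oplus>\<^bsub>V\<^esub> T = S" if "S \<in> carrier V" "T \<in> carrier V" for S T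
    using that by (intro tensor_ext[of _ L L]) (simp_all add: tensor_eval_add tensor_eval_smult tensor_add_closed tensor_smult_closed)
  have one: "1 \<odot>\<^bsub>V\<^esub> T = T" if "T \<in> carrier V" for T
    using that by (intro tensor_ext[of _ L L]) (simp_all add: tensor_eval_smult tensor_smult_closed)
  have zero: "(\<lambda>x\<in>carrier L. \<zero>\<^bsub>V\<^esub>) \<in> carrier ?M"
    using lie_derivation_zero by (simp add: mem)
  have coset: "Inn L V act +>\<^bsub>?M\<^esub> E = Inn L V act" if E: "E \<in> carrier ?M" for E
  proof (intro equalityI subsetI)
    fix D' assume "D' \<in> Inn L V act +>\<^bsub>?M\<^esub> E"
    then obtain D where D: "D \<in> carrier ?M" "D' = D \<oplus>\<^bsub>?M\<^esub> E"
      unfolding Inn_eq_Der a_r_coset_def' by blast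
    have "lie_derivation L V act D'"
    proof (rule lie_derivation_lincomb[of D E D' 1])
      show "D' x = D x \<oplus>\<^bsub>V\<^esub> 1 \<odot>\<^bsub>V\<^esub> E x" if "x \<in> carrier L" for x
        using that by (simp add: D(2) add one V_closed[OF E])
    qed (use D(1) E in \<open>simp_all add: mem\<close>)
    then show "D' \<in> Inn L V act"
      unfolding Inn_eq_Der mem using D(2) by (simp add: add)
  next
    fix D assume "D \<in> Inn L V act"
    then have D: "D \<in> carrier ?M"
      by (simp add: Inn_eq_Der)
    let ?D' = "\<lambda>x\<in>carrier L. D x \<oplus>\<^bsub>V\<^esub> (- 1) \<odot>\<^bsub>V\<^esub> E x"
    have "lie_derivation L V act ?D'"
      using D E by (intro lie_derivation_lincomb[of D E ?D' "- 1"]) (auto simp: mem)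
    then have "?D' \<in> carrier ?M"
      by (simp add: mem)
    moreover have "D = ?D' \<oplus>\<^bsub>?M\<^esub> E"
    proof (rule extensionalityI[of _ "carrier L"])
      show "D x = (?D' \<oplus>\<^bsub>?M\<^esub> E) x" if "x \<in> carrier L" for x
        using that by (simp add: add cancel V_closed[OF D] V_closed[OF E])
    qed (use D in \<open>simp_all add: mem add\<close>)
    ultimately show "D \<in> Inn L V act +>\<^bsub>?M\<^esub> E"
      unfolding Inn_eq_Der a_r_coset_def' by blast
  qed
  have "carrier (H1 L V act) = (\<lambda>E. Inn L V act +>\<^bsub>?M\<^esub> E) ` carrier ?M"
    by (auto simp: H1_def quotient_module_def A_RCOSETS_def')
  also have "\<dots> = {Inn L V act}"
    using coset zero by force
  also have "Inn L V act = \<zero>\<^bsub>H1 L V act\<^esub>"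
    by (simp add: H1_def quotient_module_def)
  finally show ?thesis .
qed

end

theorem proposition4p3:
  fixes \<Gamma> :: "'f::field_char_0 set"
    and A :: "('f, 'a) module"
  assumes "additive_subgroup \<Gamma> (ring_of_type_algebra :: 'f ring)"
    and "1 \<in> \<Gamma>"
    and "algebra (ring_of_type_algebra :: 'f ring) A"
    and "domain (tensor_product A A)"
  shows "let L = map_virasoro \<Gamma> A;
             V = tensor_product L L;
             act = adjoint_diagonal_action L
         in (\<forall>D. lie_derivation L V act D \<longrightarrow> inner_derivation L V act D) \<and>
            carrier (H1 L V act) = {\<zero>\<^bsub>H1 L V act\<^esub>}"
proof -
  interpret map_virasoro_algebra \<Gamma> A
    using additive_subgroup_type_algebra[OF assms(1)] algebra_type_algebra[OF assms(3)] assms(2)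
    by unfold_locales auto
  show ?thesis
    unfolding Let_def using derivation_inner H1_zero by blast
qed

end
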